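(* Let $G$ be a countable group, and let $\mathcal{T}_{\mathrm{ss}}$ be the set of minimal isometric actions of $G$ on $\mathbb{R}$-trees, modulo equivariant isometry, which are either irreducible or such that the tree is isometric to $\mathbb{R}$. Then two minimal trees $T,T'\in\mathcal{T}_{\mathrm{ss}}$ with the same length function are equivariantly isometric. Moreover, the equivariant Gromov topology and the axes topology agree on $\mathcal{T}_{\mathrm{ss}}$.
   Context: An $\mathbb{R}$-tree is a geodesic metric space in which any two distinct points are joined by a unique topological arc; all $\mathbb{R}$-trees carry an isometric action of $G$. The length function of $T$ is $\ell_T(g)=\min_{x\in T}d_T(x,gx)$, $g\in G$. An element is hyperbolic if it fixes no point; it then has an axis. The action is minimal if there is no proper invariant subtree, and irreducible if there exist hyperbolic elements $g,h$ whose axes have compact (possibly empty) intersection. The axes topology on $\mathcal{T}_{\mathrm{ss}}$ is the topology induced by the map $T\mapsto\ell_T$ from $\mathcal{T}_{\mathrm{ss}}$ to $\mathbb{R}^G$ (product topology). The equivariant Gromov topology is defined by the following neighbourhood basis: given a tree $T$, a number $\varepsilon>0$, a finite subset $A\subset G$ and points $x_1,\dots,x_n\in T$, the set $N_{\varepsilon,A,\{x_1,\dots,x_n\}}(T)$ consists of the trees $T'$ such that there exist $x'_1,\dots,x'_n\in T'$ with $|d_{T'}(x'_i,ax'_j)-d_T(x_i,ax_j)|\le\varepsilon$ for all $a\in A$ and all $i,j\in\{1,\dots,n\}$. *)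

theory Defs
  imports "HOL-Analysis.Analysis" "HOL-Algebra.Group_Action"
begin

section \<open>\<open>\<real>\<close>-trees\<close>

definition isometry_between ::
  "'a set \<Rightarrow> ('a \<Rightarrow> 'a \<Rightarrow> real) \<Rightarrow> 'b set \<Rightarrow> ('b \<Rightarrow> 'b \<Rightarrow> real) \<Rightarrow> ('a \<Rightarrow> 'b) \<Rightarrow> bool"
  where "isometry_between X d Y e f \<longleftrightarrow>
    bij_betw f X Y \<and> (\<forall>x\<in>X. \<forall>y\<in>X. e (f x) (f y) = d x y)"

definition geodesic_metric :: "'p set \<Rightarrow> ('p \<Rightarrow> 'p \<Rightarrow> real) \<Rightarrow> bool"
  where "geodesic_metric X d \<longleftrightarrow> Metric_space X d \<and>
    (\<forall>x\<in>X. \<forall>y\<in>X. \<exists>S \<gamma>. S \<subseteq> X \<and> isometry_between {0..d x y} dist S d \<gamma> \<and>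
                        \<gamma> 0 = x \<and> \<gamma> (d x y) = y)"

text \<open>Arcs are regarded as subsets, so that uniqueness is up to reparametrisation.\<close>

definition is_arc_between :: "'p set \<Rightarrow> ('p \<Rightarrow> 'p \<Rightarrow> real) \<Rightarrow> 'p \<Rightarrow> 'p \<Rightarrow> 'p set \<Rightarrow> bool"
  where "is_arc_between X d x y A \<longleftrightarrow>
    (\<exists>\<gamma>. embedding_map (top_of_set {0..1::real}) (Metric_space.mtopology X d) \<gamma> \<and>
         \<gamma> 0 = x \<and> \<gamma> 1 = y \<and> A = \<gamma> ` {0..1})"

text \<open>Trees, hence also subtrees, are nonempty; otherwise the empty set would be a proper
  invariant subtree of every tree.\<close>

definition R_tree :: "'p set \<Rightarrow> ('p \<Rightarrow> 'p \<Rightarrow> real) \<Rightarrow> bool"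
  where "R_tree X d \<longleftrightarrow> X \<noteq> {} \<and> geodesic_metric X d \<and>
    (\<forall>x\<in>X. \<forall>y\<in>X. x \<noteq> y \<longrightarrow> (\<exists>!A. is_arc_between X d x y A))"


section \<open>\<open>\<real>\<close>-trees with an isometric action\<close>

record ('g, 'p) gtree =
  pts :: "'p set"
  tdist :: "'p \<Rightarrow> 'p \<Rightarrow> real"
  act :: "'g \<Rightarrow> 'p \<Rightarrow> 'p"

definition is_gtree :: "('g, 'm) monoid_scheme \<Rightarrow> ('g, 'p) gtree \<Rightarrow> bool"
  where "is_gtree G T \<longleftrightarrow> R_tree (pts T) (tdist T) \<and> group_action G (pts T) (act T) \<and>
    (\<forall>g\<in>carrier G. isometry_between (pts T) (tdist T) (pts T) (tdist T) (act T g))"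

text \<open>The minimum is attained for every isometry of an \<open>\<real>\<close>-tree.  Functions on the group
  are extensional, so that \<open>length_function G T\<close> is a point of \<open>\<real>\<^sup>G\<close>.\<close>

definition length_function :: "('g, 'm) monoid_scheme \<Rightarrow> ('g, 'p) gtree \<Rightarrow> 'g \<Rightarrow> real"
  where "length_function G T =
    (\<lambda>g\<in>carrier G. LEAST r. r \<in> (\<lambda>x. tdist T x (act T g x)) ` pts T)"

definition hyperbolic :: "('g, 'p) gtree \<Rightarrow> 'g \<Rightarrow> bool"
  where "hyperbolic T g \<longleftrightarrow> (\<forall>x\<in>pts T. act T g x \<noteq> x)"

text \<open>An axis is an isometrically embedded line on which the element acts by translation.
  A hyperbolic element of an \<open>\<real>\<close>-tree has exactly one.\<close>

definition is_axis :: "('g, 'p) gtree \<Rightarrow> 'g \<Rightarrow> 'p set \<Rightarrow> bool"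
  where "is_axis T g L \<longleftrightarrow> L \<subseteq> pts T \<and>
    (\<exists>(f :: real \<Rightarrow> 'p) c. isometry_between UNIV dist L (tdist T) f \<and>
       (\<forall>t. act T g (f t) = f (t + c)))"

definition minimal_gtree :: "('g, 'm) monoid_scheme \<Rightarrow> ('g, 'p) gtree \<Rightarrow> bool"
  where "minimal_gtree G T \<longleftrightarrow>
    \<not> (\<exists>S. S \<subset> pts T \<and> R_tree S (tdist T) \<and> (\<forall>g\<in>carrier G. act T g ` S \<subseteq> S))"

definition irreducible_gtree :: "('g, 'm) monoid_scheme \<Rightarrow> ('g, 'p) gtree \<Rightarrow> bool"
  where "irreducible_gtree G T \<longleftrightarrow>
    (\<exists>g\<in>carrier G. \<exists>h\<in>carrier G. \<exists>L M. hyperbolic T g \<and> hyperbolic T h \<and>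
       is_axis T g L \<and> is_axis T h M \<and>
       compactin (Metric_space.mtopology (pts T) (tdist T)) (L \<inter> M))"

definition isometric_to_line :: "('g, 'p) gtree \<Rightarrow> bool"
  where "isometric_to_line T \<longleftrightarrow>
    (\<exists>f :: real \<Rightarrow> 'p. isometry_between UNIV dist (pts T) (tdist T) f)"

definition equivariantly_isometric ::
  "('g, 'm) monoid_scheme \<Rightarrow> ('g, 'p) gtree \<Rightarrow> ('g, 'p) gtree \<Rightarrow> bool"
  where "equivariantly_isometric G T T' \<longleftrightarrow>
    (\<exists>f. isometry_between (pts T) (tdist T) (pts T') (tdist T') f \<and>
       (\<forall>g\<in>carrier G. \<forall>x\<in>pts T. f (act T g x) = act T' g (f x)))"


section \<open>The space \<open>\<T>\<^sub>s\<^sub>s\<close> and its two topologies\<close>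

text \<open>Trees have their points in an arbitrary type \<open>'p\<close>.  For a countable group, a minimal tree
  that is irreducible or a line is the union of countably many axes, so it has the cardinality
  of the continuum; hence as soon as \<open>'p\<close> is at least as large as \<open>real\<close>, every such tree is
  represented up to equivariant isometry.\<close>

definition ss_trees :: "('g, 'm) monoid_scheme \<Rightarrow> ('g, 'p) gtree set"
  where "ss_trees G =
    {T. is_gtree G T \<and> minimal_gtree G T \<and> (irreducible_gtree G T \<or> isometric_to_line T)}"

definition eqiso_rel :: "('g, 'm) monoid_scheme \<Rightarrow> (('g, 'p) gtree \<times> ('g, 'p) gtree) set"
  where "eqiso_rel G =
    {(T, T'). T \<in> ss_trees G \<and> T' \<in> ss_trees G \<and> equivariantly_isometric G T T'}"

definition Tss :: "('g, 'm) monoid_scheme \<Rightarrow> ('g, 'p) gtree set set"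
  where "Tss G = ss_trees G // eqiso_rel G"

text \<open>The length function is constant on classes, so this is the map \<open>\<T>\<^sub>s\<^sub>s \<rightarrow> \<real>\<^sup>G\<close> induced on
  the quotient; see \<open>length_function_class\<close> below.\<close>

definition class_length_function ::
  "('g, 'm) monoid_scheme \<Rightarrow> ('g, 'p) gtree set \<Rightarrow> 'g \<Rightarrow> real"
  where "class_length_function G C = the_elem (length_function G ` C)"

definition axes_topology :: "('g, 'm) monoid_scheme \<Rightarrow> ('g, 'p) gtree set topology"
  where "axes_topology G =
    pullback_topology (Tss G) (class_length_function G)
      (product_topology (\<lambda>_. euclideanreal) (carrier G))"

definition gromov_nbhd ::
  "('g, 'm) monoid_scheme \<Rightarrow> ('g, 'p) gtree \<Rightarrow> real \<Rightarrow> 'g set \<Rightarrow> nat \<Rightarrow> (nat \<Rightarrow> 'p)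
    \<Rightarrow> ('g, 'p) gtree set set"
  where "gromov_nbhd G T \<epsilon> A n x =
    {C' \<in> Tss G. \<exists>T'\<in>C'. \<exists>x'. (\<forall>i\<in>{1..n}. x' i \<in> pts T') \<and>
       (\<forall>a\<in>A. \<forall>i\<in>{1..n}. \<forall>j\<in>{1..n}.
          \<bar>tdist T' (x' i) (act T' a (x' j)) - tdist T (x i) (act T a (x j))\<bar> \<le> \<epsilon>)}"

text \<open>The topology in which the sets \<open>gromov_nbhd G T \<epsilon> A n x\<close> form a neighbourhood basis at
  the class of \<open>T\<close>; see \<open>gromov_nbhd_is_nbhd\<close> below.\<close>

definition gromov_open :: "('g, 'm) monoid_scheme \<Rightarrow> ('g, 'p) gtree set set \<Rightarrow> bool"
  where "gromov_open G U \<longleftrightarrow> U \<subseteq> Tss G \<and>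
    (\<forall>C\<in>U. \<forall>T\<in>C. \<exists>\<epsilon> A n x. \<epsilon> > 0 \<and> finite A \<and> A \<subseteq> carrier G \<and>
       (\<forall>i\<in>{1..n}. x i \<in> pts T) \<and> gromov_nbhd G T \<epsilon> A n x \<subseteq> U)"

definition equivariant_gromov_topology ::
  "('g, 'm) monoid_scheme \<Rightarrow> ('g, 'p) gtree set topology"
  where "equivariant_gromov_topology G = topology (gromov_open G)"


section \<open>Well-definedness\<close>

lemma act_closed:
  assumes "is_gtree G T" "g \<in> carrier G" "x \<in> pts T"
  shows "act T g x \<in> pts T"
  using assms unfolding is_gtree_def isometry_between_def bij_betw_def by blast

lemma equivariantly_isometric_refl: "equivariantly_isometric G T T"
  unfolding equivariantly_isometric_def isometry_between_def
  by (rule exI[of _ "\<lambda>x. x"]) (auto simp: bij_betw_def inj_on_def)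

lemma equivariantly_isometric_sym:
  assumes "is_gtree G T" "equivariantly_isometric G T T'"
  shows "equivariantly_isometric G T' T"
proof -
  obtain f where b: "bij_betw f (pts T) (pts T')"
    and i: "\<And>x y. x \<in> pts T \<Longrightarrow> y \<in> pts T \<Longrightarrow> tdist T' (f x) (f y) = tdist T x y"
    and e: "\<And>g x. g \<in> carrier G \<Longrightarrow> x \<in> pts T \<Longrightarrow> f (act T g x) = act T' g (f x)"
    using assms(2) unfolding equivariantly_isometric_def isometry_between_def by blast
  define h where "h = inv_into (pts T) f"
  have h: "h y \<in> pts T" "f (h y) = y" if "y \<in> pts T'" for y
    using b that unfolding h_def by (auto simp: bij_betw_def inv_into_into f_inv_into_f)
  have hf: "h (f x) = x" if "x \<in> pts T" for x
    using b that unfolding h_def by (auto simp: bij_betw_def)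
  have "bij_betw h (pts T') (pts T)"
    unfolding h_def by (rule bij_betw_inv_into[OF b])
  moreover have "tdist T (h x) (h y) = tdist T' x y" if "x \<in> pts T'" "y \<in> pts T'" for x y
    using i[of "h x" "h y"] h that by simp
  moreover have "h (act T' g y) = act T g (h y)" if "g \<in> carrier G" "y \<in> pts T'" for g y
    using e[of g "h y"] h[of y] hf[of "act T g (h y)"] act_closed[OF assms(1), of g "h y"] that
    by simp
  ultimately show ?thesis
    unfolding equivariantly_isometric_def isometry_between_def by blast
qed

lemma equivariantly_isometric_trans:
  assumes "equivariantly_isometric G T T'" "equivariantly_isometric G T' T''"
  shows "equivariantly_isometric G T T''"
proof -
  obtain f where f: "bij_betw f (pts T) (pts T')"
    "\<And>x y. x \<in> pts T \<Longrightarrow> y \<in> pts T \<Longrightarrow> tdist T' (f x) (f y) = tdist T x y"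
    "\<And>g x. g \<in> carrier G \<Longrightarrow> x \<in> pts T \<Longrightarrow> f (act T g x) = act T' g (f x)"
    using assms(1) unfolding equivariantly_isometric_def isometry_between_def by blast
  obtain h where h: "bij_betw h (pts T') (pts T'')"
    "\<And>x y. x \<in> pts T' \<Longrightarrow> y \<in> pts T' \<Longrightarrow> tdist T'' (h x) (h y) = tdist T' x y"
    "\<And>g x. g \<in> carrier G \<Longrightarrow> x \<in> pts T' \<Longrightarrow> h (act T' g x) = act T'' g (h x)"
    using assms(2) unfolding equivariantly_isometric_def isometry_between_def by blast
  have fc: "f x \<in> pts T'" if "x \<in> pts T" for x
    using f(1) that by (auto simp: bij_betw_def)
  show ?thesis
    unfolding equivariantly_isometric_def isometry_between_def
  proof (intro exI[of _ "h \<circ> f"] conjI ballI)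
    show "bij_betw (h \<circ> f) (pts T) (pts T'')"
      by (rule bij_betw_trans[OF f(1) h(1)])
  qed (simp_all add: f h fc)
qed

lemma equiv_eqiso_rel: "equiv (ss_trees G) (eqiso_rel G)"
proof (rule equivI)
  show "eqiso_rel G \<subseteq> ss_trees G \<times> ss_trees G"
    by (auto simp: eqiso_rel_def)
  show "refl_on (ss_trees G) (eqiso_rel G)"
    by (auto simp: refl_on_def eqiso_rel_def equivariantly_isometric_refl)
  show "sym (eqiso_rel G)"
    by (auto simp: sym_def eqiso_rel_def ss_trees_def intro: equivariantly_isometric_sym)
  show "trans (eqiso_rel G)"
    by (auto simp: trans_def eqiso_rel_def intro: equivariantly_isometric_trans)
qed

lemma Tss_cases:
  assumes "C \<in> Tss G" "T \<in> C"
  shows "T \<in> ss_trees G" "C = eqiso_rel G `` {T}"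
  using assms equiv_eqiso_rel[of G] unfolding Tss_def
  by (auto elim!: quotientE dest: equiv_class_eq simp: eqiso_rel_def)

lemma Tss_eqiso:
  assumes "C \<in> Tss G" "T \<in> C" "T' \<in> C"
  shows "equivariantly_isometric G T T'"
  using Tss_cases(2)[OF assms(1,2)] assms(3) by (auto simp: eqiso_rel_def)

lemma length_function_cong:
  assumes "is_gtree G T" "equivariantly_isometric G T T'"
  shows "length_function G T = length_function G T'"
proof -
  obtain f where f: "bij_betw f (pts T) (pts T')"
    "\<And>x y. x \<in> pts T \<Longrightarrow> y \<in> pts T \<Longrightarrow> tdist T' (f x) (f y) = tdist T x y"
    "\<And>g x. g \<in> carrier G \<Longrightarrow> x \<in> pts T \<Longrightarrow> f (act T g x) = act T' g (f x)"
    using assms(2) unfolding equivariantly_isometric_def isometry_between_def by blast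
  have "(\<lambda>x. tdist T x (act T g x)) ` pts T = (\<lambda>x. tdist T' x (act T' g x)) ` pts T'"
    if g: "g \<in> carrier G" for g
  proof -
    have "tdist T' (f x) (act T' g (f x)) = tdist T x (act T g x)" if "x \<in> pts T" for x
      using f(2)[OF that act_closed[OF assms(1) g that]] f(3)[OF g that] by simp
    then have "(\<lambda>x. tdist T' x (act T' g x)) ` (f ` pts T) = (\<lambda>x. tdist T x (act T g x)) ` pts T"
      unfolding image_image by (intro image_cong) auto
    then show ?thesis
      using f(1) by (simp add: bij_betw_def)
  qed
  then show ?thesis
    unfolding length_function_def by (intro restrict_ext) simp
qed

lemma length_function_class:
  assumes "C \<in> Tss G" "T \<in> C"
  shows "class_length_function G C = length_function G T"
proof -
  have "length_function G T' = length_function G T" if "T' \<in> C" for T'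
    using length_function_cong[of G T T'] Tss_eqiso[OF assms that] Tss_cases(1)[OF assms]
    by (simp add: ss_trees_def)
  then have "length_function G ` C = {length_function G T}"
    using assms(2) by blast
  then show ?thesis
    by (simp add: class_length_function_def)
qed

lemma gromov_openE:
  assumes "gromov_open G U" "C \<in> U" "T \<in> C"
  obtains \<epsilon> A n x where "\<epsilon> > 0" "finite A" "A \<subseteq> carrier G" "\<forall>i\<in>{1..n}. x i \<in> pts T"
    "gromov_nbhd G T \<epsilon> A n x \<subseteq> U"
proof -
  have "\<forall>C\<in>U. \<forall>T\<in>C. \<exists>\<epsilon> A n x. \<epsilon> > 0 \<and> finite A \<and> A \<subseteq> carrier G \<and>
       (\<forall>i\<in>{1..n}. x i \<in> pts T) \<and> gromov_nbhd G T \<epsilon> A n x \<subseteq> U"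
    using assms(1) unfolding gromov_open_def by (rule conjunct2)
  from bspec[OF bspec[OF this assms(2)] assms(3)] show thesis
    by (elim exE conjE) (rule that)
qed

lemma istopology_gromov_open:
  "istopology (gromov_open G :: ('a, 'c) gtree set set \<Rightarrow> bool)"
  unfolding istopology_def
proof (intro conjI allI impI)
  fix U V :: "('a, 'c) gtree set set"
  assume U: "gromov_open G U" and V: "gromov_open G V"
  show "gromov_open G (U \<inter> V)"
    unfolding gromov_open_def
  proof (intro conjI ballI)
    show "U \<inter> V \<subseteq> Tss G"
      using U by (auto simp: gromov_open_def)
    fix C T assume C: "C \<in> U \<inter> V" and T: "T \<in> C"
    from C have CU: "C \<in> U" and CV: "C \<in> V" by simp_all
    obtain e A n x where 1: "e > 0" "finite A" "A \<subseteq> carrier G" "\<forall>i\<in>{1..n}. x i \<in> pts T"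
      "gromov_nbhd G T e A n x \<subseteq> U"
      by (rule gromov_openE[OF U CU T])
    obtain e' A' n' x' where 2: "e' > 0" "finite A'" "A' \<subseteq> carrier G"
      "\<forall>i\<in>{1..n'}. x' i \<in> pts T" "gromov_nbhd G T e' A' n' x' \<subseteq> V"
      by (rule gromov_openE[OF V CV T])
    define y where "y i = (if i \<le> n then x i else x' (i - n))" for i
    have y: "\<forall>i\<in>{1..n + n'}. y i \<in> pts T"
    proof
      fix i assume i: "i \<in> {1..n + n'}"
      then have "i - n \<in> {1..n'}" if "\<not> i \<le> n" using that by auto
      then show "y i \<in> pts T"
        using 1(4) 2(4) i by (simp add: y_def)
    qed
    have "gromov_nbhd G T (min e e') (A \<union> A') (n + n') y \<subseteq> gromov_nbhd G T e A n x"
    proof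
      fix D assume "D \<in> gromov_nbhd G T (min e e') (A \<union> A') (n + n') y"
      then obtain S z where D: "D \<in> Tss G" "S \<in> D" "\<forall>i\<in>{1..n+n'}. z i \<in> pts S"
        "\<forall>a\<in>A \<union> A'. \<forall>i\<in>{1..n+n'}. \<forall>j\<in>{1..n+n'}.
          \<bar>tdist S (z i) (act S a (z j)) - tdist T (y i) (act T a (y j))\<bar> \<le> min e e'"
        unfolding gromov_nbhd_def by blast
      have "\<bar>tdist S (z i) (act S a (z j)) - tdist T (x i) (act T a (x j))\<bar> \<le> e"
        if "a \<in> A" "i \<in> {1..n}" "j \<in> {1..n}" for a i j
        using D(4)[rule_format, of a i j] that by (auto simp: y_def)
      moreover have "\<forall>i\<in>{1..n}. z i \<in> pts S"
        using D(3) by auto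
      ultimately show "D \<in> gromov_nbhd G T e A n x"
        using D(1,2) unfolding gromov_nbhd_def by blast
    qed
    moreover have "gromov_nbhd G T (min e e') (A \<union> A') (n + n') y \<subseteq> gromov_nbhd G T e' A' n' x'"
    proof
      fix D assume "D \<in> gromov_nbhd G T (min e e') (A \<union> A') (n + n') y"
      then obtain S z where D: "D \<in> Tss G" "S \<in> D" "\<forall>i\<in>{1..n+n'}. z i \<in> pts S"
        "\<forall>a\<in>A \<union> A'. \<forall>i\<in>{1..n+n'}. \<forall>j\<in>{1..n+n'}.
          \<bar>tdist S (z i) (act S a (z j)) - tdist T (y i) (act T a (y j))\<bar> \<le> min e e'"
        unfolding gromov_nbhd_def by blast
      have "\<bar>tdist S (z (n + i)) (act S a (z (n + j))) - tdist T (x' i) (act T a (x' j))\<bar> \<le> e'"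
        if "a \<in> A'" "i \<in> {1..n'}" "j \<in> {1..n'}" for a i j
        using D(4)[rule_format, of a "n + i" "n + j"] that by (auto simp: y_def)
      moreover have "\<forall>i\<in>{1..n'}. z (n + i) \<in> pts S"
        using D(3) by auto
      ultimately show "D \<in> gromov_nbhd G T e' A' n' x'"
        using D(1,2) unfolding gromov_nbhd_def
        by (intro CollectI conjI bexI[of _ S] exI[of _ "\<lambda>i. z (n + i)"]) blast+
    qed
    ultimately have "gromov_nbhd G T (min e e') (A \<union> A') (n + n') y \<subseteq> U \<inter> V"
      using 1(5) 2(5) by blast
    then show "\<exists>\<epsilon> A n x. \<epsilon> > 0 \<and> finite A \<and> A \<subseteq> carrier G \<and>
       (\<forall>i\<in>{1..n}. x i \<in> pts T) \<and> gromov_nbhd G T \<epsilon> A n x \<subseteq> U \<inter> V"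
      using 1(1-3) 2(1-3) y
      by (intro exI[of _ "min e e'"] exI[of _ "A \<union> A'"] exI[of _ "n + n'"] exI[of _ y]) auto
  qed
next
  fix K :: "('a, 'c) gtree set set set"
  assume K: "\<forall>U\<in>K. gromov_open G U"
  show "gromov_open G (\<Union>K)"
    unfolding gromov_open_def
  proof (intro conjI ballI)
    show "\<Union>K \<subseteq> Tss G"
      using K by (auto simp: gromov_open_def)
    fix C T assume "C \<in> \<Union>K" and T: "T \<in> C"
    then obtain U where U: "U \<in> K" "C \<in> U" by blast
    have "gromov_open G U" using K U(1) by blast
    then obtain e A n x where "e > 0" "finite A" "A \<subseteq> carrier G" "\<forall>i\<in>{1..n}. x i \<in> pts T"
      "gromov_nbhd G T e A n x \<subseteq> U"
      by (rule gromov_openE[OF _ U(2) T])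
    moreover have "U \<subseteq> \<Union>K" using U(1) by blast
    ultimately have "e > 0 \<and> finite A \<and> A \<subseteq> carrier G \<and>
      (\<forall>i\<in>{1..n}. x i \<in> pts T) \<and> gromov_nbhd G T e A n x \<subseteq> \<Union>K"
      by blast
    then show "\<exists>\<epsilon> A n x. \<epsilon> > 0 \<and> finite A \<and> A \<subseteq> carrier G \<and>
       (\<forall>i\<in>{1..n}. x i \<in> pts T) \<and> gromov_nbhd G T \<epsilon> A n x \<subseteq> \<Union>K"
      by (intro exI)
  qed
qed

lemma openin_equivariant_gromov_topology:
  "openin (equivariant_gromov_topology G) U \<longleftrightarrow> gromov_open G U"
  unfolding equivariant_gromov_topology_def
  by (simp add: istopology_gromov_open)

lemma gromov_nbhd_is_nbhd:
  assumes C: "C \<in> Tss G" "T \<in> C" and e: "\<epsilon> > 0" and A: "finite A" "A \<subseteq> carrier G"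
    and x: "\<forall>i\<in>{1..n}. x i \<in> pts T"
  shows "\<exists>U. openin (equivariant_gromov_topology G) U \<and> C \<in> U \<and> U \<subseteq> gromov_nbhd G T \<epsilon> A n x"
proof -
  define U where "U = (\<Union>\<delta>\<in>{0<..<\<epsilon>}. gromov_nbhd G T \<delta> A n x)"
  have "C \<in> gromov_nbhd G T (\<epsilon>/2) A n x"
    unfolding gromov_nbhd_def using C e x by (auto intro!: bexI[of _ T] exI[of _ x])
  then have "C \<in> U"
    unfolding U_def using e by (auto intro!: bexI[of _ "\<epsilon>/2"])
  moreover have "U \<subseteq> gromov_nbhd G T \<epsilon> A n x"
  proof
    fix D assume "D \<in> U"
    then obtain \<delta> where \<delta>: "0 < \<delta>" "\<delta> < \<epsilon>" "D \<in> gromov_nbhd G T \<delta> A n x"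
      by (auto simp: U_def)
    then obtain S z where D: "D \<in> Tss G" "S \<in> D" "\<forall>i\<in>{1..n}. z i \<in> pts S"
      "\<And>a i j. a \<in> A \<Longrightarrow> i \<in> {1..n} \<Longrightarrow> j \<in> {1..n} \<Longrightarrow>
        \<bar>tdist S (z i) (act S a (z j)) - tdist T (x i) (act T a (x j))\<bar> \<le> \<delta>"
      unfolding gromov_nbhd_def by blast
    then have "\<bar>tdist S (z i) (act S a (z j)) - tdist T (x i) (act T a (x j))\<bar> \<le> \<epsilon>"
      if "a \<in> A" "i \<in> {1..n}" "j \<in> {1..n}" for a i j
      using D(4)[OF that] \<delta>(2) by linarith
    then show "D \<in> gromov_nbhd G T \<epsilon> A n x"
      using D(1-3) unfolding gromov_nbhd_def by blast
  qed
  moreover have "gromov_open G U"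
    unfolding gromov_open_def
  proof (intro conjI ballI)
    show "U \<subseteq> Tss G"
      by (auto simp: U_def gromov_nbhd_def)
    fix D R assume "D \<in> U" and R: "R \<in> D"
    then obtain \<delta> where \<delta>: "0 < \<delta>" "\<delta> < \<epsilon>" "D \<in> gromov_nbhd G T \<delta> A n x"
      by (auto simp: U_def)
    then obtain S z where D: "D \<in> Tss G" "S \<in> D" "\<And>i. i \<in> {1..n} \<Longrightarrow> z i \<in> pts S"
      "\<And>a i j. a \<in> A \<Longrightarrow> i \<in> {1..n} \<Longrightarrow> j \<in> {1..n} \<Longrightarrow>
        \<bar>tdist S (z i) (act S a (z j)) - tdist T (x i) (act T a (x j))\<bar> \<le> \<delta>"
      unfolding gromov_nbhd_def by blast
    have S: "is_gtree G S"
      using Tss_cases(1)[OF D(1,2)] by (simp add: ss_trees_def)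
    obtain f where f: "bij_betw f (pts S) (pts R)"
      "\<And>x y. x \<in> pts S \<Longrightarrow> y \<in> pts S \<Longrightarrow> tdist R (f x) (f y) = tdist S x y"
      "\<And>g x. g \<in> carrier G \<Longrightarrow> x \<in> pts S \<Longrightarrow> f (act S g x) = act R g (f x)"
      using Tss_eqiso[OF D(1,2) R] unfolding equivariantly_isometric_def isometry_between_def
      by blast
    define w where "w i = f (z i)" for i
    have w: "\<forall>i\<in>{1..n}. w i \<in> pts R"
      using f(1) D(3) by (auto simp: w_def bij_betw_def)
    have dw: "tdist R (w i) (act R a (w j)) = tdist S (z i) (act S a (z j))"
      if "a \<in> A" "i \<in> {1..n}" "j \<in> {1..n}" for a i j
    proof -
      have a: "a \<in> carrier G" using A that by blast
      show ?thesis
        unfolding w_def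
        using f(2)[of "z i" "act S a (z j)"] f(3)[OF a D(3)[OF that(3)]] D(3) that
          act_closed[OF S a D(3)[OF that(3)]] by simp
    qed
    have "gromov_nbhd G R ((\<epsilon> - \<delta>)/2) A n w \<subseteq> gromov_nbhd G T ((\<epsilon> + \<delta>)/2) A n x"
    proof
      fix E assume "E \<in> gromov_nbhd G R ((\<epsilon> - \<delta>)/2) A n w"
      then obtain Q v where E: "E \<in> Tss G" "Q \<in> E" "\<forall>i\<in>{1..n}. v i \<in> pts Q"
        "\<And>a i j. a \<in> A \<Longrightarrow> i \<in> {1..n} \<Longrightarrow> j \<in> {1..n} \<Longrightarrow>
          \<bar>tdist Q (v i) (act Q a (v j)) - tdist R (w i) (act R a (w j))\<bar> \<le> (\<epsilon> - \<delta>)/2"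
        unfolding gromov_nbhd_def by blast
      have "\<bar>tdist Q (v i) (act Q a (v j)) - tdist T (x i) (act T a (x j))\<bar> \<le> (\<epsilon> + \<delta>)/2"
        if "a \<in> A" "i \<in> {1..n}" "j \<in> {1..n}" for a i j
      proof -
        have "(\<epsilon> + \<delta>)/2 = (\<epsilon> - \<delta>)/2 + \<delta>" by (simp add: field_simps)
        then show ?thesis
          using E(4)[OF that] D(4)[OF that] dw[OF that] by linarith
      qed
      then show "E \<in> gromov_nbhd G T ((\<epsilon> + \<delta>)/2) A n x"
        using E(1-3) unfolding gromov_nbhd_def by blast
    qed
    also have "\<dots> \<subseteq> U"
      unfolding U_def using \<delta>(1,2) by (intro UN_upper) auto
    finally show "\<exists>\<epsilon> A n x. \<epsilon> > 0 \<and> finite A \<and> A \<subseteq> carrier G \<and>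
       (\<forall>i\<in>{1..n}. x i \<in> pts R) \<and> gromov_nbhd G R \<epsilon> A n x \<subseteq> U"
      using \<delta>(2) A w
      by (intro exI[of _ "(\<epsilon> - \<delta>)/2"] exI[of _ A] exI[of _ n] exI[of _ w]) auto
  qed
  ultimately show ?thesis
    by (auto simp: openin_equivariant_gromov_topology)
qed

end

theory Submission
  imports Defs
begin

text \<open>By the four-point condition, an isometry \<open>g\<close> of an \<open>\<real>\<close>-tree has translation length
  \<open>max 0 (d(x, g\<^sup>2x) - d(x, gx))\<close> for every point \<open>x\<close>, so length functions are continuous in the
  Gromov topology.  Conversely, the sets \<open>{y. d(y, sy) \<le> r\<^sub>s}\<close> are convex, and two of them meet as soon
  as they are nonempty and \<open>\<ell>(ts) \<le> r\<^sub>s + r\<^sub>t\<close>.  By Helly's theorem for trees, a point \<open>x \<in> T\<close> and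
  finitely many group elements give a point \<open>x'\<close> in any tree \<open>T'\<close> with nearby length function whose
  displacements are at most slightly larger than those of \<open>x\<close>.  If \<open>x\<close> is chosen such that for every
  \<open>s\<close> there is \<open>t\<close> with \<open>d(x, sx) + d(x, tx) = \<ell>(st)\<close>, these upper bounds also yield lower bounds.
  By minimality \<open>T\<close> is the hull of the orbit of \<open>x\<close>, so its geometry is recovered from the displacements
  of \<open>x\<close>.  When the length functions agree and \<open>T\<close> is irreducible, finitely many displacements already
  determine \<open>x'\<close>, and matching the two orbits extends to an equivariant isometry.\<close>

section \<open>Metric trees and the four-point condition\<close>

text \<open>Uniqueness of arcs serves to derive the four-point inequality and to recognise convex
  subsets as subtrees. Everything else about segments, projections and axes is a computation with
  finitely many distances, and this is what allows two trees to be compared approximately. Taut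
  points have two sources. In an irreducible tree, conjugating one hyperbolic element by a power of
  the other gives two elements with disjoint axes; the foot of the bridge between the axes is a
  point that the two elements and their inverses leave in enough different directions to be aligned
  with any given \<open>s\<close>. A line has only two directions; there the fixed point of a
  reflection is taut, or every point if no element reflects. For equal length functions the obstacle
  is that Helly's theorem covers only finite families and the trees need not be complete, so a point
  with all the prescribed displacements cannot be obtained as a limit. A pair of elements as above
  pins the point down, so that the points found for different finite families coincide.\<close>

locale metric_tree = Metric_space X d for X :: "'p set" and d +
  assumes segment_point: "\<lbrakk>x \<in> X; y \<in> X; 0 \<le> t; t \<le> d x y\<rbrakk> \<Longrightarrow> \<exists>z\<in>X. d x z = t \<and> d z y = d x y - t"
    and four_point: "\<lbrakk>x \<in> X; y \<in> X; z \<in> X; w \<in> X\<rbrakk> \<Longrightarrow>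
      d x y + d z w \<le> max (d x z + d y w) (d x w + d y z)"
begin

definition between :: "'p \<Rightarrow> 'p \<Rightarrow> 'p \<Rightarrow> bool"
  where "between p q r \<longleftrightarrow> d p q + d q r = d p r"

lemma between_sym: "between p q r \<longleftrightarrow> between r q p"
  unfolding between_def using commute[of p q] commute[of q r] commute[of p r] by auto

text \<open>The triangle inequality gives \<ge>; the four-point inequality for \<open>c, p\<close>
  against \<open>a, b\<close> gives \<le>. A point of a segment thus has its distance to any other
  point fixed by the distances from the two ends, on which every later transfer between trees
  rests.\<close>

lemma dist_to_segment:
  assumes "a \<in> X" "b \<in> X" "c \<in> X" "p \<in> X" "between a c b"
  shows "d c p = max (d a p - d a c) (d b p - d c b)"
  using four_point[of c p a b] assms triangle[of a c p] triangle[of b c p]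
    commute[of a c] commute[of c b] commute[of p b] commute[of p a]
  unfolding between_def by (simp add: max_def split: if_splits)

lemma between_unique:
  assumes "a \<in> X" "b \<in> X" "c \<in> X" "c' \<in> X" "between a c b" "between a c' b" "d a c = d a c'"
  shows "c = c'"
proof -
  have "d c c' = 0"
    using dist_to_segment[of a b c c'] assms commute[of b c'] unfolding between_def by simp
  then show ?thesis using assms zero by simp
qed

text \<open>Overlapping segments glue: in the four-point inequality for \<open>p, w\<close> against
  \<open>q, z\<close>, the alternative \<open>d p q + d w z\<close> is excluded by the positive
  overlap \<open>d q w\<close>. Long geodesics are assembled from local data in this way.\<close>

lemma chain:
  assumes "p \<in> X" "q \<in> X" "w \<in> X" "z \<in> X" "between p q w" "between q w z" "q \<noteq> w"
  shows "d p z = d p q + d q w + d w z"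
proof -
  have "d q w > 0" using assms by (simp add: mdist_pos_less)
  then show ?thesis
    using four_point[of p w q z] assms triangle[of p q z] triangle[of p w z]
      commute[of w q] commute[of w z]
    unfolding between_def by (smt (verit))
qed

text \<open>\<open>between a q b\<close> says that \<open>a\<close> and \<open>b\<close> lie in different directions at \<open>q\<close>, or that one
  of them is \<open>q\<close>.\<close>

lemma between_or:
  assumes "a \<in> X" "b \<in> X" "c \<in> X" "q \<in> X" "between a q c"
  shows "between a q b \<or> between b q c"
  using four_point[of a c b q] assms triangle[of a q b] triangle[of b q c]
    commute[of c b] commute[of c q] commute[of b q]
  unfolding between_def by (simp add: max_def split: if_splits)

lemma median:
  assumes "x \<in> X" "y \<in> X" "z \<in> X"
  obtains m where "m \<in> X" "between x m y" "between y m z" "between x m z"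
proof -
  \<comment> \<open>The Gromov product of \<open>y\<close> and \<open>z\<close> at \<open>x\<close>:
    the distance from \<open>x\<close> at which the segments to \<open>y\<close> and to
    \<open>z\<close> part.\<close>
  let ?t = "(d x y + d x z - d y z) / 2"
  have "0 \<le> ?t" "?t \<le> d x y"
    using triangle[of y x z] triangle[of x y z] commute[of x y] assms by auto
  then obtain m where m: "m \<in> X" "d x m = ?t" "d m y = d x y - ?t"
    using segment_point assms by blast
  have "between x m y" using m by (simp add: between_def)
  from dist_to_segment[OF _ _ _ _ this, of z] m assms
  have "d m z = (d x z + d y z - d x y) / 2" by simp argo
  then show thesis
    using m commute[of m y] by (intro that[of m]) (simp_all add: between_def field_simps)
qed

section \<open>Convex sets and Helly's theorem\<close>

definition convex_in :: "'p set \<Rightarrow> bool"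
  where "convex_in S \<longleftrightarrow> S \<subseteq> X \<and> (\<forall>a\<in>S. \<forall>b\<in>S. \<forall>c\<in>X. between a c b \<longrightarrow> c \<in> S)"

lemma convex_inD:
  "\<lbrakk>convex_in S; a \<in> S; b \<in> S; c \<in> X; between a c b\<rbrakk> \<Longrightarrow> c \<in> S"
  unfolding convex_in_def by blast

lemma convex_in_subset: "convex_in S \<Longrightarrow> S \<subseteq> X"
  unfolding convex_in_def by blast

lemma convex_in_Int: "convex_in S \<Longrightarrow> convex_in R \<Longrightarrow> convex_in (S \<inter> R)"
  unfolding convex_in_def by blast

text \<open>The median of three points, one from each pairwise intersection, lies in all three
  sets.\<close>

lemma helly3:
  assumes "convex_in A" "convex_in B" "convex_in C"
    and "A \<inter> B \<noteq> {}" "B \<inter> C \<noteq> {}" "A \<inter> C \<noteq> {}"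
  shows "A \<inter> B \<inter> C \<noteq> {}"
proof -
  obtain p q r where pqr: "p \<in> A \<inter> B" "q \<in> B \<inter> C" "r \<in> A \<inter> C" using assms by blast
  then have "p \<in> X" "q \<in> X" "r \<in> X" using convex_in_subset[OF assms(1)] convex_in_subset[OF assms(2)] by auto
  then obtain m where m: "m \<in> X" "between p m q" "between q m r" "between p m r"
    by (rule median)
  have "m \<in> A" "m \<in> B" "m \<in> C"
    using convex_inD[OF assms(1) _ _ m(1,4)] convex_inD[OF assms(2) _ _ m(1,2)]
      convex_inD[OF assms(3) _ _ m(1,3)] pqr by simp_all
  then show ?thesis by blast
qed

lemma helly:
  assumes "finite I" "I \<noteq> {}" "\<And>i. i \<in> I \<Longrightarrow> convex_in (C i)"
    and "\<And>i j. i \<in> I \<Longrightarrow> j \<in> I \<Longrightarrow> C i \<inter> C j \<noteq> {}"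
  shows "(\<Inter>i\<in>I. C i) \<noteq> {}"
  using assms
proof (induction I arbitrary: C rule: finite_ne_induct)
  case (singleton k)
  then show ?case by auto
next
  case (insert k I)
  \<comment> \<open>Absorbing \<open>C k\<close> into the other sets keeps pairwise intersections
    nonempty by \<open>helly3\<close>, so the induction hypothesis applies.\<close>
  have "(\<Inter>i\<in>I. C i \<inter> C k) \<noteq> {}"
  proof (rule insert.IH)
    show "convex_in (C i \<inter> C k)" if "i \<in> I" for i
      using insert.prems(1) that by (simp add: convex_in_Int)
    show "(C i \<inter> C k) \<inter> (C j \<inter> C k) \<noteq> {}" if "i \<in> I" "j \<in> I" for i j
    proof -
      have "C i \<inter> C j \<inter> C k \<noteq> {}"
        using insert.prems that by (intro helly3) auto
      then show ?thesis by blast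
    qed
  qed
  then show ?case using insert.hyps by auto
qed

end

section \<open>Every \<open>\<real>\<close>-tree satisfies the four-point condition\<close>

definition geodesic_in :: "'p set \<Rightarrow> ('p \<Rightarrow> 'p \<Rightarrow> real) \<Rightarrow> (real \<Rightarrow> 'p) \<Rightarrow> real \<Rightarrow> bool"
  where "geodesic_in X d \<gamma> a \<longleftrightarrow> 0 \<le> a \<and> \<gamma> ` {0..a} \<subseteq> X \<and>
    (\<forall>s\<in>{0..a}. \<forall>t\<in>{0..a}. d (\<gamma> s) (\<gamma> t) = \<bar>s - t\<bar>)"

lemma geodesic_inD:
  assumes "geodesic_in X d \<gamma> a"
  shows "0 \<le> a" "\<And>s. \<lbrakk>0 \<le> s; s \<le> a\<rbrakk> \<Longrightarrow> \<gamma> s \<in> X"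
    "\<And>s t. \<lbrakk>0 \<le> s; s \<le> a; 0 \<le> t; t \<le> a\<rbrakk> \<Longrightarrow> d (\<gamma> s) (\<gamma> t) = \<bar>s - t\<bar>"
  using assms unfolding geodesic_in_def by auto

lemma geodesic_in_initial: "geodesic_in X d \<gamma> a \<Longrightarrow> 0 \<le> b \<Longrightarrow> b \<le> a \<Longrightarrow> geodesic_in X d \<gamma> b"
  unfolding geodesic_in_def by auto

lemma geodesic_in_reverse: "geodesic_in X d \<gamma> a \<Longrightarrow> geodesic_in X d (\<lambda>t. \<gamma> (a - t)) a"
  unfolding geodesic_in_def by auto

lemma geodesic_metric_ex:
  assumes "geodesic_metric X d" "x \<in> X" "y \<in> X"
  obtains \<gamma> where "geodesic_in X d \<gamma> (d x y)" "\<gamma> 0 = x" "\<gamma> (d x y) = y"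
proof -
  obtain S \<gamma> where *: "S \<subseteq> X" "isometry_between {0..d x y} dist S d \<gamma>" "\<gamma> 0 = x" "\<gamma> (d x y) = y"
    using assms unfolding geodesic_metric_def by blast
  have "0 \<le> d x y"
    using assms(1) Metric_space.nonneg[of X d] unfolding geodesic_metric_def by blast
  then have "geodesic_in X d \<gamma> (d x y)"
    using * unfolding geodesic_in_def isometry_between_def bij_betw_def
    by (auto simp: dist_real_def)
  with * show thesis by (intro that)
qed

text \<open>Stated for Lipschitz paths because concatenated geodesics need not be geodesic.
  Compactness of the interval makes the continuous injection closed, hence an embedding.\<close>

lemma is_arc_between_lipschitz:
  assumes "Metric_space X d" "0 < c" "\<gamma> ` {0..c} \<subseteq> X" "inj_on \<gamma> {0..c}"
    and lip: "\<And>s t. \<lbrakk>0 \<le> s; s \<le> t; t \<le> c\<rbrakk> \<Longrightarrow> d (\<gamma> s) (\<gamma> t) \<le> t - s"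
  shows "is_arc_between X d (\<gamma> 0) (\<gamma> c) (\<gamma> ` {0..c})"
proof -
  interpret Metric_space X d by fact
  define \<delta> where "\<delta> u = \<gamma> (c * u)" for u
  have lip': "d (\<gamma> s) (\<gamma> t) \<le> \<bar>s - t\<bar>" if "s \<in> {0..c}" "t \<in> {0..c}" for s t
    using lip[of s t] lip[of t s] that commute[of "\<gamma> s" "\<gamma> t"] by (cases "s \<le> t") auto
  have cu: "c * u \<in> {0..c}" if "u \<in> {0..1}" for u
    using that \<open>0 < c\<close> by (simp add: mult_left_le)
  have "continuous_map (top_of_set {0..1}) mtopology \<delta>"
    unfolding continuous_map_to_metric
  proof (intro ballI allI impI)
    fix u \<epsilon> :: real assume u: "u \<in> topspace (top_of_set {0..1})" and "0 < \<epsilon>"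
    let ?U = "{0..1} \<inter> ball u (\<epsilon> / c)"
    have "\<delta> v \<in> mball (\<delta> u) \<epsilon>" if "v \<in> ?U" for v
    proof -
      have "d (\<gamma> (c * u)) (\<gamma> (c * v)) \<le> \<bar>c * u - c * v\<bar>"
        using that u by (intro lip' cu) auto
      also have "\<dots> = c * dist u v"
        using \<open>0 < c\<close> by (simp add: dist_real_def abs_mult flip: right_diff_distrib)
      also have "\<dots> < \<epsilon>"
        using that \<open>0 < c\<close> by (simp add: field_simps)
      finally have "d (\<delta> u) (\<delta> v) < \<epsilon>" by (simp only: \<delta>_def)
      moreover have "\<delta> u \<in> X" "\<delta> v \<in> X"
        unfolding \<delta>_def using u that by (intro subsetD[OF assms(3)] imageI cu; simp)+
      ultimately show ?thesis by (simp only: in_mball)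
    qed
    then show "\<exists>U. openin (top_of_set {0..1}) U \<and> u \<in> U \<and> (\<forall>v\<in>U. \<delta> v \<in> mball (\<delta> u) \<epsilon>)"
      using u \<open>0 < \<epsilon>\<close> \<open>0 < c\<close> by (intro exI[of _ ?U]) auto
  qed
  moreover have "inj_on \<delta> (topspace (top_of_set {0..1}))"
  proof (rule inj_onI)
    fix u v assume "u \<in> topspace (top_of_set {0..1})" "v \<in> topspace (top_of_set {0..1})" "\<delta> u = \<delta> v"
    then show "u = v"
      using inj_onD[OF assms(4), of "c * u" "c * v"] cu[of u] cu[of v] \<open>0 < c\<close>
      unfolding \<delta>_def by simp
  qed
  moreover have "closed_map (top_of_set {0..1}) mtopology \<delta>"
    using calculation(1) by (intro continuous_imp_closed_map)
      (auto simp: compact_space_subtopology Hausdorff_space_mtopology)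
  ultimately have "embedding_map (top_of_set {0..1}) mtopology \<delta>"
    by (intro injective_closed_imp_embedding_map)
  moreover have "(\<lambda>u. c * u) ` {0..1} = {0..c}"
    using \<open>0 < c\<close> by (simp add: image_mult_atLeastAtMost)
  then have "\<delta> ` {0..1} = \<gamma> ` {0..c}"
    unfolding \<delta>_def using image_image[of \<gamma> "\<lambda>u. c * u" "{0..1}"] by simp
  ultimately show ?thesis
    unfolding is_arc_between_def by (intro exI[of _ \<delta>]) (auto simp: \<delta>_def)
qed

locale r_tree =
  fixes X :: "'p set" and d
  assumes R_tree: "R_tree X d"

sublocale r_tree \<subseteq> Metric_space X d
  using R_tree unfolding R_tree_def geodesic_metric_def by (elim conjE)

context r_tree
begin

lemma geodesic:
  assumes "x \<in> X" "y \<in> X"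
  obtains \<gamma> where "geodesic_in X d \<gamma> (d x y)" "\<gamma> 0 = x" "\<gamma> (d x y) = y"
proof -
  have "geodesic_metric X d" using R_tree unfolding R_tree_def by (elim conjE)
  from geodesic_metric_ex[OF this assms] that show thesis by blast
qed

lemma arc_unique:
  assumes "x \<in> X" "y \<in> X" "x \<noteq> y" "is_arc_between X d x y A" "is_arc_between X d x y B"
  shows "A = B"
  using R_tree assms unfolding R_tree_def by blast

lemma geodesic_is_arc:
  assumes "geodesic_in X d \<gamma> a" "0 < a"
  shows "is_arc_between X d (\<gamma> 0) (\<gamma> a) (\<gamma> ` {0..a})"
proof (rule is_arc_between_lipschitz[OF Metric_space_axioms assms(2)])
  show "\<gamma> ` {0..a} \<subseteq> X"
    using assms(1) unfolding geodesic_in_def by (elim conjE)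
  show "d (\<gamma> s) (\<gamma> t) \<le> t - s" if "0 \<le> s" "s \<le> t" "t \<le> a" for s t
    using geodesic_inD(3)[OF assms(1), of s t] that by simp
  show "inj_on \<gamma> {0..a}"
  proof (rule inj_onI)
    fix s t assume st: "s \<in> {0..a}" "t \<in> {0..a}" "\<gamma> s = \<gamma> t"
    then show "s = t"
      using geodesic_inD(3)[OF assms(1), of s t] geodesic_inD(2)[OF assms(1), of s] by auto
  qed
qed

lemma concat_is_arc:
  assumes \<alpha>: "geodesic_in X d \<alpha> a" and \<beta>: "geodesic_in X d \<beta> b" and "\<alpha> a = \<beta> 0" and "0 < a + b"
    and meet: "\<And>s t. \<lbrakk>0 \<le> s; s \<le> a; 0 \<le> t; t \<le> b; \<alpha> s = \<beta> t\<rbrakk> \<Longrightarrow> t = 0"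
  shows "is_arc_between X d (\<alpha> 0) (\<beta> b) (\<alpha> ` {0..a} \<union> \<beta> ` {0..b})"
proof -
  define \<gamma> where "\<gamma> t = (if t \<le> a then \<alpha> t else \<beta> (t - a))" for t
  note \<alpha>D = geodesic_inD[OF \<alpha>] and \<beta>D = geodesic_inD[OF \<beta>]
  have g\<beta>: "\<gamma> (a + t) = \<beta> t" if "0 \<le> t" for t
    using that assms(3) by (cases "t = 0") (auto simp: \<gamma>_def)
  have im: "\<gamma> ` {0..a + b} = \<alpha> ` {0..a} \<union> \<beta> ` {0..b}"
  proof -
    have "{0..a + b} = {0..a} \<union> (+) a ` {0..b}"
      using \<alpha>D(1) \<beta>D(1) by auto
    moreover have "\<gamma> ` (+) a ` {0..b} = \<beta> ` {0..b}"
      unfolding image_image using g\<beta> by (intro image_cong) auto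
    moreover have "\<gamma> ` {0..a} = \<alpha> ` {0..a}"
      by (intro image_cong) (auto simp: \<gamma>_def)
    ultimately show ?thesis by (simp add: image_Un)
  qed
  have "is_arc_between X d (\<gamma> 0) (\<gamma> (a + b)) (\<gamma> ` {0..a + b})"
  proof (rule is_arc_between_lipschitz[OF Metric_space_axioms assms(4)])
    show "\<gamma> ` {0..a + b} \<subseteq> X"
      unfolding im using \<alpha> \<beta> by (simp add: geodesic_in_def)
    fix s t assume st: "0 \<le> s" "s \<le> t" "t \<le> a + b"
    consider "t \<le> a" | "s \<le> a" "a < t" | "a < s" by linarith
    then show "d (\<gamma> s) (\<gamma> t) \<le> t - s"
    proof cases
      case 1
      then show ?thesis using st \<alpha>D(3)[of s t] by (simp add: \<gamma>_def)
    next
      case 2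
      have "d (\<alpha> s) (\<beta> (t - a)) \<le> d (\<alpha> s) (\<alpha> a) + d (\<beta> 0) (\<beta> (t - a))"
        using triangle[of "\<alpha> s" "\<alpha> a" "\<beta> (t - a)"] \<alpha>D(1,2) \<beta>D(1,2) assms(3) st 2 by simp
      also have "\<dots> = t - s"
        using \<alpha>D(1) \<alpha>D(3)[of s a] \<beta>D(1) \<beta>D(3)[of 0 "t - a"] st 2 by simp
      finally show ?thesis using 2 by (simp add: \<gamma>_def)
    next
      case 3
      then show ?thesis using st \<beta>D(3)[of "s - a" "t - a"] by (simp add: \<gamma>_def)
    qed
  next
    have "s = t" if st: "0 \<le> s" "s \<le> t" "t \<le> a + b" and eq: "\<gamma> s = \<gamma> t" for s t
    proof -
      consider "t \<le> a" | "s \<le> a" "a < t" | "a < s" by linarith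
      then show ?thesis
      proof cases
        case 1
        then show ?thesis
          using st eq \<alpha>D(2)[of s] \<alpha>D(3)[of s t] by (simp add: \<gamma>_def)
      next
        case 2
        then show ?thesis
          using st eq meet[of s "t - a"] by (simp add: \<gamma>_def)
      next
        case 3
        then show ?thesis
          using st eq \<beta>D(2)[of "s - a"] \<beta>D(3)[of "s - a" "t - a"] by (simp add: \<gamma>_def)
      qed
    qed
    then show "inj_on \<gamma> {0..a + b}"
      unfolding inj_on_def by (metis atLeastAtMost_iff linear)
  qed
  then show ?thesis
    using im g\<beta>[of b] \<alpha>D(1) \<beta>D(1) by (simp add: \<gamma>_def)
qed

text \<open>The concatenation is an arc with the ends of the geodesic \<open>\<sigma>\<close>, so by
  uniqueness of arcs the images agree; the parameter of the corner \<open>\<alpha> a\<close> on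
  \<open>\<sigma>\<close> is then its distance from the start. Here the topological hypothesis
  becomes metric.\<close>

lemma concat_through:
  assumes \<alpha>: "geodesic_in X d \<alpha> a" and \<beta>: "geodesic_in X d \<beta> b" and "\<alpha> a = \<beta> 0"
    and meet: "\<And>s t. \<lbrakk>0 \<le> s; s \<le> a; 0 \<le> t; t \<le> b; \<alpha> s = \<beta> t\<rbrakk> \<Longrightarrow> t = 0"
    and ne: "\<alpha> 0 \<noteq> \<beta> b"
    and \<sigma>: "geodesic_in X d \<sigma> c" "\<sigma> 0 = \<alpha> 0" "\<sigma> c = \<beta> b"
  shows "\<alpha> a = \<sigma> a" "a \<le> c"
proof -
  note D = geodesic_inD[OF \<alpha>] geodesic_inD[OF \<beta>] geodesic_inD[OF \<sigma>(1)]
  have "0 < a + b"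
    using ne assms(3) D(1,4) by (cases "a = 0"; cases "b = 0") auto
  then have A: "is_arc_between X d (\<alpha> 0) (\<beta> b) (\<alpha> ` {0..a} \<union> \<beta> ` {0..b})"
    by (rule concat_is_arc[OF \<alpha> \<beta> assms(3) _ meet])
  have "0 < c"
    using ne \<sigma>(2,3) D(7) by (cases "c = 0") auto
  have B: "is_arc_between X d (\<alpha> 0) (\<beta> b) (\<sigma> ` {0..c})"
    using geodesic_is_arc[OF \<sigma>(1) \<open>0 < c\<close>] \<sigma>(2,3) by simp
  have "\<alpha> ` {0..a} \<union> \<beta> ` {0..b} = \<sigma> ` {0..c}"
    using arc_unique[OF D(2)[of 0] D(5)[of b] ne A B] D(1,4) by simp
  moreover have "\<alpha> a \<in> \<alpha> ` {0..a} \<union> \<beta> ` {0..b}" using D(1) by simp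
  ultimately have "\<alpha> a \<in> \<sigma> ` {0..c}" by (simp only:)
  then obtain u where u: "0 \<le> u" "u \<le> c" "\<alpha> a = \<sigma> u" by (elim imageE) (rule that; simp)
  have "u = a"
    using D(9)[of 0 u] D(3)[of 0 a] D(1) u \<sigma>(2) by simp
  then show "\<alpha> a = \<sigma> a" "a \<le> c" using u by simp_all
qed

text \<open>For \<open>m\<close> with \<open>d x m + d m y = d x y\<close>, geodesics from
  \<open>x\<close> to \<open>m\<close> and from \<open>m\<close> to \<open>y\<close> meet only in
  \<open>m\<close>, so their concatenation has to follow one fixed geodesic \<open>\<sigma>\<close>,
  and \<open>m\<close> is \<open>\<sigma> (d x m)\<close>.\<close>

lemma segment_point_unique:
  assumes X: "x \<in> X" "y \<in> X" "p \<in> X" "q \<in> X"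
    and p: "d x p + d p y = d x y" and q: "d x q + d q y = d x y" and eq: "d x p = d x q"
  shows "p = q"
proof (cases "x = y")
  case True
  then show ?thesis
    using p q X commute[of x p] commute[of x q] mdist_pos_less[of x p] mdist_pos_less[of x q]
    by fastforce
next
  case False
  obtain \<sigma> where \<sigma>: "geodesic_in X d \<sigma> (d x y)" "\<sigma> 0 = x" "\<sigma> (d x y) = y"
    using geodesic[OF X(1,2)] .
  have "m = \<sigma> (d x m)" if m: "m \<in> X" "d x m + d m y = d x y" for m
  proof -
    obtain \<alpha> where \<alpha>: "geodesic_in X d \<alpha> (d x m)" "\<alpha> 0 = x" "\<alpha> (d x m) = m"
      using geodesic[OF X(1) m(1)] .
    obtain \<beta> where \<beta>: "geodesic_in X d \<beta> (d m y)" "\<beta> 0 = m" "\<beta> (d m y) = y"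
      using geodesic[OF m(1) X(2)] .
    have "t = 0" if "0 \<le> s" "s \<le> d x m" "0 \<le> t" "t \<le> d m y" "\<alpha> s = \<beta> t" for s t
    proof -
      have "d x y \<le> d x (\<alpha> s) + d (\<alpha> s) y"
        using triangle[of x "\<alpha> s" y] X geodesic_inD(2)[OF \<alpha>(1), of s] that(1,2) by simp
      moreover have "d x (\<alpha> s) = s"
        using geodesic_inD(3)[OF \<alpha>(1), of 0 s] \<alpha>(2) that by simp
      moreover have "d (\<alpha> s) y = d m y - t"
        using geodesic_inD(3)[OF \<beta>(1), of t "d m y"] \<beta>(3) that by simp
      ultimately show "t = 0" using m that by linarith
    qed
    note meet = this
    have "\<alpha> (d x m) = \<sigma> (d x m)"
      by (rule concat_through(1)[OF \<alpha>(1) \<beta>(1) _ meet _ \<sigma>(1)]) (simp_all add: \<alpha> \<beta> \<sigma> False)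
    then show ?thesis using \<alpha>(3) by simp
  qed
  from this[OF X(3) p] this[OF X(4) q] eq show ?thesis by simp
qed

text \<open>The median is the point of the segment \<open>[x, y]\<close> nearest to \<open>z\<close>.\<close>

lemma median_ex:
  assumes X: "x \<in> X" "y \<in> X" "z \<in> X"
  shows "\<exists>m\<in>X. d x m + d m y = d x y \<and> d x m + d m z = d x z \<and> d y m + d m z = d y z"
proof -
  obtain \<alpha> where \<alpha>: "geodesic_in X d \<alpha> (d x y)" "\<alpha> 0 = x" "\<alpha> (d x y) = y"
    using geodesic[OF X(1,2)] .
  let ?D = "d x y"
  note \<alpha>D = geodesic_inD[OF \<alpha>(1)]
  have "\<bar>d (\<alpha> s) z - d (\<alpha> t) z\<bar> \<le> \<bar>s - t\<bar>" if "s \<in> {0..?D}" "t \<in> {0..?D}" for s t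
    using triangle[of "\<alpha> s" "\<alpha> t" z] triangle[of "\<alpha> t" "\<alpha> s" z] commute[of "\<alpha> s" "\<alpha> t"]
      \<alpha>D(2)[of s] \<alpha>D(2)[of t] \<alpha>D(3)[of s t] X that by simp
  then have "continuous_on {0..?D} (\<lambda>t. d (\<alpha> t) z)"
    unfolding continuous_on_iff dist_real_def by (meson le_less_trans)
  then obtain t0 where t0: "t0 \<in> {0..?D}" "\<And>t. t \<in> {0..?D} \<Longrightarrow> d (\<alpha> t0) z \<le> d (\<alpha> t) z"
    using continuous_attains_inf[of "{0..?D}" "\<lambda>t. d (\<alpha> t) z"] by auto
  define m where "m = \<alpha> t0"
  have m: "m \<in> X" using \<alpha>D(2)[of t0] t0(1) by (simp add: m_def)
  obtain \<beta> where \<beta>: "geodesic_in X d \<beta> (d m z)" "\<beta> 0 = m" "\<beta> (d m z) = z"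
    using geodesic[OF m X(3)] .
  \<comment> \<open>\<open>\<eta>\<close> runs along \<open>[x, y]\<close> into \<open>m\<close>. As
    \<open>m\<close> is nearest to \<open>z\<close>, it meets \<open>[m, z]\<close> only in
    \<open>m\<close>, and \<open>concat_through\<close> puts \<open>m\<close> on the geodesic from
    \<open>w\<close> to \<open>z\<close>.\<close>
  have through: "d w m + d m z = d w z"
    if \<eta>: "geodesic_in X d \<eta> a" "\<eta> 0 = w" "\<eta> a = m" "\<eta> ` {0..a} \<subseteq> \<alpha> ` {0..?D}" for \<eta> a w
  proof (cases "w = z")
    case True
    have "w \<in> \<alpha> ` {0..?D}"
      using subsetD[OF \<eta>(4) imageI[of 0 "{0..a}" \<eta>]] \<eta>(2) geodesic_inD(1)[OF \<eta>(1)] by simp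
    then have "d m z \<le> d w z" using t0(2) unfolding m_def by (elim imageE) simp
    then show ?thesis using True X m commute[of w m] mdist_pos_less[of m z] by fastforce
  next
    case False
    have w: "w \<in> X" using geodesic_inD(1)[OF \<eta>(1)] geodesic_inD(2)[OF \<eta>(1), of 0] \<eta>(2) by simp
    obtain \<sigma> where \<sigma>: "geodesic_in X d \<sigma> (d w z)" "\<sigma> 0 = w" "\<sigma> (d w z) = z"
      using geodesic[OF w X(3)] .
    have "t = 0" if "0 \<le> s" "s \<le> a" "0 \<le> t" "t \<le> d m z" "\<eta> s = \<beta> t" for s t
    proof -
      have "\<eta> s \<in> \<alpha> ` {0..?D}" using subsetD[OF \<eta>(4), of "\<eta> s"] that(1,2) by simp
      then have "d m z \<le> d (\<eta> s) z" using t0(2) unfolding m_def by (elim imageE) simp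
      moreover have "d (\<eta> s) z = d m z - t"
        using geodesic_inD(3)[OF \<beta>(1), of t "d m z"] \<beta>(3) that by simp
      ultimately show "t = 0" using that by linarith
    qed
    note meet = this
    have "\<eta> a = \<sigma> a" "a \<le> d w z"
      by (rule concat_through[OF \<eta>(1) \<beta>(1) _ meet _ \<sigma>(1)]; simp add: \<eta> \<beta> \<sigma> False)+
    then show ?thesis
      using \<eta>(3) \<sigma>(2,3) geodesic_inD(1)[OF \<eta>(1)] geodesic_inD(3)[OF \<sigma>(1), of 0 a]
        geodesic_inD(3)[OF \<sigma>(1), of a "d w z"] by simp
  qed
  have "d x m + d m z = d x z"
  proof (rule through)
    show "geodesic_in X d \<alpha> t0" using geodesic_in_initial[OF \<alpha>(1)] t0(1) by simp
  qed (use \<alpha> t0(1) in \<open>auto simp: m_def\<close>)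
  moreover have "d y m + d m z = d y z"
  proof (rule through)
    show "geodesic_in X d (\<lambda>t. \<alpha> (?D - t)) (?D - t0)"
      using geodesic_in_initial[OF geodesic_in_reverse[OF \<alpha>(1)]] t0(1) by simp
  qed (use \<alpha> t0(1) in \<open>auto simp: m_def\<close>)
  moreover have "d x m + d m y = d x y"
    using \<alpha>D(3)[of 0 t0] \<alpha>D(3)[of t0 ?D] \<alpha>(2,3) t0(1) by (simp add: m_def)
  ultimately show ?thesis using m by blast
qed

lemma segment_point_ex:
  assumes "x \<in> X" "y \<in> X" "0 \<le> t" "t \<le> d x y"
  shows "\<exists>z\<in>X. d x z = t \<and> d z y = d x y - t"
proof -
  obtain \<gamma> where \<gamma>: "geodesic_in X d \<gamma> (d x y)" "\<gamma> 0 = x" "\<gamma> (d x y) = y"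
    using geodesic[OF assms(1,2)] .
  then show ?thesis
    using geodesic_inD(2)[OF \<gamma>(1), of t] geodesic_inD(3)[OF \<gamma>(1), of 0 t]
      geodesic_inD(3)[OF \<gamma>(1), of t "d x y"] assms
    by (intro bexI[of _ "\<gamma> t"]) auto
qed

text \<open>\<open>m\<close> and \<open>p\<close> are the points where \<open>z\<close> and
  \<open>w\<close> branch off \<open>[x, y]\<close>. Since \<open>p\<close> comes no later than
  \<open>m\<close>, it lies on \<open>[x, m]\<close>, and the bound is the length of the route
  \<open>z, m, p, w\<close>.\<close>

lemma dist_via_branch:
  assumes X: "x \<in> X" "y \<in> X" "z \<in> X" "w \<in> X" "m \<in> X" "p \<in> X"
    and m: "d x m + d m y = d x y" "d x m + d m z = d x z"
    and p: "d x p + d p y = d x y" "d x p + d p w = d x w" and le: "d x p \<le> d x m"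
  shows "d z w \<le> d x z + d x w - 2 * d x p"
proof -
  obtain p' where p': "p' \<in> X" "d x p' = d x p" "d p' m = d x m - d x p"
    using segment_point_ex[OF X(1,5), of "d x p"] le by auto
  have "d x p' + d p' y = d x y"
    using triangle[OF p'(1) X(5,2)] triangle[OF X(1) p'(1) X(2)] p' m by simp
  then have "p' = p"
    using segment_point_unique[OF X(1,2) p'(1) X(6) _ p(1)] p' by simp
  then show ?thesis
    using triangle[OF X(3,6,4)] triangle[OF X(6,5,3)] p' m p commute[of z p] by simp
qed

end

text \<open>The branch points of \<open>z\<close> and \<open>w\<close> on \<open>[x, y]\<close> come
  in one of two orders, and each order yields one of the two terms of the maximum.\<close>

sublocale r_tree \<subseteq> metric_tree X d
proof
  fix x y t assume "x \<in> X" "y \<in> X" "0 \<le> t" "t \<le> d x y"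
  then show "\<exists>z\<in>X. d x z = t \<and> d z y = d x y - t" by (rule segment_point_ex)
next
  fix x y z w assume X: "x \<in> X" "y \<in> X" "z \<in> X" "w \<in> X"
  obtain m where m: "m \<in> X" "d x m + d m y = d x y" "d x m + d m z = d x z" "d y m + d m z = d y z"
    using median_ex[OF X(1,2,3)] by blast
  obtain p where p: "p \<in> X" "d x p + d p y = d x y" "d x p + d p w = d x w" "d y p + d p w = d y w"
    using median_ex[OF X(1,2,4)] by blast
  show "d x y + d z w \<le> max (d x z + d y w) (d x w + d y z)"
  proof (cases "d x p \<le> d x m")
    case True
    then have "d z w \<le> d x z + d x w - 2 * d x p"
      using dist_via_branch[of x y z w m p] X m p by simp
    then have "d x y + d z w \<le> d x z + d y w"
      using p commute[of p y] by simp
    then show ?thesis by simp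
  next
    case False
    then have "d w z \<le> d x w + d x z - 2 * d x m"
      using dist_via_branch[of x y w z p m] X m p by simp
    then have "d x y + d z w \<le> d x w + d y z"
      using m commute[of m y] commute[of z w] by simp
    then show ?thesis by simp
  qed
qed

text \<open>Minimality speaks of subsets that are \<open>R_tree\<close>s, so convex sets must be
  recognised as such: geodesics of \<open>X\<close> stay in \<open>S\<close>, and arcs in
  \<open>S\<close> are arcs in \<open>X\<close>, hence unique.\<close>

lemma (in r_tree) R_tree_convex_in:
  assumes S: "convex_in S" "S \<noteq> {}"
  shows "R_tree S d"
proof -
  have SX: "S \<subseteq> X" using convex_in_subset[OF S(1)] .
  interpret S: Submetric X d S by unfold_locales (fact SX)
  have geo: "geodesic_metric S d"
    unfolding geodesic_metric_def
  proof (intro conjI ballI)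
    show "Metric_space S d" by (rule S.sub.Metric_space_axioms)
    fix x y assume xy: "x \<in> S" "y \<in> S"
    then obtain \<gamma> where \<gamma>: "geodesic_in X d \<gamma> (d x y)" "\<gamma> 0 = x" "\<gamma> (d x y) = y"
      using geodesic SX by (metis subsetD)
    have "\<gamma> ` {0..d x y} \<subseteq> S"
    proof
      fix z assume "z \<in> \<gamma> ` {0..d x y}"
      then obtain t where t: "z = \<gamma> t" "0 \<le> t" "t \<le> d x y" by auto
      have "z \<in> X" using geodesic_inD(2)[OF \<gamma>(1)] t by simp
      moreover have "between x z y"
        using geodesic_inD(3)[OF \<gamma>(1), of 0 t] geodesic_inD(3)[OF \<gamma>(1), of t "d x y"] \<gamma> t
        by (simp add: between_def)
      ultimately show "z \<in> S" using convex_inD[OF S(1) xy] by blast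
    qed
    moreover have "inj_on \<gamma> {0..d x y}"
    proof (rule inj_onI)
      fix s t assume st: "s \<in> {0..d x y}" "t \<in> {0..d x y}" "\<gamma> s = \<gamma> t"
      then show "s = t"
        using geodesic_inD(3)[OF \<gamma>(1), of s t] geodesic_inD(2)[OF \<gamma>(1), of s] by auto
    qed
    ultimately show "\<exists>R \<gamma>. R \<subseteq> S \<and> isometry_between {0..d x y} dist R d \<gamma> \<and>
        \<gamma> 0 = x \<and> \<gamma> (d x y) = y"
      using \<gamma> geodesic_inD(3)[OF \<gamma>(1)]
      by (intro exI[of _ "\<gamma> ` {0..d x y}"] exI[of _ \<gamma>])
        (auto simp: isometry_between_def bij_betw_def dist_real_def)
  qed
  have arcX: "is_arc_between X d x y A" if "is_arc_between S d x y A" for x y A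
    using that unfolding is_arc_between_def S.mtopology_submetric embedding_map_in_subtopology
    by blast
  have "\<exists>!A. is_arc_between S d x y A" if xy: "x \<in> S" "y \<in> S" "x \<noteq> y" for x y
  proof -
    obtain \<gamma> where \<gamma>: "geodesic_in S d \<gamma> (d x y)" "\<gamma> 0 = x" "\<gamma> (d x y) = y"
      using geodesic_metric_ex[OF geo xy(1,2)] .
    have pos: "0 < d x y" using xy SX by (simp add: mdist_pos_less subsetD)
    have "inj_on \<gamma> {0..d x y}"
    proof (rule inj_onI)
      fix s t assume st: "s \<in> {0..d x y}" "t \<in> {0..d x y}" "\<gamma> s = \<gamma> t"
      then show "s = t"
        using geodesic_inD(3)[OF \<gamma>(1), of s t] geodesic_inD(2)[OF \<gamma>(1), of s] SX
        by (auto dest: subsetD)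
    qed
    then have "is_arc_between S d (\<gamma> 0) (\<gamma> (d x y)) (\<gamma> ` {0..d x y})"
      using geodesic_inD(2,3)[OF \<gamma>(1)] pos
      by (intro is_arc_between_lipschitz[OF S.sub.Metric_space_axioms]) auto
    then have "is_arc_between S d x y (\<gamma> ` {0..d x y})"
      using \<gamma> by simp
    moreover have "A = B" if "is_arc_between S d x y A" "is_arc_between S d x y B" for A B
      using arc_unique[of x y A B] arcX that xy SX by blast
    ultimately show ?thesis by blast
  qed
  with geo S(2) show ?thesis unfolding R_tree_def by blast
qed

section \<open>Hulls of finite sets\<close>

context metric_tree
begin

lemma between_left_or_right:
  assumes "p \<in> X" "q \<in> X" "c \<in> X" "w \<in> X" "between p c q"
  shows "between p c w \<or> between q c w"
  using dist_to_segment[of p q c w] assms commute[of q c] unfolding between_def max_def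
  by (auto split: if_splits)

lemma between_extend:
  assumes "p \<in> X" "c \<in> X" "w \<in> X" "z \<in> X" "between p c w" "between c z w"
  shows "between p z w"
  using assms triangle[of p z w] triangle[of p c z] unfolding between_def by simp

text \<open>A geodesic arriving at \<open>c\<close> can be prolonged to one end of
  \<open>[p, q]\<close>, and likewise at \<open>c'\<close>. This is why joining orbit points by
  segments once already gives a convex set.\<close>

lemma between_segments:
  assumes X: "p \<in> X" "q \<in> X" "c \<in> X" "p' \<in> X" "q' \<in> X" "c' \<in> X" "z \<in> X"
    and b: "between p c q" "between p' c' q'" "between c z c'"
  shows "\<exists>u\<in>{p, q}. \<exists>v\<in>{p', q'}. between u z v"
proof -
  obtain u where u: "u \<in> {p, q}" "between u c c'"
    using between_left_or_right[OF X(1,2,3,6) b(1)] by blast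
  then have uX: "u \<in> X" using X by blast
  have "between u z c'" using between_extend[OF uX X(3,6,7) u(2) b(3)] .
  then have z: "between c' z u" using between_sym by blast
  obtain v where v: "v \<in> {p', q'}" "between v c' u"
    using between_left_or_right[OF X(4,5,6) uX b(2)] by blast
  then have "v \<in> X" using X by blast
  then have "between v z u" using between_extend[of v c' u z] X uX v(2) z by blast
  then show ?thesis using u(1) v(1) between_sym by blast
qed

text \<open>\<open>dist_to_segment\<close> applied to both segments. Being a maximum of linear
  terms, the formula passes estimates for the four end distances on to interior points.\<close>

lemma dist_segments:
  assumes "p \<in> X" "q \<in> X" "c \<in> X" "p' \<in> X" "q' \<in> X" "c' \<in> X"
    and "between p c q" "between p' c' q'"
  shows "d c c' = max (max (d p p' - d p' c' - d p c) (d p q' - d c' q' - d p c))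
                      (max (d q p' - d p' c' - d c q) (d q q' - d c' q' - d c q))"
proof -
  have "d c c' = max (d p c' - d p c) (d q c' - d c q)"
    using dist_to_segment[of p q c c'] assms by simp
  moreover have "d c' p = max (d p' p - d p' c') (d q' p - d c' q')"
    using dist_to_segment[of p' q' c' p] assms by simp
  moreover have "d c' q = max (d p' q - d p' c') (d q' q - d c' q')"
    using dist_to_segment[of p' q' c' q] assms by simp
  ultimately have "d c c' = max (max (d p p' - d p' c') (d p q' - d c' q') - d p c)
      (max (d q p' - d p' c') (d q q' - d c' q') - d c q)"
    using commute[of c' p] commute[of c' q] commute[of p' p] commute[of q' p] commute[of p' q]
      commute[of q' q] by simp
  then show ?thesis by (simp only: max_diff_distrib_left)
qed

end

section \<open>Isometric actions on metric trees\<close>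

locale tree_action = metric_tree X d + group G
  for X :: "'p set" and d and G :: "('g, 'm) monoid_scheme" (structure) +
  fixes \<phi> :: "'g \<Rightarrow> 'p \<Rightarrow> 'p"
  assumes act_in: "\<lbrakk>g \<in> carrier G; x \<in> X\<rbrakk> \<Longrightarrow> \<phi> g x \<in> X"
    and act_mult: "\<lbrakk>g \<in> carrier G; h \<in> carrier G; x \<in> X\<rbrakk> \<Longrightarrow> \<phi> (g \<otimes> h) x = \<phi> g (\<phi> h x)"
    and act_one: "x \<in> X \<Longrightarrow> \<phi> \<one> x = x"
    and act_dist: "\<lbrakk>g \<in> carrier G; x \<in> X; y \<in> X\<rbrakk> \<Longrightarrow> d (\<phi> g x) (\<phi> g y) = d x y"
    and nonempty: "X \<noteq> {}"
begin

lemma act_inv: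
  assumes "g \<in> carrier G" "x \<in> X"
  shows "\<phi> (inv g) (\<phi> g x) = x" "\<phi> g (\<phi> (inv g) x) = x"
  using act_mult[of "inv g" g x] act_mult[of g "inv g" x] act_one[of x] assms by simp_all

lemma act_dist_inv:
  assumes "g \<in> carrier G" "x \<in> X" "y \<in> X"
  shows "d (\<phi> g x) y = d x (\<phi> (inv g) y)" "d x (\<phi> g y) = d (\<phi> (inv g) x) y"
  using act_dist[of "inv g" "\<phi> g x" y] act_dist[of "inv g" x "\<phi> g y"] act_inv[of g x] act_inv[of g y]
    act_in[of g x] act_in[of g y] assms by simp_all

lemma dist_orbit:
  assumes "g \<in> carrier G" "h \<in> carrier G" "x \<in> X"
  shows "d (\<phi> g x) (\<phi> h x) = d x (\<phi> (inv g \<otimes> h) x)"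
  using act_dist_inv(1)[of g x "\<phi> h x"] act_in[of h x] act_mult[of "inv g" h x] assms by simp

lemma between_act:
  assumes "g \<in> carrier G" "p \<in> X" "q \<in> X" "r \<in> X"
  shows "between (\<phi> g p) (\<phi> g q) (\<phi> g r) \<longleftrightarrow> between p q r"
  using assms by (simp add: between_def act_dist)

section \<open>Translation lengths\<close>

definition len :: "'g \<Rightarrow> real"
  where "len g = (LEAST r. r \<in> (\<lambda>x. d x (\<phi> g x)) ` X)"

lemma displacement_retract:
  assumes g: "g \<in> carrier G" and y: "y \<in> X"
    and r: "0 \<le> r" "d y (\<phi> g (\<phi> g y)) - d y (\<phi> g y) \<le> r" "r \<le> d y (\<phi> g y)"
  obtains c where "c \<in> X" "d y c = (d y (\<phi> g y) - r) / 2" "d c (\<phi> g y) = (d y (\<phi> g y) + r) / 2"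
    "d c (\<phi> g c) = r"
proof -
  define D E u where "D = d y (\<phi> g y)" and "E = d y (\<phi> g (\<phi> g y))" and "u = (D - r) / 2"
  note X = y act_in[OF g y] act_in[OF g act_in[OF g y]]
  have "0 \<le> u" "u \<le> D" using r by (simp_all add: D_def u_def)
  then obtain c where c: "c \<in> X" "d y c = u" "d c (\<phi> g y) = D - u"
    using segment_point[OF X(1,2), of u] unfolding D_def by blast
  have gc: "\<phi> g c \<in> X" "d (\<phi> g y) (\<phi> g c) = u" "d (\<phi> g c) (\<phi> g (\<phi> g y)) = D - u"
    using act_in[OF g c(1)] act_dist[OF g] c X by auto
  have "between y c (\<phi> g y)" "between (\<phi> g y) (\<phi> g c) (\<phi> g (\<phi> g y))"
    using c gc act_dist[OF g X(1,2)] by (simp_all add: between_def D_def)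
  then have "d c (\<phi> g (\<phi> g y)) = max (E - u) (D - (D - u))"
    and "d (\<phi> g c) c = max (d (\<phi> g y) c - u) (d (\<phi> g (\<phi> g y)) c - (D - u))"
    using dist_to_segment[OF X(1,2) c(1) X(3)] dist_to_segment[OF X(2,3) gc(1) c(1)] c gc
      act_dist[OF g X(1,2)] by (simp_all add: D_def E_def)
  then have "d c (\<phi> g c) = max (D - u - u) (max (E - u) u - (D - u))"
    using commute[of c "\<phi> g c"] commute[of c "\<phi> g y"] commute[of c "\<phi> g (\<phi> g y)"] c(3) by simp
  also have "\<dots> = r" using r by (simp add: u_def D_def E_def max_def field_simps)
  finally show thesis
    using c by (intro that[of c]) (simp_all add: u_def D_def field_simps)
qed

text \<open>The four-point inequality for \<open>y, g (g y)\<close> against \<open>g y, g z\<close>: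
  since \<open>d (g y) (g z) = d y z\<close>, this distance cancels from both sides.\<close>

lemma displacement_lower:
  assumes g: "g \<in> carrier G" and y: "y \<in> X" and z: "z \<in> X"
  shows "d y (\<phi> g (\<phi> g y)) - d y (\<phi> g y) \<le> d z (\<phi> g z)"
proof -
  note X = y z act_in[OF g y] act_in[OF g z] act_in[OF g act_in[OF g y]]
  have "d y (\<phi> g (\<phi> g y)) + d (\<phi> g y) (\<phi> g z)
      \<le> max (d y (\<phi> g y) + d (\<phi> g (\<phi> g y)) (\<phi> g z)) (d y (\<phi> g z) + d (\<phi> g (\<phi> g y)) (\<phi> g y))"
    by (rule four_point[OF X(1,5,3,4)])
  moreover have "d (\<phi> g (\<phi> g y)) (\<phi> g z) \<le> d y z + d z (\<phi> g z)"
    using act_dist[OF g X(3,2)] act_dist[OF g X(1,2)] triangle[OF X(3,4,2)] commute[of "\<phi> g z" z]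
    by simp
  moreover have "d y (\<phi> g z) \<le> d y z + d z (\<phi> g z)"
    by (rule triangle[OF X(1,2,4)])
  ultimately show ?thesis
    using act_dist[OF g X(1,2)] act_dist[OF g X(1,3)] commute[of "\<phi> g (\<phi> g y)" "\<phi> g y"] by simp
qed

text \<open>\<open>displacement_retract\<close> yields a point whose displacement is the value on
  the right, and \<open>displacement_lower\<close> shows that no point moves less; so the minimum
  defining the length exists.\<close>

lemma len_attained:
  assumes g: "g \<in> carrier G" and y: "y \<in> X"
  shows "len g = max 0 (d y (\<phi> g (\<phi> g y)) - d y (\<phi> g y))"
    and "\<exists>z\<in>X. d z (\<phi> g z) = len g" and "\<forall>z\<in>X. len g \<le> d z (\<phi> g z)"
proof -
  let ?l = "max 0 (d y (\<phi> g (\<phi> g y)) - d y (\<phi> g y))"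
  have "d y (\<phi> g (\<phi> g y)) \<le> 2 * d y (\<phi> g y)"
    using triangle[OF y act_in[OF g y] act_in[OF g act_in[OF g y]]] act_dist[OF g y act_in[OF g y]]
    by simp
  then obtain m where m: "m \<in> X" "d m (\<phi> g m) = ?l"
    using displacement_retract[OF g y, of ?l] by auto
  have low: "?l \<le> d z (\<phi> g z)" if "z \<in> X" for z
    using displacement_lower[OF g y that] by simp
  have "len g = ?l"
    unfolding len_def
  proof (rule Least_equality)
    show "?l \<in> (\<lambda>x. d x (\<phi> g x)) ` X" using m by (metis imageI)
  qed (use low in blast)
  then show "len g = ?l" "\<exists>z\<in>X. d z (\<phi> g z) = len g" "\<forall>z\<in>X. len g \<le> d z (\<phi> g z)"
    using m low by auto
qed

lemma len_le: "\<lbrakk>g \<in> carrier G; x \<in> X\<rbrakk> \<Longrightarrow> len g \<le> d x (\<phi> g x)"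
  using len_attained(3) by blast

lemma len_nonneg: "g \<in> carrier G \<Longrightarrow> 0 \<le> len g"
  using len_attained(1) nonempty by fastforce

text \<open>\<open>dist_segments\<close> for \<open>[p, q]\<close> and its image under
  \<open>g\<close>: corresponding points sit at equal positions, and each of the four terms is at
  most the larger end displacement.\<close>

lemma displacement_convex:
  assumes g: "g \<in> carrier G" and X: "p \<in> X" "q \<in> X" "c \<in> X" and b: "between p c q"
  shows "d c (\<phi> g c) \<le> max (d p (\<phi> g p)) (d q (\<phi> g q))"
proof -
  note gX = act_in[OF g X(1)] act_in[OF g X(2)] act_in[OF g X(3)]
  have "between (\<phi> g p) (\<phi> g c) (\<phi> g q)" using between_act[OF g X(1,3,2)] b by simp
  note eq = dist_segments[OF X gX b this]
  have "d p (\<phi> g q) \<le> d p (\<phi> g p) + d p q"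
    using triangle[OF X(1) gX(1,2)] act_dist[OF g X(1,2)] by simp
  moreover have "d q (\<phi> g p) \<le> d p (\<phi> g p) + d p q"
    using triangle[OF X(2,1) gX(1)] commute[of q p] by simp
  moreover define M where "M = max (d p (\<phi> g p)) (d q (\<phi> g q))"
  then have "d p (\<phi> g p) \<le> M" "d q (\<phi> g q) \<le> M" by simp_all
  moreover have "d (\<phi> g p) (\<phi> g c) = d p c" "d (\<phi> g c) (\<phi> g q) = d c q"
    using act_dist[OF g] X by simp_all
  ultimately have "d c (\<phi> g c) \<le> M"
    unfolding eq using b nonneg[of p c] nonneg[of c q] unfolding between_def
    by (intro max.boundedI) linarith+
  then show ?thesis by (simp add: M_def)
qed

section \<open>Slow sets and common slow points\<close>

definition slow_set :: "'g \<Rightarrow> real \<Rightarrow> 'p set"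
  where "slow_set g r = {x \<in> X. d x (\<phi> g x) \<le> r}"

lemma slow_set_convex:
  assumes "g \<in> carrier G"
  shows "convex_in (slow_set g r)"
  unfolding convex_in_def
proof (intro conjI ballI impI)
  show "slow_set g r \<subseteq> X" by (auto simp: slow_set_def)
  fix p q c assume "p \<in> slow_set g r" "q \<in> slow_set g r" "c \<in> X" "between p c q"
  then show "c \<in> slow_set g r"
    using displacement_convex[OF assms, of p q c] unfolding slow_set_def
    by (simp add: max_def split: if_splits)
qed

text \<open>Here \<open>[a, c]\<close> is the bridge between two disjoint slow sets of \<open>g\<close> and \<open>h\<close>; the points
  \<open>a, c, h c, h a, h g a, h g c, h g h c, h g h a, h g h g a\<close> lie in this order on a geodesic.\<close>

lemma len_mult_bridge:
  assumes gh: "g \<in> carrier G" "h \<in> carrier G" and X: "a \<in> X" "c \<in> X" and "a \<noteq> c"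
    and g: "d a (\<phi> g a) = r" "2 * d a c + r \<le> d c (\<phi> g c)"
    and h: "d c (\<phi> h c) = r'" "2 * d a c + r' \<le> d a (\<phi> h a)"
  shows "len (h \<otimes> g) \<ge> 2 * d a c + r + r'"
proof -
  define e where "e = d a c"
  define s where "s = h \<otimes> g"
  have s: "s \<in> carrier G" using gh by (simp add: s_def)
  have sa: "\<phi> s x = \<phi> h (\<phi> g x)" if "x \<in> X" for x using act_mult gh that by (simp add: s_def)
  have e: "e > 0" using X \<open>a \<noteq> c\<close> by (simp add: e_def)
  define hc ha where "hc = \<phi> h c" and "ha = \<phi> h a"
  have hX: "hc \<in> X" "ha \<in> X" using act_in gh X by (simp_all add: hc_def ha_def)
  have sX: "\<phi> s a \<in> X" "\<phi> s c \<in> X" "\<phi> s hc \<in> X" "\<phi> s ha \<in> X" "\<phi> s (\<phi> s a) \<in> X"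
    using act_in[OF s] X hX by simp_all
  have d0: "d hc ha = e" "d c hc = r'" "d (\<phi> s a) (\<phi> s c) = e"
    using act_dist[OF gh(2) X(2,1)] act_dist[OF s X] h(1) commute[of c a]
    by (simp_all add: hc_def ha_def e_def)
  have d1: "d a ha = 2 * e + r'" "d a hc = e + r'" "d c ha = e + r'"
    using triangle[OF X hX(2)] triangle[OF X hX(1)] triangle[OF X(2) hX] triangle[OF X(1) hX] d0 h(2)
    by (simp_all add: e_def[symmetric] ha_def[symmetric])
  have gX: "\<phi> g a \<in> X" "\<phi> g c \<in> X" using act_in gh X by simp_all
  have "d (\<phi> g a) (\<phi> g c) = e" "d c a = e" using act_dist[OF gh(1) X] commute[of c a] by (simp_all add: e_def)
  then have "d c (\<phi> g c) = 2 * e + r" "d c (\<phi> g a) = e + r" "d a (\<phi> g c) = e + r"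
    using triangle[OF X(2,1) gX(2)] triangle[OF X(2,1) gX(1)] triangle[OF X(1) gX]
      triangle[OF X(2) gX] g by (simp_all add: e_def[symmetric])
  then have d2: "d hc (\<phi> s c) = 2 * e + r" "d hc (\<phi> s a) = e + r" "d ha (\<phi> s c) = e + r"
      "d ha (\<phi> s a) = r"
    using act_dist[OF gh(2)] X gX g(1) by (simp_all add: hc_def ha_def sa)
  have d3: "d (\<phi> s a) (\<phi> s ha) = 2 * e + r'" "d (\<phi> s c) (\<phi> s ha) = e + r'"
      "d (\<phi> s c) (\<phi> s hc) = r'" "d (\<phi> s hc) (\<phi> s ha) = e"
      "d (\<phi> s hc) (\<phi> s (\<phi> s a)) = e + r" "d (\<phi> s ha) (\<phi> s (\<phi> s a)) = r"
    using act_dist[OF s] X hX sX d0 d1 d2 by simp_all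
  have ne: "hc \<noteq> ha" "\<phi> s a \<noteq> \<phi> s c" "\<phi> s hc \<noteq> \<phi> s ha"
    using d0 d3 e mdist_zero[OF hX(2)] mdist_zero[OF sX(2)] mdist_zero[OF sX(4)] by auto
  \<comment> \<open>Three gluings by \<open>chain\<close>, over the overlaps
    \<open>[h c, h a]\<close>, \<open>[s a, s c]\<close> and \<open>[s h c, s h a]\<close>, each of
    length \<open>e > 0\<close>; the length of \<open>s\<close> is then
    \<open>d a (s s a) - d a (s a)\<close>.\<close>
  have "d a (\<phi> s c) = 3 * e + r + r'"
    using chain[OF X(1) hX sX(2) _ _ ne(1)] d0 d1 d2 by (simp add: between_def)
  moreover from this have "d a (\<phi> s a) = 2 * e + r + r'"
    using triangle[OF X(1) sX(1,2)] triangle[OF X(1) hX(2) sX(1)] d0 d1 d2 by simp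
  moreover from calculation have "d a (\<phi> s ha) = 4 * e + r + 2 * r'"
    using chain[OF X(1) sX(1,2,4) _ _ ne(2)] d0 d3 by (simp add: between_def)
  moreover from calculation have "d a (\<phi> s hc) = 3 * e + r + 2 * r'"
    using triangle[OF X(1) sX(3,4)] triangle[OF X(1) sX(2,3)] d3 by simp
  moreover from calculation have "d a (\<phi> s (\<phi> s a)) = 4 * e + 2 * r + 2 * r'"
    using chain[OF X(1) sX(3,4,5) _ _ ne(3)] d3 by (simp add: between_def)
  ultimately show ?thesis
    using len_attained(1)[OF s X(1)] by (simp add: s_def[symmetric] e_def[symmetric])
qed

text \<open>If the sets were disjoint, a bridge \<open>[a, c]\<close> between them would make
  \<open>len (h \<otimes> g)\<close> exceed \<open>r + r'\<close> by at least twice the length of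
  the bridge.\<close>

lemma slow_sets_meet:
  assumes gh: "g \<in> carrier G" "h \<in> carrier G" and r: "len g \<le> r" "len h \<le> r'" "len (h \<otimes> g) \<le> r + r'"
  shows "slow_set g r \<inter> slow_set h r' \<noteq> {}"
proof (rule ccontr)
  assume "\<not> ?thesis"
  then have disj: "r' < d x (\<phi> h x)" if "x \<in> X" "d x (\<phi> g x) \<le> r" for x
    using that by (force simp: slow_set_def)
  obtain y where y: "y \<in> X" "d y (\<phi> g y) \<le> r"
    using len_attained(2)[OF gh(1)] nonempty r(1) by force
  have r0: "0 \<le> r" "0 \<le> r'" using len_nonneg gh r by force+
  have "d y (\<phi> h (\<phi> h y)) - d y (\<phi> h y) \<le> r'" "r' \<le> d y (\<phi> h y)"
    using len_attained(1)[OF gh(2) y(1)] r(2) disj[OF y] by simp_all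
  \<comment> \<open>\<open>c\<close> is where the way from \<open>y\<close>, slow for
    \<open>g\<close>, towards \<open>h y\<close> reaches displacement \<open>r'\<close> under
    \<open>h\<close>. In the same way \<open>a\<close> is found below, from \<open>c\<close> towards
    \<open>g c\<close>.\<close>
  then obtain c where c: "c \<in> X" "d y c = (d y (\<phi> h y) - r') / 2"
      "d c (\<phi> h y) = (d y (\<phi> h y) + r') / 2" "d c (\<phi> h c) = r'"
    by (rule displacement_retract[OF gh(2) y(1) r0(2)])
  have cg: "r < d c (\<phi> g c)" using disj[OF c(1)] c(4) by force
  then have "d c (\<phi> g (\<phi> g c)) - d c (\<phi> g c) \<le> r" "r \<le> d c (\<phi> g c)"
    using len_attained(1)[OF gh(1) c(1)] r(1) by simp_all
  then obtain a where a: "a \<in> X" "d c a = (d c (\<phi> g c) - r) / 2"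
      "d a (\<phi> g c) = (d c (\<phi> g c) + r) / 2" "d a (\<phi> g a) = r"
    by (rule displacement_retract[OF gh(1) c(1) r0(1)])
  note X = y(1) c(1) a(1) act_in[OF gh(1) c(1)] act_in[OF gh(1) y(1)]
  have "between c a (\<phi> g c)" using a by (simp add: between_def field_simps)
  from dist_to_segment[OF X(2,4,3,1) this]
  have "d a y = max (d c y - d c a) (d (\<phi> g c) y - d a (\<phi> g c))" .
  moreover have "d (\<phi> g c) y \<le> d c y + r"
    using triangle[OF X(4,5,1)] act_dist[OF gh(1) c(1) y(1)] y(2) commute[of y "\<phi> g y"] by simp
  \<comment> \<open>So \<open>a\<close> lies between \<open>c\<close> and \<open>y\<close>; hence
    \<open>h\<close> moves it at least by \<open>2 * d a c + r'\<close>, as the bridge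
    requires.\<close>
  ultimately have "d a y \<le> d c y - d c a" using a by (simp add: field_simps)
  moreover have "d y (\<phi> h y) \<le> 2 * d a y + d a (\<phi> h a)"
    using triangle[OF y(1) a(1) act_in[OF gh(2) y(1)]]
      triangle[OF a(1) act_in[OF gh(2) a(1)] act_in[OF gh(2) y(1)]] act_dist[OF gh(2) a(1) y(1)]
      commute[of a y] by simp
  ultimately have "2 * d a c + r' \<le> d a (\<phi> h a)"
    using c(2) commute[of a c] commute[of y c] by simp
  moreover have "d a c > 0" using a(2) cg commute[of a c] by simp
  then have "a \<noteq> c" using mdist_zero[OF a(1)] by auto
  ultimately have "2 * d a c + r + r' \<le> len (h \<otimes> g)"
    using len_mult_bridge[OF gh a(1) c(1) _ a(4) _ c(4)] a(2) commute[of a c] by (simp add: field_simps)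
  then show False using r(3) \<open>d a c > 0\<close> by simp
qed

lemma common_slow_point:
  assumes F: "finite F" "F \<subseteq> carrier G" and r: "\<And>s. s \<in> F \<Longrightarrow> len s \<le> \<rho> s"
    and rr: "\<And>s t. s \<in> F \<Longrightarrow> t \<in> F \<Longrightarrow> len (t \<otimes> s) \<le> \<rho> s + \<rho> t"
  obtains w where "w \<in> X" "\<And>s. s \<in> F \<Longrightarrow> d w (\<phi> s w) \<le> \<rho> s"
proof (cases "F = {}")
  case True
  then show thesis using nonempty that by blast
next
  case False
  have "(\<Inter>s\<in>F. slow_set s (\<rho> s)) \<noteq> {}"
  proof (rule helly[OF F(1) False])
    show "convex_in (slow_set s (\<rho> s))" if "s \<in> F" for s
      using slow_set_convex F(2) that by blast
    show "slow_set s (\<rho> s) \<inter> slow_set t (\<rho> t) \<noteq> {}" if "s \<in> F" "t \<in> F" for s t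
      using slow_sets_meet[of s t "\<rho> s" "\<rho> t"] r rr that F(2) by blast
  qed
  then obtain w where "\<forall>s\<in>F. w \<in> slow_set s (\<rho> s)" by blast
  then show thesis using False by (intro that[of w]) (auto simp: slow_set_def)
qed

section \<open>Hulls of orbits and taut points\<close>

definition orbit_hull :: "'p \<Rightarrow> 'p set"
  where "orbit_hull x = {z \<in> X. \<exists>g\<in>carrier G. \<exists>h\<in>carrier G. between (\<phi> g x) z (\<phi> h x)}"

lemma orbit_hull_convex:
  assumes x: "x \<in> X"
  shows "convex_in (orbit_hull x)"
  unfolding convex_in_def
proof (intro conjI ballI impI)
  show "orbit_hull x \<subseteq> X" by (auto simp: orbit_hull_def)
  fix c c' z assume c: "c \<in> orbit_hull x" "c' \<in> orbit_hull x" and z: "z \<in> X" "between c z c'"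
  obtain g h where gh: "g \<in> carrier G" "h \<in> carrier G" "between (\<phi> g x) c (\<phi> h x)"
    using c(1) by (auto simp: orbit_hull_def)
  obtain g' h' where gh': "g' \<in> carrier G" "h' \<in> carrier G" "between (\<phi> g' x) c' (\<phi> h' x)"
    using c(2) by (auto simp: orbit_hull_def)
  have cX: "c \<in> X" "c' \<in> X" using c by (auto simp: orbit_hull_def)
  have "\<exists>u\<in>{\<phi> g x, \<phi> h x}. \<exists>v\<in>{\<phi> g' x, \<phi> h' x}. between u z v"
    by (rule between_segments[OF _ _ cX(1) _ _ cX(2) z(1) gh(3) gh'(3) z(2)])
      (simp_all add: act_in gh gh' x)
  then show "z \<in> orbit_hull x"
    using gh(1,2) gh'(1,2) z(1) unfolding orbit_hull_def by blast
qed

lemma orbit_hull_act: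
  assumes x: "x \<in> X" and g: "g \<in> carrier G"
  shows "\<phi> g ` orbit_hull x \<subseteq> orbit_hull x"
proof
  fix w assume "w \<in> \<phi> g ` orbit_hull x"
  then obtain z h k where *: "w = \<phi> g z" "z \<in> X" "h \<in> carrier G" "k \<in> carrier G"
    "between (\<phi> h x) z (\<phi> k x)"
    by (auto simp: orbit_hull_def)
  then have "between (\<phi> (g \<otimes> h) x) w (\<phi> (g \<otimes> k) x)"
    using between_act[OF g act_in[of h x] _ act_in[of k x]] act_mult x g by simp
  then show "w \<in> orbit_hull x"
    using * g act_in[of g z] unfolding orbit_hull_def by blast
qed

lemma orbit_hull_base: "x \<in> X \<Longrightarrow> x \<in> orbit_hull x"
  unfolding orbit_hull_def by (auto simp: between_def act_one intro!: bexI[of _ \<one>])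

text \<open>Since \<open>len (s \<otimes> t) \<le> d x (\<phi> s x) + d x (\<phi> t x)\<close> always holds, the length function together with
  an upper bound for the displacement of \<open>t\<close> bounds the displacement of \<open>s\<close> at a taut point from below.\<close>

definition taut :: "'p \<Rightarrow> bool"
  where "taut x \<longleftrightarrow> x \<in> X \<and>
    (\<forall>s\<in>carrier G. \<exists>t\<in>carrier G. d x (\<phi> s x) + d x (\<phi> t x) \<le> len (s \<otimes> t))"

lemma len_mult_le:
  assumes "s \<in> carrier G" "t \<in> carrier G" "x \<in> X"
  shows "len (s \<otimes> t) \<le> d x (\<phi> s x) + d x (\<phi> t x)"
proof -
  have "len (s \<otimes> t) \<le> d x (\<phi> s (\<phi> t x))"
    using len_le[of "s \<otimes> t" x] act_mult[of s t x] assms by simp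
  also have "\<dots> \<le> d x (\<phi> s x) + d (\<phi> s x) (\<phi> s (\<phi> t x))"
    using triangle[of x "\<phi> s x" "\<phi> s (\<phi> t x)"] act_in assms by simp
  also have "d (\<phi> s x) (\<phi> s (\<phi> t x)) = d x (\<phi> t x)"
    using act_dist act_in assms by simp
  finally show ?thesis .
qed

end

section \<open>Transverse pairs\<close>

context tree_action
begin

text \<open>Translating the two hypotheses by \<open>s\<close> and by
  \<open>w = s \<otimes> t\<close> shows that \<open>x, s x, w x, w s x, w w x\<close> lie in this
  order on a geodesic, so \<open>w\<close> translates by the full distance
  \<open>d x (w x)\<close>.\<close>

lemma len_mult_aligned:
  assumes st: "s \<in> carrier G" "t \<in> carrier G" and x: "x \<in> X" and "\<phi> s x \<noteq> x" "\<phi> t x \<noteq> x"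
    and b: "between (\<phi> t x) x (\<phi> (inv s) x)" "between (\<phi> (inv t) x) x (\<phi> s x)"
  shows "d x (\<phi> s x) + d x (\<phi> t x) \<le> len (s \<otimes> t)"
proof -
  define w where "w = s \<otimes> t"
  have w: "w \<in> carrier G" using st by (simp add: w_def)
  have X: "\<phi> s x \<in> X" "\<phi> t x \<in> X" "\<phi> w x \<in> X" "\<phi> w (\<phi> s x) \<in> X" "\<phi> w (\<phi> w x) \<in> X"
      "\<phi> (inv s) x \<in> X" "\<phi> (inv t) x \<in> X"
    using act_in st w x by simp_all
  have wx: "\<phi> w x = \<phi> s (\<phi> t x)" using act_mult st x by (simp add: w_def)
  have wt: "\<phi> w (\<phi> (inv t) x) = \<phi> s x"
    using act_mult[OF st X(7)] act_inv(2)[OF st(2) x] by (simp add: w_def)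
  have dw: "d (\<phi> s x) (\<phi> w x) = d x (\<phi> t x)" using act_dist[OF st(1) x X(2)] by (simp add: wx)
  have dws: "d (\<phi> w x) (\<phi> w (\<phi> s x)) = d x (\<phi> s x)" using act_dist[OF w x X(1)] .
  have 1: "between x (\<phi> s x) (\<phi> w x)"
    using between_act[OF st(1) X(2) x X(6)] b(1) act_inv(2)[OF st(1) x] between_sym by (simp add: wx)
  have 2: "between (\<phi> s x) (\<phi> w x) (\<phi> w (\<phi> s x))"
    using between_act[OF w X(7) x X(1)] b(2) by (simp add: wt)
  have 3: "between (\<phi> w x) (\<phi> w (\<phi> s x)) (\<phi> w (\<phi> w x))"
    using between_act[OF w x X(1,3)] 1 by simp
  have ne: "\<phi> s x \<noteq> \<phi> w x" "\<phi> w x \<noteq> \<phi> w (\<phi> s x)"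
    using assms(4,5) mdist_pos_less[of x "\<phi> t x"] mdist_pos_less[of x "\<phi> s x"] x X dw dws by auto
  have d1: "d x (\<phi> w x) = d x (\<phi> s x) + d x (\<phi> t x)" using 1 dw by (simp add: between_def)
  have "d x (\<phi> w (\<phi> s x)) = d x (\<phi> w x) + d x (\<phi> s x)"
    using chain[OF x X(1,3,4) 1 2 ne(1)] d1 dw dws by simp
  then have "between x (\<phi> w x) (\<phi> w (\<phi> s x))" using dws by (simp add: between_def)
  from chain[OF x X(3,4,5) this 3 ne(2)]
  have "d x (\<phi> w (\<phi> w x)) = 2 * d x (\<phi> w x)"
    using act_dist[OF w X(1,3)] d1 dw dws by simp
  then show ?thesis
    using len_attained(1)[OF w x] d1 by (simp add: w_def[symmetric])
qed

text \<open>The point \<open>x\<close> lies on an axis of \<open>g\<close>, and \<open>k x\<close>,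
  \<open>inv k x\<close> leave \<open>x\<close> in directions other than the two of that axis.
  Written with \<open>between\<close> alone, the condition concerns finitely many displacements of
  \<open>x\<close> and can be carried to another tree.\<close>

definition transverse :: "'g \<Rightarrow> 'g \<Rightarrow> 'p \<Rightarrow> bool"
  where "transverse g k x \<longleftrightarrow> g \<in> carrier G \<and> k \<in> carrier G \<and> x \<in> X \<and> \<phi> g x \<noteq> x \<and> \<phi> k x \<noteq> x \<and>
    between (\<phi> g x) x (\<phi> (inv g) x) \<and>
    (\<forall>u\<in>{k, inv k}. \<forall>v\<in>{g, inv g}. between (\<phi> u x) x (\<phi> v x))"

text \<open>\<open>s x\<close> shares its direction at \<open>x\<close> with at most one of
  \<open>g x\<close>, \<open>inv g x\<close>, and so does \<open>inv s x\<close>. If both point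
  along the same one of these two, then neither points towards \<open>k x\<close> or
  \<open>inv k x\<close>, and \<open>k\<close> is aligned with \<open>s\<close> as in
  \<open>len_mult_aligned\<close>; otherwise \<open>g\<close> or \<open>inv g\<close> is.\<close>

lemma transverse_taut:
  assumes tr: "transverse g k x"
  shows "taut x"
  unfolding taut_def
proof (intro conjI ballI)
  have gk: "g \<in> carrier G" "k \<in> carrier G" and x: "x \<in> X" and ne: "\<phi> g x \<noteq> x" "\<phi> k x \<noteq> x"
    and gg: "between (\<phi> g x) x (\<phi> (inv g) x)"
    and kg: "between (\<phi> k x) x (\<phi> g x)" "between (\<phi> k x) x (\<phi> (inv g) x)"
      "between (\<phi> (inv k) x) x (\<phi> g x)" "between (\<phi> (inv k) x) x (\<phi> (inv g) x)"
    using tr by (auto simp: transverse_def)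
  show "x \<in> X" by fact
  fix s assume s: "s \<in> carrier G"
  have in_X: "\<phi> u x \<in> X" if "u \<in> carrier G" for u using act_in that x by simp
  have inv_ne: "\<phi> (inv g) x \<noteq> x" using act_inv(2)[OF gk(1) x] ne(1) by auto
  have or: "between (\<phi> u x) x (\<phi> w x) \<or> between (\<phi> w x) x (\<phi> v x)"
    if "between (\<phi> u x) x (\<phi> v x)" "u \<in> carrier G" "v \<in> carrier G" "w \<in> carrier G" for u v w
    using between_or[of "\<phi> u x" "\<phi> w x" "\<phi> v x" x] in_X x that by simp
  let ?b = "\<lambda>u v. between (\<phi> u x) x (\<phi> v x)"
  have sym: "?b u v \<longleftrightarrow> ?b v u" for u v by (rule between_sym)
  have ic: "inv s \<in> carrier G" "inv g \<in> carrier G" "inv k \<in> carrier G" using s gk by simp_all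
  note A = or[OF gg gk(1) ic(2) s] or[OF gg gk(1) ic(2) ic(1)]
    or[OF kg(1) gk(2) gk(1) ic(1)] or[OF kg(2) gk(2) ic(2) ic(1)]
    or[OF kg(3) ic(3) gk(1) s] or[OF kg(4) ic(3) ic(2) s]
  have "\<phi> s x = x \<or> (?b g (inv s) \<and> ?b (inv g) s) \<or> (?b (inv g) (inv s) \<and> ?b g s) \<or>
      (?b k (inv s) \<and> ?b (inv k) s)"
    using A sym by blast
  then show "\<exists>t\<in>carrier G. d x (\<phi> s x) + d x (\<phi> t x) \<le> len (s \<otimes> t)"
  proof (elim disjE conjE)
    assume "\<phi> s x = x"
    then show ?thesis using len_nonneg[of "s \<otimes> \<one>"] s x act_one[OF x] by (intro bexI[of _ \<one>]) simp_all
  next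
    assume "?b g (inv s)" "?b (inv g) s"
    then show ?thesis
      using len_mult_aligned[OF s gk(1) x _ ne(1)] gk len_nonneg[of "s \<otimes> \<one>"] s x act_one[OF x]
      by (cases "\<phi> s x = x") (auto intro: bexI[of _ g] bexI[of _ \<one>])
  next
    assume "?b (inv g) (inv s)" "?b g s"
    then show ?thesis
      using len_mult_aligned[OF s ic(2) x _ inv_ne] gk len_nonneg[of "s \<otimes> \<one>"] s x act_one[OF x]
      by (cases "\<phi> s x = x") (auto intro: bexI[of _ "inv g"] bexI[of _ \<one>])
  next
    assume "?b k (inv s)" "?b (inv k) s"
    then show ?thesis
      using len_mult_aligned[OF s gk(2) x _ ne(2)] gk len_nonneg[of "s \<otimes> \<one>"] s x act_one[OF x]
      by (cases "\<phi> s x = x") (auto intro: bexI[of _ k] bexI[of _ \<one>])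
  qed
qed

text \<open>\<open>y, x, g x, g y\<close> lie in this order on a geodesic, so the displacement grows
  by \<open>2 * d x y\<close>.\<close>

lemma displacement_outside:
  assumes g: "g \<in> carrier G" and X: "x \<in> X" "y \<in> X" and ne: "\<phi> g x \<noteq> x" "y \<noteq> x"
    and b: "between y x (\<phi> g x)" "between y x (\<phi> (inv g) x)"
  shows "d x (\<phi> g x) < d y (\<phi> g y)"
proof -
  have gX: "\<phi> g x \<in> X" "\<phi> g y \<in> X" "\<phi> (inv g) x \<in> X" using act_in g X by simp_all
  have "between x (\<phi> g x) (\<phi> g y)"
    using between_act[OF g gX(3) X] b(2) act_inv(2)[OF g X(1)] between_sym[of y x "\<phi> (inv g) x"]
    by simp
  then have "d y (\<phi> g y) = d y x + d x (\<phi> g x) + d (\<phi> g x) (\<phi> g y)"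
    using chain[OF X(2,1) gX(1,2) b(1)] ne(1) by simp
  then show ?thesis
    using act_dist[OF g X] mdist_pos_less[OF ne(2) X(2,1)] commute[of x y] by simp
qed

text \<open>A point other than \<open>x\<close> that \<open>g\<close> moves no farther than
  \<open>x\<close> lies in the direction of \<open>g x\<close> or \<open>inv g x\<close>; the same
  holds for \<open>k\<close>. At a transverse point no direction is of both kinds.\<close>

lemma transverse_unique:
  assumes tr: "transverse g k x" and y: "y \<in> X"
    and le: "d y (\<phi> g y) \<le> d x (\<phi> g x)" "d y (\<phi> k y) \<le> d x (\<phi> k x)"
  shows "y = x"
proof (rule ccontr)
  assume "y \<noteq> x"
  have gk: "g \<in> carrier G" "k \<in> carrier G" and x: "x \<in> X" and ne: "\<phi> g x \<noteq> x" "\<phi> k x \<noteq> x"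
    and kg: "between (\<phi> k x) x (\<phi> g x)" "between (\<phi> k x) x (\<phi> (inv g) x)"
      "between (\<phi> (inv k) x) x (\<phi> g x)" "between (\<phi> (inv k) x) x (\<phi> (inv g) x)"
    using tr by (auto simp: transverse_def)
  have X: "\<phi> g x \<in> X" "\<phi> k x \<in> X" "\<phi> (inv g) x \<in> X" "\<phi> (inv k) x \<in> X"
    using act_in gk x by simp_all
  have "\<not> between y x (\<phi> g x) \<or> \<not> between y x (\<phi> (inv g) x)"
    using displacement_outside[OF gk(1) x y ne(1) \<open>y \<noteq> x\<close>] le(1) by linarith
  moreover have "\<not> between y x (\<phi> k x) \<or> \<not> between y x (\<phi> (inv k) x)"
    using displacement_outside[OF gk(2) x y ne(2) \<open>y \<noteq> x\<close>] le(2) by linarith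
  ultimately show False
    using between_or[OF X(2) y X(1) x kg(1)] between_or[OF X(2) y X(3) x kg(2)]
      between_or[OF X(4) y X(1) x kg(3)] between_or[OF X(4) y X(3) x kg(4)]
      between_sym[of y x "\<phi> k x"] between_sym[of y x "\<phi> (inv k) x"] by argo
qed

section \<open>Finite test sets for lengths\<close>

definition tautness_witness :: "'p \<Rightarrow> 'g \<Rightarrow> 'g"
  where "tautness_witness x s =
    (SOME t. t \<in> carrier G \<and> d x (\<phi> s x) + d x (\<phi> t x) \<le> len (s \<otimes> t))"

lemma tautness_witness:
  assumes "taut x" "s \<in> carrier G"
  shows "tautness_witness x s \<in> carrier G"
    and "d x (\<phi> s x) + d x (\<phi> (tautness_witness x s) x) \<le> len (s \<otimes> tautness_witness x s)"
proof -
  have "\<exists>t. t \<in> carrier G \<and> d x (\<phi> s x) + d x (\<phi> t x) \<le> len (s \<otimes> t)"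
    using assms unfolding taut_def by blast
  from someI_ex[OF this]
  show "tautness_witness x s \<in> carrier G"
    and "d x (\<phi> s x) + d x (\<phi> (tautness_witness x s) x) \<le> len (s \<otimes> tautness_witness x s)"
    unfolding tautness_witness_def by simp_all
qed

text \<open>Products of pairs are included because their lengths enter twice: in the pairwise
  condition for slow sets, and in the lower bound for \<open>s\<close> through the length of
  \<open>s\<close> times its witness.\<close>

definition test_set :: "'p \<Rightarrow> 'g set \<Rightarrow> 'g set"
  where "test_set x F = (let H = F \<union> tautness_witness x ` F in H \<union> (\<lambda>(s, t). s \<otimes> t) ` (H \<times> H))"

lemma test_set:
  assumes "taut x" "finite F" "F \<subseteq> carrier G"
  shows "finite (test_set x F)" "test_set x F \<subseteq> carrier G"
proof -
  show "finite (test_set x F)" using assms(2) by (simp add: test_set_def Let_def)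
  have "F \<union> tautness_witness x ` F \<subseteq> carrier G" using assms(3) tautness_witness(1)[OF assms(1)] by blast
  then show "test_set x F \<subseteq> carrier G" by (auto simp: test_set_def Let_def)
qed

end

section \<open>Comparing two actions\<close>

lemma abs_max_diff_le:
  fixes a b a' b' k :: real
  assumes "\<bar>a - a'\<bar> \<le> k" "\<bar>b - b'\<bar> \<le> k"
  shows "\<bar>max a b - max a' b'\<bar> \<le> k"
  using assms by (simp add: max_def abs_le_iff)

lemma abs_diff3_le:
  fixes p q r p' q' r' k :: real
  assumes "\<bar>p - p'\<bar> \<le> k" "\<bar>q - q'\<bar> \<le> 2 * k" "\<bar>r - r'\<bar> \<le> 2 * k"
  shows "\<bar>(p - q - r) - (p' - q' - r')\<bar> \<le> 5 * k"
  using assms by linarith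

locale tree_action_pair = T: tree_action X d G \<phi> + U: tree_action Y e G \<psi>
  for X :: "'p set" and d and G :: "('g, 'm) monoid_scheme" (structure) and \<phi>
    and Y :: "'q set" and e and \<psi>
begin

text \<open>A common slow point for radii enlarged by \<open>\<delta>\<close> gives the upper bound.
  For the lower one, with \<open>t\<close> the witness of \<open>s\<close>, \<open>e y (s y)\<close>
  is at least \<open>U.len (s \<otimes> t) - e y (t y)\<close>, which loses \<open>\<delta>\<close>
  in the length and \<open>\<delta>\<close> in the displacement of \<open>t\<close>.\<close>

lemma orbit_approx:
  assumes x: "T.taut x" and F: "finite F" "F \<subseteq> carrier G"
    and \<delta>: "0 \<le> \<delta>" "\<And>s. s \<in> T.test_set x F \<Longrightarrow> \<bar>U.len s - T.len s\<bar> \<le> \<delta>"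
  obtains y where "y \<in> Y" "\<And>s. s \<in> F \<Longrightarrow> \<bar>e y (\<psi> s y) - d x (\<phi> s x)\<bar> \<le> 2 * \<delta>"
proof -
  define H where "H = F \<union> T.tautness_witness x ` F"
  have test: "T.test_set x F = H \<union> (\<lambda>(s, t). s \<otimes> t) ` (H \<times> H)"
    by (simp add: T.test_set_def H_def Let_def)
  have "finite H" using F(1) by (simp add: H_def)
  moreover have "H \<subseteq> carrier G" using F(2) T.tautness_witness(1)[OF x] unfolding H_def by blast
  ultimately have H: "finite H" "H \<subseteq> carrier G" .
  have xX: "x \<in> X" using x by (simp add: T.taut_def)
  obtain y where y: "y \<in> Y" "\<And>s. s \<in> H \<Longrightarrow> e y (\<psi> s y) \<le> d x (\<phi> s x) + \<delta>"
  proof (rule U.common_slow_point[OF H])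
    fix s assume s: "s \<in> H"
    have "s \<in> T.test_set x F" using s by (simp add: test)
    then show "U.len s \<le> d x (\<phi> s x) + \<delta>"
      using T.len_le[OF subsetD[OF H(2) s] xX] \<delta>(2)[of s] by linarith
    fix t assume t: "t \<in> H"
    have "t \<otimes> s \<in> T.test_set x F" unfolding test using s t by (intro UnI2 image_eqI[of _ _ "(t, s)"]) simp_all
    then have "U.len (t \<otimes> s) \<le> T.len (t \<otimes> s) + \<delta>" using \<delta>(2)[of "t \<otimes> s"] by simp
    moreover have "T.len (t \<otimes> s) \<le> d x (\<phi> t x) + d x (\<phi> s x)"
      by (rule T.len_mult_le[OF subsetD[OF H(2) t] subsetD[OF H(2) s] xX])
    ultimately show "U.len (t \<otimes> s) \<le> (d x (\<phi> s x) + \<delta>) + (d x (\<phi> t x) + \<delta>)"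
      using \<delta>(1) by linarith
  qed blast
  have "\<bar>e y (\<psi> s y) - d x (\<phi> s x)\<bar> \<le> 2 * \<delta>" if s: "s \<in> F" for s
  proof -
    define t where "t = T.tautness_witness x s"
    have sG: "s \<in> carrier G" using s F(2) by blast
    have t: "t \<in> carrier G" "d x (\<phi> s x) + d x (\<phi> t x) \<le> T.len (s \<otimes> t)"
      using T.tautness_witness[OF x sG] by (simp_all add: t_def)
    have "s \<in> H" "t \<in> H" using s by (simp_all add: H_def t_def)
    then have "e y (\<psi> s y) \<le> d x (\<phi> s x) + \<delta>" "e y (\<psi> t y) \<le> d x (\<phi> t x) + \<delta>"
      and "s \<otimes> t \<in> T.test_set x F"
      unfolding test using y(2) by (simp, simp, intro UnI2 image_eqI[of _ _ "(s, t)"], simp_all)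
    moreover from this have "T.len (s \<otimes> t) \<le> U.len (s \<otimes> t) + \<delta>" using \<delta>(2)[of "s \<otimes> t"] by simp
    moreover have "U.len (s \<otimes> t) \<le> e y (\<psi> s y) + e y (\<psi> t y)"
      using U.len_mult_le[OF sG t(1) y(1)] .
    ultimately show ?thesis using t(2) \<delta>(1) by linarith
  qed
  with y(1) show thesis by (rule that)
qed

text \<open>Every clause of \<open>transverse\<close> compares distances among \<open>x\<close> and
  its translates by \<open>L\<close>; by \<open>dist_orbit\<close> those between two translates are
  displacements by \<open>inv u \<otimes> v\<close>.\<close>

lemma transverse_transfer:
  assumes tr: "T.transverse g k x" and y: "y \<in> Y"
    and L: "L = {g, k, inv g, inv k}"
    and eq: "\<And>s. s \<in> L \<union> (\<lambda>(u, v). inv u \<otimes> v) ` (L \<times> L) \<Longrightarrow> e y (\<psi> s y) = d x (\<phi> s x)"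
  shows "U.transverse g k y"
proof -
  have gk: "g \<in> carrier G" "k \<in> carrier G" and x: "x \<in> X"
    using tr by (simp_all add: T.transverse_def)
  have LG: "L \<subseteq> carrier G" using gk by (simp add: L)
  have d1: "e y (\<psi> u y) = d x (\<phi> u x)" if "u \<in> L" for u using eq[of u] that by simp
  have d2: "e (\<psi> u y) (\<psi> v y) = d (\<phi> u x) (\<phi> v x)" if uv: "u \<in> L" "v \<in> L" for u v
  proof -
    have "inv u \<otimes> v \<in> (\<lambda>(u, v). inv u \<otimes> v) ` (L \<times> L)" using uv by force
    then have "e y (\<psi> (inv u \<otimes> v) y) = d x (\<phi> (inv u \<otimes> v) x)" by (intro eq UnI2)
    moreover have "u \<in> carrier G" "v \<in> carrier G" using uv LG by blast+
    ultimately show ?thesis using T.dist_orbit[of u v x] U.dist_orbit[of u v y] x y by simp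
  qed
  have b: "U.between (\<psi> u y) y (\<psi> v y) \<longleftrightarrow> T.between (\<phi> u x) x (\<phi> v x)" if "u \<in> L" "v \<in> L" for u v
    unfolding U.between_def T.between_def using d1[OF that(1)] d1[OF that(2)] d2[OF that]
      U.commute[of "\<psi> u y" y] T.commute[of "\<phi> u x" x] by simp
  have ne: "\<psi> u y \<noteq> y" if "\<phi> u x \<noteq> x" "u \<in> L" for u
  proof
    assume "\<psi> u y = y"
    then have "d x (\<phi> u x) = 0" using d1[OF that(2)] y by simp
    moreover have "\<phi> u x \<in> X" using T.act_in that(2) LG x by blast
    ultimately show False using that(1) x T.mdist_pos_less[of x "\<phi> u x"] by simp
  qed
  show ?thesis
    using tr ne[of g] ne[of k] b[of g "inv g"] b[of k g] b[of k "inv g"] b[of "inv k" g]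
      b[of "inv k" "inv g"] y unfolding U.transverse_def T.transverse_def by (simp add: L)
qed

text \<open>The point found for a finite set may depend on the set. Prescribing the displacements in
  \<open>F\<close> makes it transverse for \<open>g\<close> and \<open>k\<close>, hence unique, so
  adding any \<open>s\<close> to \<open>F\<close> returns the same point.\<close>

lemma orbit_transfer:
  assumes len: "\<And>s. s \<in> carrier G \<Longrightarrow> U.len s = T.len s" and tr: "T.transverse g k x"
  obtains y where "y \<in> Y" "\<And>s. s \<in> carrier G \<Longrightarrow> e y (\<psi> s y) = d x (\<phi> s x)"
proof -
  have gk: "g \<in> carrier G" "k \<in> carrier G" using tr by (simp_all add: T.transverse_def)
  have taut: "T.taut x" using T.transverse_taut[OF tr] .
  define L where "L = {g, k, inv g, inv k}"
  define F where "F = L \<union> (\<lambda>(u, v). inv u \<otimes> v) ` (L \<times> L)"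
  have LG: "L \<subseteq> carrier G" using gk by (simp add: L_def)
  have F: "finite F" "F \<subseteq> carrier G" using LG by (auto simp: F_def L_def)
  have gkF: "g \<in> F" "k \<in> F" by (simp_all add: F_def L_def)
  have ex: "\<exists>y\<in>Y. \<forall>s\<in>F'. e y (\<psi> s y) = d x (\<phi> s x)"
    if F': "finite F'" "F' \<subseteq> carrier G" for F'
  proof -
    have "\<bar>U.len s - T.len s\<bar> \<le> 0" if "s \<in> T.test_set x F'" for s
      using T.test_set(2)[OF taut F'] that len[of s] by auto
    then obtain y where "y \<in> Y" "\<And>s. s \<in> F' \<Longrightarrow> \<bar>e y (\<psi> s y) - d x (\<phi> s x)\<bar> \<le> 2 * 0"
      using orbit_approx[OF taut F', of 0] by (metis order_refl)
    then show ?thesis by auto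
  qed
  obtain y where y: "y \<in> Y" "\<And>s. s \<in> F \<Longrightarrow> e y (\<psi> s y) = d x (\<phi> s x)"
    using ex[OF F] by blast
  have "U.transverse g k y"
    using transverse_transfer[OF tr y(1) L_def] y(2) unfolding F_def by blast
  note uniq = U.transverse_unique[OF this]
  have "e y (\<psi> s y) = d x (\<phi> s x)" if s: "s \<in> carrier G" for s
  proof -
    obtain z where z: "z \<in> Y" "\<And>t. t \<in> insert s F \<Longrightarrow> e z (\<psi> t z) = d x (\<phi> t x)"
      using ex[of "insert s F"] F s by auto
    have "z = y" using uniq[OF z(1)] z(2) y(2) gkF by simp
    then show ?thesis using z(2) by simp
  qed
  with y(1) show thesis by (rule that)
qed

text \<open>A relation in place of a map, so that the two trees can exchange roles: this yields
  surjectivity of the isometry, while uniqueness of the partner yields equivariance.\<close>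

definition corresponding :: "'p \<Rightarrow> 'q \<Rightarrow> 'p \<Rightarrow> 'q \<Rightarrow> bool"
  where "corresponding x y z w \<longleftrightarrow> z \<in> X \<and> w \<in> Y \<and> (\<forall>k\<in>carrier G. e w (\<psi> k y) = d z (\<phi> k x))"

lemma orbit_dist_eq:
  assumes "x \<in> X" "y \<in> Y" "\<And>s. s \<in> carrier G \<Longrightarrow> e y (\<psi> s y) = d x (\<phi> s x)"
    and "g \<in> carrier G" "h \<in> carrier G"
  shows "e (\<psi> g y) (\<psi> h y) = d (\<phi> g x) (\<phi> h x)"
  using assms T.dist_orbit[of g h x] U.dist_orbit[of g h y] by simp

text \<open>\<open>w\<close> is put at the same position on \<open>[g y, h y]\<close> as
  \<open>z\<close> on \<open>[g x, h x]\<close>; \<open>dist_to_segment\<close> then determines its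
  distances to the whole orbit.\<close>

lemma corresponding_ex:
  assumes x: "x \<in> X" and y: "y \<in> Y" and eq: "\<And>s. s \<in> carrier G \<Longrightarrow> e y (\<psi> s y) = d x (\<phi> s x)"
    and z: "z \<in> T.orbit_hull x"
  shows "\<exists>w. corresponding x y z w"
proof -
  obtain g h where gh: "g \<in> carrier G" "h \<in> carrier G" and zX: "z \<in> X"
    and b: "T.between (\<phi> g x) z (\<phi> h x)"
    using z by (auto simp: T.orbit_hull_def)
  have X: "\<phi> k x \<in> X" "\<psi> k y \<in> Y" if "k \<in> carrier G" for k using T.act_in U.act_in x y that by simp_all
  have dd: "e (\<psi> g y) (\<psi> h y) = d (\<phi> g x) (\<phi> h x)" using orbit_dist_eq[OF x y eq gh] .
  have "d (\<phi> g x) z \<le> e (\<psi> g y) (\<psi> h y)" using b dd T.nonneg[of z "\<phi> h x"] unfolding T.between_def by linarith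
  then obtain w where w: "w \<in> Y" "e (\<psi> g y) w = d (\<phi> g x) z" "e w (\<psi> h y) = d z (\<phi> h x)"
    using U.segment_point[of "\<psi> g y" "\<psi> h y" "d (\<phi> g x) z"] X gh b dd
    by (auto simp: T.between_def)
  have "U.between (\<psi> g y) w (\<psi> h y)" using w b dd by (simp add: U.between_def T.between_def)
  then have "e w (\<psi> k y) = d z (\<phi> k x)" if k: "k \<in> carrier G" for k
    using U.dist_to_segment[of "\<psi> g y" "\<psi> h y" w "\<psi> k y"] T.dist_to_segment[of "\<phi> g x" "\<phi> h x" z "\<phi> k x"]
      X gh k zX w b orbit_dist_eq[OF x y eq gh(1) k] orbit_dist_eq[OF x y eq gh(2) k] by simp
  then show ?thesis using zX w(1) by (auto simp: corresponding_def)
qed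

text \<open>\<open>w\<close> lies on \<open>[g y, h y]\<close>, and the distances from
  \<open>w'\<close> to the ends of this segment are known by correspondence, so
  \<open>dist_to_segment\<close> gives the same value in both trees.\<close>

lemma corresponding_dist:
  assumes x: "x \<in> X" and y: "y \<in> Y" and eq: "\<And>s. s \<in> carrier G \<Longrightarrow> e y (\<psi> s y) = d x (\<phi> s x)"
    and z: "z \<in> T.orbit_hull x" and zw: "corresponding x y z w" and zw': "corresponding x y z' w'"
  shows "e w w' = d z z'"
proof -
  obtain g h where gh: "g \<in> carrier G" "h \<in> carrier G" and b: "T.between (\<phi> g x) z (\<phi> h x)"
    using z by (auto simp: T.orbit_hull_def)
  have X: "\<phi> k x \<in> X" "\<psi> k y \<in> Y" if "k \<in> carrier G" for k using T.act_in U.act_in x y that by simp_all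
  have zX: "z \<in> X" "w \<in> Y" "z' \<in> X" "w' \<in> Y" using zw zw' by (simp_all add: corresponding_def)
  have c: "e w (\<psi> k y) = d z (\<phi> k x)" "e w' (\<psi> k y) = d z' (\<phi> k x)" if "k \<in> carrier G" for k
    using zw zw' that by (simp_all add: corresponding_def)
  have c': "e (\<psi> k y) w = d (\<phi> k x) z" "e (\<psi> k y) w' = d (\<phi> k x) z'" if "k \<in> carrier G" for k
    using c[OF that] U.commute[of "\<psi> k y"] T.commute[of "\<phi> k x"] by simp_all
  have "U.between (\<psi> g y) w (\<psi> h y)"
    using b c(1)[OF gh(2)] c'(1)[OF gh(1)] orbit_dist_eq[OF x y eq gh]
    by (simp add: U.between_def T.between_def)
  then show ?thesis
    using U.dist_to_segment[of "\<psi> g y" "\<psi> h y" w w'] T.dist_to_segment[of "\<phi> g x" "\<phi> h x" z z']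
      X gh zX b c(1)[OF gh(2)] c'[OF gh(1)] c'[OF gh(2)] by simp
qed

end

text \<open>A point of the hull of an orbit is determined by its distances to the orbit.\<close>

lemma (in tree_action_pair) equivariant_isometry_of_orbits:
  assumes x: "x \<in> X" and y: "y \<in> Y" and eq: "\<And>s. s \<in> carrier G \<Longrightarrow> e y (\<psi> s y) = d x (\<phi> s x)"
    and hull: "T.orbit_hull x = X" "U.orbit_hull y = Y"
  shows "\<exists>f. isometry_between X d Y e f \<and> (\<forall>g\<in>carrier G. \<forall>z\<in>X. f (\<phi> g z) = \<psi> g (f z))"
proof -
  interpret swap: tree_action_pair Y e G \<psi> X d \<phi> by unfold_locales
  have swap: "swap.corresponding y x w z \<longleftrightarrow> corresponding x y z w" for z w
    by (auto simp: corresponding_def swap.corresponding_def)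
  have dist: "e w w' = d z z'" if "corresponding x y z w" "corresponding x y z' w'" for z z' w w'
    using corresponding_dist[OF x y eq _ that] hull(1) that(1) by (simp add: corresponding_def)
  define f where "f z = (SOME w. corresponding x y z w)" for z
  have f: "corresponding x y z (f z)" if "z \<in> X" for z
    unfolding f_def by (rule someI_ex[OF corresponding_ex[OF x y eq]]) (simp_all add: hull(1) that)
  have fY: "f z \<in> Y" if "z \<in> X" for z using f[OF that] by (simp add: corresponding_def)
  have uniq: "f z = w" if c: "corresponding x y z w" for z w
  proof -
    have z: "z \<in> X" "w \<in> Y" using c by (simp_all add: corresponding_def)
    have "e (f z) w = 0" using dist[OF f[OF z(1)] c] z by simp
    then show ?thesis using U.mdist_pos_less[of "f z" w] fY[OF z(1)] z(2) by fastforce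
  qed
  have "isometry_between X d Y e f"
    unfolding isometry_between_def bij_betw_def
  proof (intro conjI ballI)
    show "e (f z) (f z') = d z z'" if "z \<in> X" "z' \<in> X" for z z'
      using dist[OF f f] that by simp
    show "inj_on f X"
    proof (rule inj_onI)
      fix z z' assume z: "z \<in> X" "z' \<in> X" "f z = f z'"
      then have "d z z' = 0" using dist[OF f[OF z(1)] f[OF z(2)]] fY[OF z(1)] by simp
      then show "z = z'" using T.mdist_pos_less[of z z'] z by fastforce
    qed
    show "f ` X = Y"
    proof
      show "f ` X \<subseteq> Y" using fY by blast
      show "Y \<subseteq> f ` X"
      proof
        fix w assume w: "w \<in> Y"
        then obtain z where "corresponding x y z w"
          using swap.corresponding_ex[OF y x, of w] eq hull(2) swap by auto
        then show "w \<in> f ` X" using uniq by (auto simp: corresponding_def)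
      qed
    qed
  qed
  moreover have "f (\<phi> g z) = \<psi> g (f z)" if g: "g \<in> carrier G" and z: "z \<in> X" for g z
  \<comment> \<open>It is enough that \<open>\<psi> g (f z)\<close> has the right distances to the
    orbit; moving \<open>g\<close> to the other argument turns them into distances from
    \<open>f z\<close>.\<close>
  proof (rule uniq)
    have "e (\<psi> g (f z)) (\<psi> k y) = d (\<phi> g z) (\<phi> k x)" if k: "k \<in> carrier G" for k
    proof -
      have "e (\<psi> g (f z)) (\<psi> k y) = e (f z) (\<psi> (inv g \<otimes> k) y)"
        using U.act_dist_inv(1)[OF g fY[OF z], of "\<psi> k y"] U.act_in[OF k y] U.act_mult[of "inv g" k y]
          g k y by simp
      also have "\<dots> = d z (\<phi> (inv g \<otimes> k) x)"
        using f[OF z] g k by (simp add: corresponding_def)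
      also have "\<dots> = d (\<phi> g z) (\<phi> k x)"
        using T.act_dist_inv(1)[OF g z, of "\<phi> k x"] T.act_in[OF k x] T.act_mult[of "inv g" k x]
          g k x by simp
      finally show ?thesis .
    qed
    then show "corresponding x y (\<phi> g z) (\<psi> g (f z))"
      using T.act_in[OF g z] U.act_in[OF g fY[OF z]] by (simp add: corresponding_def)
  qed
  ultimately show ?thesis by blast
qed

section \<open>Approximate transfer of points on segments\<close>

context tree_action_pair
begin

lemma segment_transfer:
  assumes x: "x \<in> X" and y: "y \<in> Y" and gh: "g \<in> carrier G" "h \<in> carrier G"
    and close: "\<bar>e y (\<psi> (inv g \<otimes> h) y) - d x (\<phi> (inv g \<otimes> h) x)\<bar> \<le> \<eta>"
    and z: "T.between (\<phi> g x) z (\<phi> h x)"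
  shows "\<exists>w\<in>Y. U.between (\<psi> g y) w (\<psi> h y) \<and> \<bar>e (\<psi> g y) w - d (\<phi> g x) z\<bar> \<le> \<eta> \<and>
    \<bar>e w (\<psi> h y) - d z (\<phi> h x)\<bar> \<le> 2 * \<eta>"
proof -
  \<comment> \<open>The segment in \<open>Y\<close> may be too short for the position of
    \<open>z\<close>, so the position is cut off at its end. This costs at most
    \<open>\<eta>\<close>; the distance to the other end also suffers from the change of total
    length.\<close>
  define u where "u = min (d (\<phi> g x) z) (e (\<psi> g y) (\<psi> h y))"
  have close': "\<bar>e (\<psi> g y) (\<psi> h y) - d (\<phi> g x) (\<phi> h x)\<bar> \<le> \<eta>"
    using close T.dist_orbit[OF gh x] U.dist_orbit[OF gh y] by simp
  have "0 \<le> u" "u \<le> e (\<psi> g y) (\<psi> h y)" by (simp_all add: u_def)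
  then obtain w where w: "w \<in> Y" "e (\<psi> g y) w = u" "e w (\<psi> h y) = e (\<psi> g y) (\<psi> h y) - u"
    using U.segment_point[of "\<psi> g y" "\<psi> h y" u] U.act_in gh y by blast
  have "\<bar>u - d (\<phi> g x) z\<bar> \<le> \<eta>" "\<bar>e (\<psi> g y) (\<psi> h y) - u - d z (\<phi> h x)\<bar> \<le> 2 * \<eta>"
    using close' z T.nonneg[of z "\<phi> h x"] unfolding u_def T.between_def min_def
    by (smt (verit))+
  then show ?thesis using w by (intro bexI[of _ w]) (simp_all add: U.between_def)
qed

text \<open>Each of the four terms in \<open>dist_segments\<close> is an end distance minus two
  positions, with errors \<open>\<eta>\<close>, \<open>2 * \<eta>\<close> and
  \<open>2 * \<eta>\<close>; taking maxima does not increase the error.\<close>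

lemma segments_dist_transfer:
  assumes x: "x \<in> X" and y: "y \<in> Y" and a: "a \<in> carrier G"
    and G: "g \<in> carrier G" "h \<in> carrier G" "g' \<in> carrier G" "h' \<in> carrier G"
    and X: "z \<in> X" "z' \<in> X" "w \<in> Y" "w' \<in> Y"
    and close: "\<And>u v. u \<in> {g, h} \<Longrightarrow> v \<in> {g', h'} \<Longrightarrow>
      \<bar>e y (\<psi> (inv u \<otimes> (a \<otimes> v)) y) - d x (\<phi> (inv u \<otimes> (a \<otimes> v)) x)\<bar> \<le> \<eta>"
    and z: "T.between (\<phi> g x) z (\<phi> h x)" "T.between (\<phi> g' x) z' (\<phi> h' x)"
    and w: "U.between (\<psi> g y) w (\<psi> h y)" "\<bar>e (\<psi> g y) w - d (\<phi> g x) z\<bar> \<le> \<eta>"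
      "\<bar>e w (\<psi> h y) - d z (\<phi> h x)\<bar> \<le> 2 * \<eta>"
    and w': "U.between (\<psi> g' y) w' (\<psi> h' y)" "\<bar>e (\<psi> g' y) w' - d (\<phi> g' x) z'\<bar> \<le> \<eta>"
      "\<bar>e w' (\<psi> h' y) - d z' (\<phi> h' x)\<bar> \<le> 2 * \<eta>"
  shows "\<bar>e w (\<psi> a w') - d z (\<phi> a z')\<bar> \<le> 5 * \<eta>"
proof -
  have tX: "\<phi> k x \<in> X" "\<psi> k y \<in> Y" if "k \<in> carrier G" for k using T.act_in U.act_in x y that by simp_all
  have aX: "\<phi> a v \<in> X" if "v \<in> X" for v using T.act_in a that by simp
  have aY: "\<psi> a v \<in> Y" if "v \<in> Y" for v using U.act_in a that by simp
  have bz: "T.between (\<phi> a (\<phi> g' x)) (\<phi> a z') (\<phi> a (\<phi> h' x))"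
    using T.between_act[OF a tX(1)[OF G(3)] X(2) tX(1)[OF G(4)]] z(2) by simp
  have bw: "U.between (\<psi> a (\<psi> g' y)) (\<psi> a w') (\<psi> a (\<psi> h' y))"
    using U.between_act[OF a tX(2)[OF G(3)] X(4) tX(2)[OF G(4)]] w'(1) by simp
  have D: "d (\<phi> a (\<phi> g' x)) (\<phi> a z') = d (\<phi> g' x) z'" "d (\<phi> a z') (\<phi> a (\<phi> h' x)) = d z' (\<phi> h' x)"
    "e (\<psi> a (\<psi> g' y)) (\<psi> a w') = e (\<psi> g' y) w'" "e (\<psi> a w') (\<psi> a (\<psi> h' y)) = e w' (\<psi> h' y)"
    using T.act_dist[OF a] U.act_dist[OF a] tX G X by simp_all
  have C: "\<bar>e (\<psi> u y) (\<psi> a (\<psi> v y)) - d (\<phi> u x) (\<phi> a (\<phi> v x))\<bar> \<le> \<eta>"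
    if uv: "u \<in> {g, h}" "v \<in> {g', h'}" for u v
  proof -
    have "u \<in> carrier G" "v \<in> carrier G" using uv G by auto
    then show ?thesis
      using close[OF uv] T.dist_orbit[of u "a \<otimes> v" x] U.dist_orbit[of u "a \<otimes> v" y]
        T.act_mult[OF a, of v x] U.act_mult[OF a, of v y] a x y by simp
  qed
  have "0 \<le> \<eta>" using w(2) by linarith
  moreover have "\<bar>e (\<psi> g y) (\<psi> a (\<psi> g' y)) - d (\<phi> g x) (\<phi> a (\<phi> g' x))\<bar> \<le> \<eta>"
    "\<bar>e (\<psi> g y) (\<psi> a (\<psi> h' y)) - d (\<phi> g x) (\<phi> a (\<phi> h' x))\<bar> \<le> \<eta>"
    "\<bar>e (\<psi> h y) (\<psi> a (\<psi> g' y)) - d (\<phi> h x) (\<phi> a (\<phi> g' x))\<bar> \<le> \<eta>"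
    "\<bar>e (\<psi> h y) (\<psi> a (\<psi> h' y)) - d (\<phi> h x) (\<phi> a (\<phi> h' x))\<bar> \<le> \<eta>"
    by (rule C; simp)+
  moreover have "\<bar>e (\<psi> g y) w - d (\<phi> g x) z\<bar> \<le> 2 * \<eta>" "\<bar>e (\<psi> g' y) w' - d (\<phi> g' x) z'\<bar> \<le> 2 * \<eta>"
    using w(2) w'(2) \<open>0 \<le> \<eta>\<close> by linarith+
  ultimately have est: "\<bar>(e (\<psi> g y) (\<psi> a (\<psi> g' y)) - e (\<psi> g' y) w' - e (\<psi> g y) w) -
        (d (\<phi> g x) (\<phi> a (\<phi> g' x)) - d (\<phi> g' x) z' - d (\<phi> g x) z)\<bar> \<le> 5 * \<eta>"
    "\<bar>(e (\<psi> g y) (\<psi> a (\<psi> h' y)) - e w' (\<psi> h' y) - e (\<psi> g y) w) -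
        (d (\<phi> g x) (\<phi> a (\<phi> h' x)) - d z' (\<phi> h' x) - d (\<phi> g x) z)\<bar> \<le> 5 * \<eta>"
    "\<bar>(e (\<psi> h y) (\<psi> a (\<psi> g' y)) - e (\<psi> g' y) w' - e w (\<psi> h y)) -
        (d (\<phi> h x) (\<phi> a (\<phi> g' x)) - d (\<phi> g' x) z' - d z (\<phi> h x))\<bar> \<le> 5 * \<eta>"
    "\<bar>(e (\<psi> h y) (\<psi> a (\<psi> h' y)) - e w' (\<psi> h' y) - e w (\<psi> h y)) -
        (d (\<phi> h x) (\<phi> a (\<phi> h' x)) - d z' (\<phi> h' x) - d z (\<phi> h x))\<bar> \<le> 5 * \<eta>"
    using w(3) w'(3) by - (rule abs_diff3_le; assumption)+
  show ?thesis
    unfolding T.dist_segments[OF tX(1)[OF G(1)] tX(1)[OF G(2)] X(1) aX[OF tX(1)[OF G(3)]]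
        aX[OF tX(1)[OF G(4)]] aX[OF X(2)] z(1) bz]
      U.dist_segments[OF tX(2)[OF G(1)] tX(2)[OF G(2)] X(3) aY[OF tX(2)[OF G(3)]]
        aY[OF tX(2)[OF G(4)]] aY[OF X(4)] w(1) bw] D
    by (intro abs_max_diff_le est)
qed

end

section \<open>Axes\<close>

context metric_tree
begin

definition line :: "(real \<Rightarrow> 'p) \<Rightarrow> bool"
  where "line f \<longleftrightarrow> (\<forall>t. f t \<in> X) \<and> (\<forall>s t. d (f s) (f t) = \<bar>s - t\<bar>)"

lemma line_inj:
  assumes "line f" "f s = f t"
  shows "s = t"
proof -
  have "d (f s) (f t) = 0" using assms mdist_zero unfolding line_def by metis
  then show ?thesis using assms(1) by (simp add: line_def)
qed

text \<open>On a long segment of the line, \<open>dist_to_segment\<close> makes the distance a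
  maximum of two linear functions of slopes -1 and 1, that is, a constant plus
  \<open>\<bar>t - t0\<bar>\<close>; \<open>chain\<close> extends this to the rest of the
  line.\<close>

lemma line_projection:
  assumes f: "line f" and y: "y \<in> X"
  obtains t0 where "\<And>t. d y (f t) = d y (f t0) + \<bar>t - t0\<bar>"
proof -
  have fX: "f t \<in> X" and fd: "d (f s) (f t) = \<bar>s - t\<bar>" for s t
    using f by (simp_all add: line_def)
  \<comment> \<open>\<open>N\<close> exceeds the distance from \<open>y\<close> to
    \<open>f 0\<close>, which places the foot \<open>f t0\<close> strictly inside the segment from
    \<open>f (- N)\<close> to \<open>f N\<close>; \<open>t0\<close> is where the two terms of the
    maximum agree.\<close>
  define N where "N = d y (f 0) + 1"
  define t0 where "t0 = (d y (f (- N)) - d y (f N)) / 2"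
  have N: "0 < N" by (simp add: N_def add_nonneg_pos)
  have "d y (f N) \<le> d y (f 0) + N" "d y (f (- N)) \<le> d y (f 0) + N"
    "N \<le> d y (f N) + d y (f 0)" "N \<le> d y (f (- N)) + d y (f 0)"
    using triangle[OF y fX[of 0] fX[of N]] triangle[OF y fX[of 0] fX[of "- N"]]
      triangle[OF fX[of N] y fX[of 0]] triangle[OF fX[of "- N"] y fX[of 0]]
      fd[of 0 N] fd[of 0 "- N"] fd[of N 0] fd[of "- N" 0] N commute[of y "f N"] commute[of y "f (- N)"]
    by linarith+
  then have t0: "- N < t0" "t0 < N"
    using N_def unfolding t0_def by (simp_all add: field_simps)
  have inner: "d y (f t) = max (d y (f (- N)) - (t + N)) (d y (f N) - (N - t))"
    if "- N \<le> t" "t \<le> N" for t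
  proof -
    have "between (f (- N)) (f t) (f N)" using that N by (simp add: between_def fd)
    from dist_to_segment[OF fX fX fX y this] show ?thesis
      using that N commute[of y "f t"] commute[of y "f N"] commute[of y "f (- N)"] by (simp add: fd)
  qed
  have t0': "2 * t0 = d y (f (- N)) - d y (f N)" by (simp add: t0_def)
  have at0: "2 * d y (f t0) = d y (f (- N)) + d y (f N) - 2 * N"
    using inner[of t0] t0 t0' by (smt (verit))
  have mid: "d y (f t) = d y (f t0) + \<bar>t - t0\<bar>" if "- N \<le> t" "t \<le> N" for t
    using at0 inner[OF that] t0' by (smt (verit))
  have "d y (f t) = d y (f t0) + \<bar>t - t0\<bar>" for t
  proof -
    consider "- N \<le> t" "t \<le> N" | "N < t" | "t < - N" by linarith
    then show ?thesis
    proof cases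
      case 1
      then show ?thesis by (rule mid)
    next
      case 2
      have "f t0 \<noteq> f N" using line_inj[OF f] t0 by fastforce
      then show ?thesis
        using chain[OF y fX[of t0] fX[of N] fX[of t]] mid[of N] t0 N 2 by (simp add: between_def fd)
    next
      case 3
      have "f t0 \<noteq> f (- N)" using line_inj[OF f] t0 by fastforce
      then show ?thesis
        using chain[OF y fX[of t0] fX[of "- N"] fX[of t]] mid[of "- N"] t0 N 3
        by (simp add: between_def fd)
    qed
  qed
  then show thesis by (rule that)
qed

text \<open>The geodesics \<open>y, f t0, f t0'\<close> and \<open>f t0, f t0', y'\<close> overlap
  in a nondegenerate piece of the line, so \<open>chain\<close> glues them.\<close>

lemma line_gate:
  assumes f: "line f" and y: "y \<in> X" "y' \<in> X"
    and p: "\<And>t. d y (f t) = r + \<bar>t - t0\<bar>" and p': "\<And>t. d y' (f t) = r' + \<bar>t - t0'\<bar>"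
    and ne: "t0 \<noteq> t0'"
  shows "d y y' = r + \<bar>t0 - t0'\<bar> + r'"
proof -
  have fX: "f t \<in> X" and fd: "d (f s) (f t) = \<bar>s - t\<bar>" for s t
    using f by (simp_all add: line_def)
  have c: "d (f t) y' = r' + \<bar>t - t0'\<bar>" for t using p'[of t] commute[of y' "f t"] by simp
  have "between y (f t0) (f t0')" "between (f t0) (f t0') y'"
    using p[of t0] p[of t0'] c[of t0] c[of t0'] by (simp_all add: between_def fd)
  moreover have "f t0 \<noteq> f t0'" using line_inj[OF f] ne by blast
  ultimately show ?thesis
    using chain[OF y(1) fX fX y(2)] p[of t0] c[of t0'] by (simp add: fd)
qed

lemma line_convex:
  assumes f: "line f" and z: "z \<in> X" "between (f s) z (f t)"
  shows "z \<in> range f"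
proof -
  have fX: "f t \<in> X" and fd: "d (f s) (f t) = \<bar>s - t\<bar>" for s t
    using f by (simp_all add: line_def)
  define u where "u = (if s \<le> t then s + d (f s) z else s - d (f s) z)"
  have le: "d (f s) z \<le> \<bar>s - t\<bar>"
    using z(2) nonneg[of z "f t"] fd[of s t] unfolding between_def by linarith
  have "between (f s) (f u) (f t)" "d (f s) (f u) = d (f s) z"
    using le by (auto simp: between_def fd u_def)
  then have "z = f u" using between_unique[OF fX fX z(1) fX z(2)] by simp
  then show ?thesis by simp
qed

end

context tree_action
begin

lemma shift_inv:
  assumes "g \<in> carrier G" "line f" "\<And>t. \<phi> g (f t) = f (t + c)"
  shows "\<phi> (inv g) (f t) = f (t - c)"
  using act_inv(1)[of g "f (t - c)"] assms by (simp add: line_def)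

lemma shift_pow:
  assumes g: "g \<in> carrier G" and f: "line f" and c: "\<And>t. \<phi> g (f t) = f (t + c)"
  shows "\<phi> (g [^] (n::nat)) (f t) = f (t + real n * c)"
proof (induction n arbitrary: t)
  case 0
  then show ?case using f act_one by (simp add: line_def)
next
  case (Suc n)
  have "\<phi> (g [^] Suc n) (f t) = \<phi> (g [^] n) (\<phi> g (f t))"
    using act_mult[of "g [^] n" g "f t"] g f by (simp add: line_def)
  then show ?case using Suc.IH[of "t + c"] c by (simp add: algebra_simps)
qed

lemma line_translate:
  assumes "g \<in> carrier G" "line f"
  shows "line (\<lambda>t. \<phi> g (f t))"
  using assms act_in act_dist by (simp add: line_def)

text \<open>The projection of \<open>f\<^sub>1\<close> to \<open>f\<^sub>2\<close> is bounded, so a large power of \<open>h\<close> moves it off itself.\<close>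

lemma disjoint_translate:
  assumes h: "h \<in> carrier G" and f: "line f\<^sub>1" "line f\<^sub>2" and c: "\<And>t. \<phi> h (f\<^sub>2 t) = f\<^sub>2 (t + c)" "c \<noteq> 0"
    and R: "\<And>p q. p \<in> range f\<^sub>1 \<inter> range f\<^sub>2 \<Longrightarrow> q \<in> range f\<^sub>1 \<inter> range f\<^sub>2 \<Longrightarrow> d p q \<le> R"
  obtains a where "a \<in> carrier G" "\<And>s t. f\<^sub>1 s \<noteq> \<phi> a (f\<^sub>1 t)"
proof -
  \<comment> \<open>\<open>n \<noteq> 0\<close> is asked for separately: \<open>R\<close> may be
    negative when the lines are disjoint, and the shift must be nontrivial.\<close>
  obtain n :: nat where n: "R < real n * \<bar>c\<bar>" "n \<noteq> 0"
  proof -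
    obtain m :: nat where "R / \<bar>c\<bar> < real m" using reals_Archimedean2 by blast
    then have "R < real m * \<bar>c\<bar>" using c(2) by (simp add: field_simps)
    also have "\<dots> \<le> real (Suc m) * \<bar>c\<bar>" by (simp add: mult_right_mono)
    finally show thesis by (rule that) simp
  qed
  define a where "a = h [^] n"
  have a: "a \<in> carrier G" using h by (simp add: a_def)
  have shift: "\<phi> a (f\<^sub>2 t) = f\<^sub>2 (t + real n * c)" for t
    unfolding a_def by (rule shift_pow[OF h f(2) c(1)])
  have "f\<^sub>1 s \<noteq> \<phi> a (f\<^sub>1 t)" for s t
  proof
    assume eq: "f\<^sub>1 s = \<phi> a (f\<^sub>1 t)"
    have X: "f\<^sub>1 t \<in> X" "f\<^sub>2 t \<in> X" for t using f by (simp_all add: line_def)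
    have fd: "d (f\<^sub>2 s) (f\<^sub>2 t) = \<bar>s - t\<bar>" for s t using f by (simp add: line_def)
    obtain t0 where t0: "\<And>u. d (f\<^sub>1 t) (f\<^sub>2 u) = d (f\<^sub>1 t) (f\<^sub>2 t0) + \<bar>u - t0\<bar>"
      using line_projection[OF f(2) X(1)[of t]] by blast
    define r where "r = d (f\<^sub>1 t) (f\<^sub>2 t0)"
    have s0: "d (f\<^sub>1 s) (f\<^sub>2 u) = r + \<bar>u - (t0 + real n * c)\<bar>" for u
    proof -
      have "d (f\<^sub>1 s) (f\<^sub>2 u) = d (\<phi> a (f\<^sub>1 t)) (\<phi> a (f\<^sub>2 (u - real n * c)))"
        unfolding eq shift by simp
      also have "\<dots> = d (f\<^sub>1 t) (f\<^sub>2 (u - real n * c))" by (rule act_dist[OF a X])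
      finally show ?thesis using t0[of "u - real n * c"] by (simp add: r_def algebra_simps)
    qed
    \<comment> \<open>The feet of the two points on the second line differ by \<open>n * c\<close>.
      By \<open>line_gate\<close> the geodesic joining the points passes through both feet, which
      therefore lie on both lines, farther apart than \<open>R\<close>.\<close>
    have nc: "real n * c \<noteq> 0" using n(2) c(2) by simp
    then have D: "d (f\<^sub>1 t) (f\<^sub>1 s) = r + \<bar>real n * c\<bar> + r"
      using line_gate[OF f(2) X(1) X(1) t0 s0] by (simp add: r_def)
    have "between (f\<^sub>1 t) (f\<^sub>2 t0) (f\<^sub>1 s)" "between (f\<^sub>1 t) (f\<^sub>2 (t0 + real n * c)) (f\<^sub>1 s)"
      using D t0[of "t0 + real n * c"] s0[of t0] s0[of "t0 + real n * c"]
        commute[of "f\<^sub>1 s" "f\<^sub>2 t0"] commute[of "f\<^sub>1 s" "f\<^sub>2 (t0 + real n * c)"]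
      by (simp_all add: between_def r_def[symmetric])
    then have "f\<^sub>2 t0 \<in> range f\<^sub>1" "f\<^sub>2 (t0 + real n * c) \<in> range f\<^sub>1"
      using line_convex[OF f(1) X(2)] by blast+
    then have "d (f\<^sub>2 t0) (f\<^sub>2 (t0 + real n * c)) \<le> R" by (intro R IntI rangeI)
    then show False using n(1) by (simp add: fd abs_mult)
  qed
  with a show thesis by (rule that)
qed

text \<open>\<open>k\<close> is the conjugate of \<open>g\<close> by \<open>a\<close>, with the
  translate \<open>f3\<close> of \<open>f\<close> as axis. The transverse point is the foot
  \<open>x\<close> on \<open>f\<close> of the bridge to \<open>f3\<close>: from \<open>x\<close>,
  both \<open>k x\<close> and \<open>inv k x\<close> are reached across the bridge, hence off the
  two directions of \<open>f\<close>.\<close>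

lemma transverse_of_disjoint:
  assumes gh: "g \<in> carrier G" "a \<in> carrier G" and f: "line f" and c: "\<And>t. \<phi> g (f t) = f (t + c)" "c \<noteq> 0"
    and disj: "\<And>s t. f s \<noteq> \<phi> a (f t)"
  shows "\<exists>k x. transverse g k x"
proof -
  define k where "k = a \<otimes> g \<otimes> inv a"
  define f3 where "f3 t = \<phi> a (f t)" for t
  have k: "k \<in> carrier G" using gh by (simp add: k_def)
  have f3: "line f3" unfolding f3_def by (rule line_translate[OF gh(2) f])
  have X: "f t \<in> X" "f3 t \<in> X" for t using f f3 by (simp_all add: line_def)
  have fd: "d (f s) (f t) = \<bar>s - t\<bar>" for s t using f by (simp add: line_def)
  have ck: "\<phi> k (f3 t) = f3 (t + c)" for t
  proof -
    have "\<phi> k (f3 t) = \<phi> (a \<otimes> g) (\<phi> (inv a) (f3 t))"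
      using act_mult[of "a \<otimes> g" "inv a" "f3 t"] gh X by (simp add: k_def)
    also have "\<dots> = \<phi> a (\<phi> g (f t))"
      using act_inv(1)[OF gh(2) X(1)] act_mult[OF gh(2,1) X(1)] by (simp add: f3_def)
    finally show ?thesis by (simp add: c f3_def)
  qed
  obtain t1 where t1: "\<And>u. d (f3 0) (f u) = d (f3 0) (f t1) + \<bar>u - t1\<bar>"
    using line_projection[OF f X(2)[of 0]] by blast
  define x where "x = f t1"
  have x: "x \<in> X" using X by (simp add: x_def)
  \<comment> \<open>All points of \<open>f3\<close> have the same foot on \<open>f\<close>: two
    different feet would put \<open>x\<close> between two points of \<open>f3\<close>, hence on
    \<open>f3\<close>, against disjointness.\<close>
  have on_f: "d (f3 t) (f u) = d (f3 t) x + \<bar>u - t1\<bar>" for t u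
  proof -
    obtain t2 where t2: "\<And>u. d (f3 t) (f u) = d (f3 t) (f t2) + \<bar>u - t2\<bar>"
      using line_projection[OF f X(2)[of t]] by blast
    have "t1 = t2"
    proof (rule ccontr)
      assume "t1 \<noteq> t2"
      from line_gate[OF f X(2) X(2) t1 t2 this]
      have "between (f3 0) x (f3 t)"
        using t2[of t1] commute[of "f3 t" x] by (simp add: between_def x_def)
      then have "x \<in> range f3" by (rule line_convex[OF f3 x])
      then show False using disj by (auto simp: x_def f3_def)
    qed
    then show ?thesis using t2[of u] by (simp add: x_def)
  qed
  obtain s1 where s1: "\<And>t. d x (f3 t) = d x (f3 s1) + \<bar>t - s1\<bar>"
    using line_projection[OF f3 x] by blast
  define r where "r = d x (f3 s1)"
  have r: "0 \<le> r" by (simp add: r_def)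
  have on_f3: "d (f u) (f3 t) = (r + \<bar>u - t1\<bar>) + \<bar>t - s1\<bar>" for u t
    using on_f[of t u] s1[of t] commute[of "f u" "f3 t"] commute[of x "f3 t"] by (simp add: r_def)
  \<comment> \<open>\<open>w\<close> stands for \<open>k\<close> and for \<open>inv k\<close>. It
    shifts the foot of \<open>x\<close> on \<open>f3\<close> by \<open>b\<close>, so by
    \<open>line_gate\<close> the geodesic from \<open>w x\<close> to \<open>f u\<close> runs along
    \<open>f3\<close>, crosses the bridge and enters \<open>f\<close> at \<open>x\<close>.\<close>
  have key: "\<phi> w x \<noteq> x \<and> (\<forall>u. between (\<phi> w x) x (f u))"
    if w: "w \<in> carrier G" "\<And>t. \<phi> w (f3 t) = f3 (t + b)" "b \<noteq> 0" for w b
  proof -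
    have wX: "\<phi> w x \<in> X" using act_in w(1) x by simp
    have "d (\<phi> w x) (f3 t) = r + \<bar>t - (s1 + b)\<bar>" for t
    proof -
      have "d (\<phi> w x) (f3 t) = d (\<phi> w x) (\<phi> w (f3 (t - b)))" using w(2)[of "t - b"] by simp
      also have "\<dots> = d x (f3 (t - b))" by (rule act_dist[OF w(1) x X(2)])
      finally show ?thesis using s1[of "t - b"] by (simp add: r_def algebra_simps)
    qed
    from line_gate[OF f3 wX X(1) this on_f3]
    have D: "d (\<phi> w x) (f u) = r + \<bar>b\<bar> + (r + \<bar>u - t1\<bar>)" for u
      using w(3) by simp
    have Dx: "d (\<phi> w x) x = r + \<bar>b\<bar> + r" using D[of t1] by (simp add: x_def)
    then have "\<phi> w x \<noteq> x" using w(3) r mdist_zero[OF x] by fastforce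
    moreover have "between (\<phi> w x) x (f u)" for u
      using D[of u] Dx fd[of t1 u] by (simp add: between_def x_def)
    ultimately show ?thesis by blast
  qed
  have ik: "\<phi> (inv k) (f3 t) = f3 (t + - c)" for t using shift_inv[OF k f3 ck] by simp
  have gx: "\<phi> g x = f (t1 + c)" "\<phi> (inv g) x = f (t1 - c)"
    using c(1) shift_inv[OF gh(1) f c(1)] by (simp_all add: x_def)
  have "\<phi> g x \<noteq> x" using line_inj[OF f, of "t1 + c" t1] c(2) gx(1) by (auto simp: x_def)
  moreover have "between (\<phi> g x) x (\<phi> (inv g) x)" unfolding gx unfolding x_def between_def fd by simp
  ultimately have "transverse g k x"
    using key[OF k ck c(2)] key[OF inv_closed[OF k] ik] c(2) gh(1) k x gx
    by (simp add: transverse_def)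
  then show ?thesis by blast
qed

end

section \<open>Actions on a line\<close>

locale line_action = tree_action X d G \<phi>
  for X :: "'p set" and d and G :: "('g, 'm) monoid_scheme" (structure) and \<phi> +
  fixes f :: "real \<Rightarrow> 'p"
  assumes line_iso: "isometry_between UNIV dist X d f"
begin

lemma f_line: "line f" and f_range: "range f = X"
  using line_iso by (auto simp: line_def isometry_between_def bij_betw_def dist_real_def)

lemma f_in: "f t \<in> X" and f_dist: "d (f s) (f t) = \<bar>s - t\<bar>"
  using f_line by (simp_all add: line_def)

lemma f_cases:
  assumes "z \<in> X"
  obtains t where "z = f t"
  using assms f_range by blast

definition preserving :: "'g \<Rightarrow> bool"
  where "preserving s \<longleftrightarrow> (\<exists>c. \<forall>u. \<phi> s (f u) = f (u + c))"

definition reversing :: "'g \<Rightarrow> bool"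
  where "reversing s \<longleftrightarrow> (\<exists>c. \<forall>u. \<phi> s (f u) = f (c - u))"

lemma preserving_or_reversing:
  assumes s: "s \<in> carrier G"
  shows "preserving s \<or> reversing s"
proof -
  have "\<exists>v. \<phi> s (f u) = f v" for u using f_cases[OF act_in[OF s f_in]] by metis
  then obtain \<sigma> where \<sigma>: "\<And>u. \<phi> s (f u) = f (\<sigma> u)" by metis
  have iso: "\<bar>\<sigma> u - \<sigma> v\<bar> = \<bar>u - v\<bar>" for u v
    using act_dist[OF s f_in[of u] f_in[of v]] by (simp add: \<sigma> f_dist)
  have "\<sigma> 1 = \<sigma> 0 + 1 \<or> \<sigma> 1 = \<sigma> 0 - 1" using iso[of 1 0] by auto
  then show ?thesis
  proof
    assume 1: "\<sigma> 1 = \<sigma> 0 + 1"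
    have \<sigma>': "\<sigma> u = u + \<sigma> 0" for u using iso[of u 0] iso[of u 1] 1 by (auto simp: abs_if split: if_splits)
    have "\<phi> s (f u) = f (u + \<sigma> 0)" for u by (rule trans[OF \<sigma> arg_cong[OF \<sigma>', of f]])
    then show ?thesis unfolding preserving_def by blast
  next
    assume 1: "\<sigma> 1 = \<sigma> 0 - 1"
    have \<sigma>': "\<sigma> u = \<sigma> 0 - u" for u using iso[of u 0] iso[of u 1] 1 by (auto simp: abs_if split: if_splits)
    have "\<phi> s (f u) = f (\<sigma> 0 - u)" for u by (rule trans[OF \<sigma> arg_cong[OF \<sigma>', of f]])
    then show ?thesis unfolding reversing_def by blast
  qed
qed

lemma preserving_displacement:
  assumes s: "s \<in> carrier G" "preserving s" and z: "z \<in> X"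
  shows "d z (\<phi> s z) = len s"
proof -
  obtain c where c: "\<And>u. \<phi> s (f u) = f (u + c)" using s(2) by (auto simp: preserving_def)
  have D: "d w (\<phi> s w) = \<bar>c\<bar>" if "w \<in> X" for w
    by (rule f_cases[OF that]) (simp add: c f_dist)
  then show ?thesis using len_attained(2)[OF s(1) z] z by auto
qed

lemma reversing_fixed:
  assumes "s \<in> carrier G" "reversing s"
  obtains p where "p \<in> X" "\<phi> s p = p"
proof -
  obtain c where "\<And>u. \<phi> s (f u) = f (c - u)" using assms(2) by (auto simp: reversing_def)
  then show thesis by (intro that[of "f (c / 2)"] f_in) simp
qed

lemma reversing_len:
  assumes "s \<in> carrier G" "reversing s"
  shows "len s = 0"
proof -
  obtain p where "p \<in> X" "\<phi> s p = p" by (rule reversing_fixed[OF assms])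
  then show ?thesis using len_le[OF assms(1), of p] len_nonneg[OF assms(1)] by simp
qed

lemma mult_orientation:
  assumes "s \<in> carrier G" "t \<in> carrier G"
  shows "reversing s \<Longrightarrow> reversing t \<Longrightarrow> preserving (s \<otimes> t)"
    and "preserving s \<Longrightarrow> reversing t \<Longrightarrow> reversing (s \<otimes> t)"
proof -
  have m: "\<phi> (s \<otimes> t) (f u) = \<phi> s (\<phi> t (f u))" for u by (rule act_mult[OF assms f_in])
  show "preserving (s \<otimes> t)" if "reversing s" "reversing t"
  proof -
    from that obtain b c where "\<And>u. \<phi> s (f u) = f (b - u)" "\<And>u. \<phi> t (f u) = f (c - u)"
      by (auto simp: reversing_def)
    then have "\<phi> (s \<otimes> t) (f u) = f (u + (b - c))" for u by (simp add: m algebra_simps)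
    then show ?thesis by (auto simp: preserving_def)
  qed
  show "reversing (s \<otimes> t)" if "preserving s" "reversing t"
  proof -
    from that obtain b c where "\<And>u. \<phi> s (f u) = f (u + b)" "\<And>u. \<phi> t (f u) = f (c - u)"
      by (auto simp: reversing_def preserving_def)
    then have "\<phi> (s \<otimes> t) (f u) = f ((c + b) - u)" for u by (simp add: m algebra_simps)
    then show ?thesis unfolding reversing_def by blast
  qed
qed

text \<open>As \<open>k\<close> fixes \<open>x\<close>, both \<open>s\<close> and
  \<open>s \<otimes> k\<close> move \<open>x\<close> to the same point. One of them preserves
  orientation, so its length is its displacement everywhere; the other is a reflection and has
  length 0.\<close>

lemma displacement_at_fixed:
  assumes k: "k \<in> carrier G" "reversing k" and x: "x \<in> X" "\<phi> k x = x" and s: "s \<in> carrier G"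
  shows "d x (\<phi> s x) = max (len s) (len (s \<otimes> k))"
proof -
  have sk: "\<phi> (s \<otimes> k) x = \<phi> s x" "s \<otimes> k \<in> carrier G" using act_mult[OF s k(1) x(1)] x(2) s k(1) by simp_all
  consider "preserving s" | "reversing s" using preserving_or_reversing[OF s] by blast
  then show ?thesis
  proof cases
    case 1
    then show ?thesis
      using preserving_displacement[OF s 1 x(1)] len_nonneg[OF s]
        reversing_len[OF sk(2) mult_orientation(2)[OF s k(1) 1 k(2)]] by simp
  next
    case 2
    then show ?thesis
      using preserving_displacement[OF sk(2) mult_orientation(1)[OF s k(1) 2 k(2)] x(1)]
        reversing_len[OF s 2] len_nonneg[OF sk(2)] sk(1) by simp
  qed
qed

text \<open>A line has too few directions for a transverse pair. At the fixed point of a reflection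
  \<open>k\<close>, the witness is \<open>\<one>\<close> or \<open>k\<close> according to which of
  \<open>s\<close>, \<open>s \<otimes> k\<close> is longer; without reflections displacement equals
  length and \<open>\<one>\<close> serves at any point.\<close>

lemma taut_ex: "\<exists>x. taut x"
proof (cases "\<exists>k\<in>carrier G. reversing k")
  case True
  then obtain k where k: "k \<in> carrier G" "reversing k" by blast
  obtain x where x: "x \<in> X" "\<phi> k x = x" by (rule reversing_fixed[OF k])
  have "\<exists>t\<in>carrier G. d x (\<phi> s x) + d x (\<phi> t x) \<le> len (s \<otimes> t)" if s: "s \<in> carrier G" for s
  proof (cases "len (s \<otimes> k) \<le> len s")
    case True
    then have "d x (\<phi> s x) + d x (\<phi> \<one> x) \<le> len (s \<otimes> \<one>)"
      using displacement_at_fixed[OF k x s] act_one[OF x(1)] x(1) s by simp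
    then show ?thesis by blast
  next
    case False
    then have "d x (\<phi> s x) + d x (\<phi> k x) \<le> len (s \<otimes> k)"
      using displacement_at_fixed[OF k x s] x by simp
    then show ?thesis using k(1) by blast
  qed
  then show ?thesis using x(1) by (auto simp: taut_def)
next
  case False
  have "d (f 0) (\<phi> s (f 0)) + d (f 0) (\<phi> \<one> (f 0)) \<le> len (s \<otimes> \<one>)" if s: "s \<in> carrier G" for s
    using preserving_displacement[OF s _ f_in] preserving_or_reversing[OF s] False s
      act_one[OF f_in] f_in by auto
  then show ?thesis using f_in unfolding taut_def by blast
qed

lemma not_fixed:
  assumes xX: "x \<in> X" and hull: "orbit_hull x = X"
  shows "\<exists>s\<in>carrier G. \<phi> s x \<noteq> x"
proof (rule ccontr)
  assume "\<not> ?thesis"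
  then have fixed: "\<phi> s x = x" if "s \<in> carrier G" for s using that by blast
  have "z = x" if "z \<in> X" for z
  proof -
    have "z \<in> orbit_hull x" using that hull by simp
    then obtain g h where "g \<in> carrier G" "h \<in> carrier G" "between (\<phi> g x) z (\<phi> h x)"
      unfolding orbit_hull_def by blast
    then have "between x z x" by (simp add: fixed)
    then have "d x z = 0" using xX commute[of z x] by (simp add: between_def)
    then show ?thesis using mdist_pos_less[of x z] xX that by fastforce
  qed
  then have "f 0 = f 1" using f_in by metis
  then show False using line_inj[OF f_line, of 0 1] by simp
qed

end

context tree_action_pair
begin

text \<open>If \<open>k\<close> is a reflection of both lines, \<open>displacement_at_fixed\<close>
  expresses the displacements at its fixed points through the common lengths.\<close>

lemma orbit_transfer_reversing:
  assumes "line_action X d G \<phi> f" "line_action Y e G \<psi> f'"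
    and len: "\<And>s. s \<in> carrier G \<Longrightarrow> U.len s = T.len s"
    and k: "k \<in> carrier G" "line_action.reversing \<phi> f k" and hull: "\<And>x. x \<in> X \<Longrightarrow> T.orbit_hull x = X"
  shows "\<exists>x\<in>X. \<exists>y\<in>Y. \<forall>s\<in>carrier G. e y (\<psi> s y) = d x (\<phi> s x)"
proof -
  interpret A: line_action X d G \<phi> f by fact
  interpret B: line_action Y e G \<psi> f' by fact
  obtain x where x: "x \<in> X" "\<phi> k x = x" by (rule A.reversing_fixed[OF k])
  \<comment> \<open>Otherwise \<open>k\<close> is a translation of length 0 on \<open>Y\<close>,
    hence trivial there, and \<open>s\<close>, \<open>s \<otimes> k\<close> have equal lengths. On
    \<open>X\<close> one of the two is a reflection, so both lengths vanish and the whole group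
    fixes \<open>x\<close>, against \<open>not_fixed\<close>.\<close>
  have "B.reversing k"
  proof (rule ccontr)
    assume "\<not> B.reversing k"
    then have "B.preserving k" using B.preserving_or_reversing[OF k(1)] by blast
    then have trivial: "\<psi> k y = y" if "y \<in> Y" for y
      using B.preserving_displacement[OF k(1) _ that] len[OF k(1)] A.reversing_len[OF k]
        U.mdist_pos_less[of y "\<psi> k y"] U.act_in[OF k(1) that] that by fastforce
    have eq: "T.len (s \<otimes> k) = T.len s" if s: "s \<in> carrier G" for s
    proof -
      have "U.len (s \<otimes> k) = U.len s"
        unfolding U.len_def using U.act_mult[OF s k(1)] trivial
        by (intro arg_cong[of _ _ Least] ext arg_cong2[of _ _ _ _ "(\<in>)"] image_cong refl) simp
      then show ?thesis using len[of s] len[of "s \<otimes> k"] s k(1) by simp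
    qed
    have "\<phi> s x = x" if s: "s \<in> carrier G" for s
    proof -
      have sk: "s \<otimes> k \<in> carrier G" using s k(1) by simp
      have "T.len s = 0"
        using A.preserving_or_reversing[OF s] A.reversing_len[OF s]
          A.reversing_len[OF sk A.mult_orientation(2)[OF s k(1) _ k(2)]] eq[OF s] by auto
      then have "d x (\<phi> s x) = 0"
        using A.displacement_at_fixed[OF k x s] eq[OF s] by simp
      then show ?thesis using T.mdist_pos_less[of x "\<phi> s x"] x(1) T.act_in[OF s x(1)] by fastforce
    qed
    then show False using A.not_fixed[OF x(1) hull[OF x(1)]] by blast
  qed
  then obtain y where y: "y \<in> Y" "\<psi> k y = y" by (rule B.reversing_fixed[OF k(1)])
  have "e y (\<psi> s y) = d x (\<phi> s x)" if s: "s \<in> carrier G" for s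
    using A.displacement_at_fixed[OF k x s] B.displacement_at_fixed[OF k(1) \<open>B.reversing k\<close> y s]
      len[OF s] len[of "s \<otimes> k"] s k(1) by simp
  then show ?thesis using x(1) y(1) by blast
qed

lemma orbit_transfer_lines:
  assumes lines: "line_action X d G \<phi> f" "line_action Y e G \<psi> f'"
    and len: "\<And>s. s \<in> carrier G \<Longrightarrow> U.len s = T.len s"
    and hull: "\<And>x. x \<in> X \<Longrightarrow> T.orbit_hull x = X" "\<And>y. y \<in> Y \<Longrightarrow> U.orbit_hull y = Y"
  shows "\<exists>x\<in>X. \<exists>y\<in>Y. \<forall>s\<in>carrier G. e y (\<psi> s y) = d x (\<phi> s x)"
proof -
  interpret A: line_action X d G \<phi> f by fact
  interpret B: line_action Y e G \<psi> f' by fact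
  interpret swap: tree_action_pair Y e G \<psi> X d \<phi> by unfold_locales
  consider k where "k \<in> carrier G" "A.reversing k" | k where "k \<in> carrier G" "B.reversing k"
    | "\<forall>k\<in>carrier G. A.preserving k \<and> B.preserving k"
    using A.preserving_or_reversing B.preserving_or_reversing by blast
  then show ?thesis
  proof cases
    case 1
    show ?thesis by (rule orbit_transfer_reversing[OF lines len 1 hull(1)])
  next
    case 2
    have "\<exists>y\<in>Y. \<exists>x\<in>X. \<forall>s\<in>carrier G. d x (\<phi> s x) = e y (\<psi> s y)"
      by (rule swap.orbit_transfer_reversing[OF lines(2,1) len[symmetric] 2 hull(2)])
    then show ?thesis by metis
  next
    case 3
    then have "e (f' 0) (\<psi> s (f' 0)) = d (f 0) (\<phi> s (f 0))" if "s \<in> carrier G" for s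
      using A.preserving_displacement[OF that _ A.f_in] B.preserving_displacement[OF that _ B.f_in]
        len[OF that] that by simp
    then show ?thesis using A.f_in B.f_in by blast
  qed
qed

end

section \<open>Trees in \<open>\<T>\<^sub>s\<^sub>s\<close>\<close>

lemma gtree_action:
  assumes "group G" and T: "is_gtree G T"
  shows "tree_action (pts T) (tdist T) G (act T)"
proof -
  have R: "R_tree (pts T) (tdist T)" and A: "group_action G (pts T) (act T)"
    and iso: "\<And>g. g \<in> carrier G \<Longrightarrow> isometry_between (pts T) (tdist T) (pts T) (tdist T) (act T g)"
    using T by (simp_all add: is_gtree_def)
  interpret group G by fact
  interpret r_tree "pts T" "tdist T" by unfold_locales (fact R)
  interpret A: group_action G "pts T" "act T" by fact
  show ?thesis
  proof unfold_locales
    show "act T g x \<in> pts T" if "g \<in> carrier G" "x \<in> pts T" for g x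
      by (rule act_closed[OF T that])
    show "act T (g \<otimes>\<^bsub>G\<^esub> h) x = act T g (act T h x)"
      if "g \<in> carrier G" "h \<in> carrier G" "x \<in> pts T" for g h x
      by (rule A.composition_rule[OF that(3,1,2)])
    show "act T \<one>\<^bsub>G\<^esub> x = x" if "x \<in> pts T" for x
      using fun_cong[OF A.id_eq_one, of x] that by simp
    show "tdist T (act T g x) (act T g y) = tdist T x y"
      if "g \<in> carrier G" "x \<in> pts T" "y \<in> pts T" for g x y
      using iso[OF that(1)] that(2,3) by (simp add: isometry_between_def)
    show "pts T \<noteq> {}" using R by (simp add: R_tree_def)
  qed
qed

lemma length_function_len:
  assumes "group G" "is_gtree G T" "g \<in> carrier G"
  shows "length_function G T g = tree_action.len (pts T) (tdist T) (act T) g"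
proof -
  interpret tree_action "pts T" "tdist T" G "act T" by (rule gtree_action[OF assms(1,2)])
  show ?thesis using assms(3) by (simp add: length_function_def len_def)
qed

lemma minimal_orbit_hull:
  assumes "group G" "is_gtree G T" "minimal_gtree G T" "x \<in> pts T"
  shows "tree_action.orbit_hull (pts T) (tdist T) G (act T) x = pts T"
proof -
  interpret tree_action "pts T" "tdist T" G "act T" by (rule gtree_action[OF assms(1,2)])
  interpret R: r_tree "pts T" "tdist T"
    using assms(2) by unfold_locales (simp add: is_gtree_def)
  have "R_tree (orbit_hull x) (tdist T)"
    using R.R_tree_convex_in[OF orbit_hull_convex[OF assms(4)]] orbit_hull_base[OF assms(4)] by blast
  moreover have "\<forall>g\<in>carrier G. act T g ` orbit_hull x \<subseteq> orbit_hull x"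
    using orbit_hull_act[OF assms(4)] by blast
  ultimately have "\<not> orbit_hull x \<subset> pts T"
    using assms(3) unfolding minimal_gtree_def by blast
  moreover have "orbit_hull x \<subseteq> pts T" by (rule convex_in_subset[OF orbit_hull_convex[OF assms(4)]])
  ultimately show ?thesis by blast
qed

lemma irreducible_transverse:
  assumes "group G" and T: "is_gtree G T" and "irreducible_gtree G T"
  shows "\<exists>g k x. tree_action.transverse (pts T) (tdist T) G (act T) g k x"
proof -
  interpret tree_action "pts T" "tdist T" G "act T" by (rule gtree_action[OF assms(1,2)])
  obtain g h L M where gh: "g \<in> carrier G" "h \<in> carrier G" "hyperbolic T g" "hyperbolic T h"
    and L: "is_axis T g L" and M: "is_axis T h M" and cpt: "compactin mtopology (L \<inter> M)"
    using assms(3) unfolding irreducible_gtree_def by blast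
  have axis: "\<exists>f c. line f \<and> range f = K \<and> (\<forall>t. act T w (f t) = f (t + c)) \<and> c \<noteq> 0"
    if ax: "is_axis T w K" and hyp: "hyperbolic T w" for w K
  proof -
    obtain f :: "real \<Rightarrow> _" and c where f: "K \<subseteq> pts T" "isometry_between UNIV dist K (tdist T) f"
      "\<forall>t. act T w (f t) = f (t + c)"
      using ax unfolding is_axis_def by blast
    have "range f = K" and d: "tdist T (f s) (f t) = \<bar>s - t\<bar>" for s t
      using f(2) by (simp_all add: isometry_between_def bij_betw_def dist_real_def)
    moreover have "line f" using f(1) d \<open>range f = K\<close> by (auto simp: line_def)
    moreover have "c \<noteq> 0"
    proof
      assume "c = 0"
      then have "act T w (f 0) = f 0" using f(3) by simp
      moreover have "f 0 \<in> pts T" using f(1) \<open>range f = K\<close> by blast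
      ultimately show False using hyp by (simp add: hyperbolic_def)
    qed
    ultimately show ?thesis using f(3) by blast
  qed
  obtain f\<^sub>1 c\<^sub>1 where 1: "line f\<^sub>1" "range f\<^sub>1 = L" "\<And>t. act T g (f\<^sub>1 t) = f\<^sub>1 (t + c\<^sub>1)" "c\<^sub>1 \<noteq> 0"
    using axis[OF L gh(3)] by blast
  obtain f\<^sub>2 c\<^sub>2 where 2: "line f\<^sub>2" "range f\<^sub>2 = M" "\<And>t. act T h (f\<^sub>2 t) = f\<^sub>2 (t + c\<^sub>2)" "c\<^sub>2 \<noteq> 0"
    using axis[OF M gh(4)] by blast
  \<comment> \<open>Compactness of the intersection of the axes enters as a bound on its
    diameter.\<close>
  obtain R where R: "\<And>p q. p \<in> L \<inter> M \<Longrightarrow> q \<in> L \<inter> M \<Longrightarrow> tdist T p q \<le> R"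
    using compactin_imp_mbounded[OF cpt] unfolding mbounded_alt by blast
  obtain a where a: "a \<in> carrier G" "\<And>s t. f\<^sub>1 s \<noteq> act T a (f\<^sub>1 t)"
    using disjoint_translate[OF gh(2) 1(1) 2(1,3,4), of R] R 1(2) 2(2) by metis
  show ?thesis
    using transverse_of_disjoint[OF gh(1) a(1) 1(1,3,4) a(2)] by blast
qed

lemma isometric_to_line_action:
  assumes "group G" "is_gtree G T" "isometric_to_line T"
  shows "\<exists>f. line_action (pts T) (tdist T) G (act T) f"
  using assms gtree_action[OF assms(1,2)]
  by (auto simp: isometric_to_line_def line_action_def line_action_axioms_def)

lemma ss_trees_taut:
  assumes "group G" "T \<in> ss_trees G"
  shows "\<exists>x. tree_action.taut (pts T) (tdist T) G (act T) x"
proof -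
  have T: "is_gtree G T" "irreducible_gtree G T \<or> isometric_to_line T"
    using assms(2) by (simp_all add: ss_trees_def)
  from T(2) show ?thesis
  proof
    assume "irreducible_gtree G T"
    then obtain g k x where "tree_action.transverse (pts T) (tdist T) G (act T) g k x"
      using irreducible_transverse[OF assms(1) T(1)] by blast
    from tree_action.transverse_taut[OF gtree_action[OF assms(1) T(1)] this]
    show ?thesis by blast
  next
    assume "isometric_to_line T"
    then show ?thesis
      using isometric_to_line_action[OF assms(1) T(1)] by (blast intro: line_action.taut_ex)
  qed
qed

lemma orbit_equal_imp_equivariantly_isometric:
  assumes "group G" and T: "T \<in> ss_trees G" and T': "T' \<in> ss_trees G"
    and x: "x \<in> pts T" and y: "y \<in> pts T'"
    and eq: "\<And>s. s \<in> carrier G \<Longrightarrow> tdist T' y (act T' s y) = tdist T x (act T s x)"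
  shows "equivariantly_isometric G T T'"
proof -
  have G: "is_gtree G T" "is_gtree G T'" and m: "minimal_gtree G T" "minimal_gtree G T'"
    using T T' by (simp_all add: ss_trees_def)
  interpret tree_action_pair "pts T" "tdist T" G "act T" "pts T'" "tdist T'" "act T'"
    unfolding tree_action_pair_def using gtree_action[OF assms(1)] G by blast
  show ?thesis
    unfolding equivariantly_isometric_def
    by (rule equivariant_isometry_of_orbits[OF x y eq minimal_orbit_hull[OF assms(1) G(1) m(1) x]
          minimal_orbit_hull[OF assms(1) G(2) m(2) y]])
qed

lemma irreducible_equivariantly_isometric:
  assumes "group G" and T: "T \<in> ss_trees G" and T': "T' \<in> ss_trees G" and "irreducible_gtree G T"
    and len: "length_function G T = length_function G T'"
  shows "equivariantly_isometric G T T'"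
proof -
  have G: "is_gtree G T" "is_gtree G T'" using T T' by (simp_all add: ss_trees_def)
  interpret tree_action_pair "pts T" "tdist T" G "act T" "pts T'" "tdist T'" "act T'"
    unfolding tree_action_pair_def using gtree_action[OF assms(1)] G by blast
  obtain g k x where tr: "T.transverse g k x"
    using irreducible_transverse[OF assms(1) G(1) assms(4)] by blast
  have len': "U.len s = T.len s" if "s \<in> carrier G" for s
    using length_function_len[OF assms(1) G(1) that] length_function_len[OF assms(1) G(2) that] len
    by simp
  have x: "x \<in> pts T" using tr by (simp add: T.transverse_def)
  show ?thesis
  proof (rule orbit_transfer[OF len' tr])
    fix y assume "y \<in> pts T'" "\<And>s. s \<in> carrier G \<Longrightarrow> tdist T' y (act T' s y) = tdist T x (act T s x)"
    then show ?thesis by (rule orbit_equal_imp_equivariantly_isometric[OF assms(1) T T' x])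
  qed
qed

lemma equal_length_equivariantly_isometric:
  assumes "group G" and T: "T \<in> ss_trees G" and T': "T' \<in> ss_trees G"
    and len: "length_function G T = length_function G T'"
  shows "equivariantly_isometric G T T'"
proof -
  have G: "is_gtree G T" "is_gtree G T'" and m: "minimal_gtree G T" "minimal_gtree G T'"
    using T T' by (simp_all add: ss_trees_def)
  \<comment> \<open>A transverse pair of an irreducible tree is carried to the other tree whatever
    its type, so mixed pairs are covered by the first two cases.\<close>
  consider "irreducible_gtree G T" | "irreducible_gtree G T'"
    | "isometric_to_line T" "isometric_to_line T'"
    using T T' by (auto simp: ss_trees_def)
  then show ?thesis
  proof cases
    case 1
    then show ?thesis by (rule irreducible_equivariantly_isometric[OF assms(1) T T' _ len])
  next
    case 2
    have "equivariantly_isometric G T' T"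
      by (rule irreducible_equivariantly_isometric[OF assms(1) T' T 2 len[symmetric]])
    then show ?thesis by (rule equivariantly_isometric_sym[OF G(2)])
  next
    case 3
    obtain f where f: "line_action (pts T) (tdist T) G (act T) f"
      using isometric_to_line_action[OF assms(1) G(1) 3(1)] by blast
    obtain f' where f': "line_action (pts T') (tdist T') G (act T') f'"
      using isometric_to_line_action[OF assms(1) G(2) 3(2)] by blast
    interpret tree_action_pair "pts T" "tdist T" G "act T" "pts T'" "tdist T'" "act T'"
      unfolding tree_action_pair_def using gtree_action[OF assms(1)] G by blast
    have "U.len s = T.len s" if "s \<in> carrier G" for s
      using length_function_len[OF assms(1) G(1) that] length_function_len[OF assms(1) G(2) that] len
      by simp
    note orbit_transfer_lines[OF f f' this minimal_orbit_hull[OF assms(1) G(1) m(1)]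
        minimal_orbit_hull[OF assms(1) G(2) m(2)]]
    then show ?thesis
      using orbit_equal_imp_equivariantly_isometric[OF assms(1) T T'] by blast
  qed
qed

section \<open>Comparison of the topologies\<close>

text \<open>Since \<open>T\<close> is the hull of the orbit of a taut point, finitely many points of \<open>T\<close> are
  described by finitely many displacements of that point.\<close>

lemma length_nbhd_in_gromov_nbhd:
  fixes T :: "('g, 'p) gtree" and G (structure) and x :: "nat \<Rightarrow> 'p"
  assumes "group G" and T: "T \<in> ss_trees G" and A: "finite A" "A \<subseteq> carrier G"
    and x: "\<forall>i\<in>{1..n}. x i \<in> pts T" and \<epsilon>: "\<epsilon> > (0::real)"
  obtains B \<delta> where "finite B" "B \<subseteq> carrier G" "\<delta> > 0"
    "\<And>T' :: ('g, 'p) gtree. T' \<in> ss_trees G \<Longrightarrow>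
      (\<And>b. b \<in> B \<Longrightarrow> \<bar>length_function G T' b - length_function G T b\<bar> < \<delta>) \<Longrightarrow>
      \<exists>x'. (\<forall>i\<in>{1..n}. x' i \<in> pts T') \<and>
       (\<forall>a\<in>A. \<forall>i\<in>{1..n}. \<forall>j\<in>{1..n}.
          \<bar>tdist T' (x' i) (act T' a (x' j)) - tdist T (x i) (act T a (x j))\<bar> \<le> \<epsilon>)"
proof -
  have G: "is_gtree G T" "minimal_gtree G T" using T by (simp_all add: ss_trees_def)
  interpret T: tree_action "pts T" "tdist T" G "act T" by (rule gtree_action[OF assms(1) G(1)])
  obtain z where z: "T.taut z" using ss_trees_taut[OF assms(1) T] by blast
  then have zX: "z \<in> pts T" by (simp add: T.taut_def)
  have "\<exists>g h. i \<in> {1..n} \<longrightarrow> g \<in> carrier G \<and> h \<in> carrier G \<and> T.between (act T g z) (x i) (act T h z)" for i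
    using minimal_orbit_hull[OF assms(1) G zX] x unfolding T.orbit_hull_def by blast
  then obtain g h where gh: "\<And>i. i \<in> {1..n} \<Longrightarrow> g i \<in> carrier G" "\<And>i. i \<in> {1..n} \<Longrightarrow> h i \<in> carrier G"
    "\<And>i. i \<in> {1..n} \<Longrightarrow> T.between (act T (g i) z) (x i) (act T (h i) z)"
    by metis
  define W where "W = g ` {1..n} \<union> h ` {1..n}"
  have W: "finite W" "W \<subseteq> carrier G" using gh(1,2) by (auto simp: W_def)
  \<comment> \<open>\<open>inv u \<otimes> v\<close> measures the segments carrying the points
    \<open>x i\<close>; \<open>inv u \<otimes> (a \<otimes> v)\<close> measures from the ends of one
    segment to the \<open>a\<close>-translates of the ends of another.\<close>
  define F where "F = (\<lambda>(u, v). inv u \<otimes> v) ` (W \<times> W) \<union> (\<lambda>(u, a, v). inv u \<otimes> (a \<otimes> v)) ` (W \<times> A \<times> W)"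
  have F: "finite F" using W(1) A(1) by (simp add: F_def)
  have FG: "F \<subseteq> carrier G"
  proof
    fix s assume "s \<in> F"
    then consider u v where "u \<in> W" "v \<in> W" "s = inv u \<otimes> v"
      | u a v where "u \<in> W" "a \<in> A" "v \<in> W" "s = inv u \<otimes> (a \<otimes> v)"
      unfolding F_def by auto
    then show "s \<in> carrier G"
    proof cases
      case 1
      then show ?thesis using subsetD[OF W(2)] by simp
    next
      case 2
      then show ?thesis using subsetD[OF W(2)] subsetD[OF A(2)] by simp
    qed
  qed
  have F1: "inv u \<otimes> v \<in> F" if "u \<in> W" "v \<in> W" for u v
    unfolding F_def using that by (intro UnI1 image_eqI[of _ _ "(u, v)"]) simp_all
  have F2: "inv u \<otimes> (a \<otimes> v) \<in> F" if "u \<in> W" "a \<in> A" "v \<in> W" for u a v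
    unfolding F_def using that by (intro UnI2 image_eqI[of _ _ "(u, a, v)"]) simp_all
  show thesis
  \<comment> \<open>\<open>orbit_approx\<close> doubles the tolerance to
    \<open>\<eta> = \<epsilon> / 5\<close>, and \<open>segments_dist_transfer\<close> multiplies
    \<open>\<eta>\<close> by 5; hence \<open>\<epsilon> / 10\<close>.\<close>
  proof (rule that[of "T.test_set z F" "\<epsilon> / 10"])
    show "finite (T.test_set z F)" "T.test_set z F \<subseteq> carrier G" by (rule T.test_set[OF z F FG])+
    show "\<epsilon> / 10 > 0" using \<epsilon> by simp
    fix T' :: "('g, 'p) gtree"
    assume T': "T' \<in> ss_trees G"
      and close: "\<And>b. b \<in> T.test_set z F \<Longrightarrow> \<bar>length_function G T' b - length_function G T b\<bar> < \<epsilon> / 10"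
    have G': "is_gtree G T'" using T' by (simp add: ss_trees_def)
    interpret tree_action_pair "pts T" "tdist T" G "act T" "pts T'" "tdist T'" "act T'"
      unfolding tree_action_pair_def using gtree_action[OF assms(1)] G G' by blast
    have "\<bar>U.len s - T.len s\<bar> \<le> \<epsilon> / 10" if s: "s \<in> T.test_set z F" for s
      using close[OF s] length_function_len[OF assms(1) G(1)] length_function_len[OF assms(1) G']
        subsetD[OF T.test_set(2)[OF z F FG] s] by simp
    then obtain y where y: "y \<in> pts T'"
      "\<And>s. s \<in> F \<Longrightarrow> \<bar>tdist T' y (act T' s y) - tdist T z (act T s z)\<bar> \<le> 2 * (\<epsilon> / 10)"
      using orbit_approx[OF z F FG, of "\<epsilon> / 10"] \<epsilon> by (metis divide_nonneg_pos less_eq_real_def zero_less_numeral)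
    define \<eta> where "\<eta> = 2 * (\<epsilon> / 10)"
    have gW: "g i \<in> W" "h i \<in> W" if "i \<in> {1..n}" for i using that by (simp_all add: W_def)
    have "\<exists>w. i \<in> {1..n} \<longrightarrow> w \<in> pts T' \<and> U.between (act T' (g i) y) w (act T' (h i) y) \<and>
        \<bar>tdist T' (act T' (g i) y) w - tdist T (act T (g i) z) (x i)\<bar> \<le> \<eta> \<and>
        \<bar>tdist T' w (act T' (h i) y) - tdist T (x i) (act T (h i) z)\<bar> \<le> 2 * \<eta>" for i
    proof (cases "i \<in> {1..n}")
      case True
      have "\<bar>tdist T' y (act T' (inv (g i) \<otimes> h i) y) - tdist T z (act T (inv (g i) \<otimes> h i) z)\<bar> \<le> \<eta>"
        unfolding \<eta>_def by (rule y(2)[OF F1[OF gW[OF True]]])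
      from segment_transfer[OF zX y(1) gh(1,2)[OF True] this gh(3)[OF True]]
      show ?thesis by blast
    qed blast
    then obtain x' where x': "\<And>i. i \<in> {1..n} \<Longrightarrow> x' i \<in> pts T'"
      "\<And>i. i \<in> {1..n} \<Longrightarrow> U.between (act T' (g i) y) (x' i) (act T' (h i) y)"
      "\<And>i. i \<in> {1..n} \<Longrightarrow> \<bar>tdist T' (act T' (g i) y) (x' i) - tdist T (act T (g i) z) (x i)\<bar> \<le> \<eta>"
      "\<And>i. i \<in> {1..n} \<Longrightarrow> \<bar>tdist T' (x' i) (act T' (h i) y) - tdist T (x i) (act T (h i) z)\<bar> \<le> 2 * \<eta>"
      by metis
    have "\<bar>tdist T' (x' i) (act T' a (x' j)) - tdist T (x i) (act T a (x j))\<bar> \<le> \<epsilon>"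
      if a: "a \<in> A" and ij: "i \<in> {1..n}" "j \<in> {1..n}" for a i j
    proof -
      have "\<bar>tdist T' y (act T' (inv u \<otimes> (a \<otimes> v)) y) - tdist T z (act T (inv u \<otimes> (a \<otimes> v)) z)\<bar> \<le> \<eta>"
        if uv: "u \<in> {g i, h i}" "v \<in> {g j, h j}" for u v
      proof -
        have "u \<in> W" "v \<in> W" using uv gW[OF ij(1)] gW[OF ij(2)] by blast+
        then show ?thesis unfolding \<eta>_def by (intro y(2) F2 a)
      qed
      from segments_dist_transfer[OF zX y(1) subsetD[OF A(2) a] gh(1,2)[OF ij(1)] gh(1,2)[OF ij(2)]
          bspec[OF x ij(1)] bspec[OF x ij(2)] x'(1)[OF ij(1)] x'(1)[OF ij(2)] this
          gh(3)[OF ij(1)] gh(3)[OF ij(2)] x'(2-4)[OF ij(1)] x'(2-4)[OF ij(2)]]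
      show ?thesis by (simp add: \<eta>_def)
    qed
    with x'(1) show "\<exists>x'. (\<forall>i\<in>{1..n}. x' i \<in> pts T') \<and>
       (\<forall>a\<in>A. \<forall>i\<in>{1..n}. \<forall>j\<in>{1..n}.
          \<bar>tdist T' (x' i) (act T' a (x' j)) - tdist T (x i) (act T a (x j))\<bar> \<le> \<epsilon>)"
      by blast
  qed
qed

lemma Tss_nonempty_class:
  assumes "C \<in> Tss G"
  obtains T where "T \<in> C"
  using assms in_quotient_imp_non_empty[OF equiv_eqiso_rel] unfolding Tss_def by blast

text \<open>Basic open sets of the product topology are \<open>Pi\<^sub>E\<close> boxes, whose
  members are extensional.\<close>

lemma class_length_function_extensional:
  assumes "C \<in> Tss G"
  shows "class_length_function G C \<in> extensional (carrier G)"
proof -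
  obtain T where T: "T \<in> C" by (rule Tss_nonempty_class[OF assms])
  show ?thesis unfolding length_function_class[OF assms T] length_function_def by simp
qed

lemma gromov_open_imp_axes_open:
  fixes U :: "('g, 'p) gtree set set"
  assumes "group G" and U: "gromov_open G U"
  shows "openin (axes_topology G) U"
proof (subst openin_subopen, intro ballI)
  fix C assume C: "C \<in> U"
  then have CT: "C \<in> Tss G" using U by (auto simp: gromov_open_def)
  obtain T where T: "T \<in> C" by (rule Tss_nonempty_class[OF CT])
  have Tss: "T \<in> ss_trees G" by (rule Tss_cases(1)[OF CT T])
  obtain \<epsilon> A n x where e: "\<epsilon> > 0" "finite A" "A \<subseteq> carrier G" "\<forall>i\<in>{1..n}. x i \<in> pts T"
    "gromov_nbhd G T \<epsilon> A n x \<subseteq> U"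
    by (rule gromov_openE[OF U C T])
  obtain B \<delta> where B: "finite B" "B \<subseteq> carrier G" "\<delta> > 0"
    and near: "\<And>T' :: ('g, 'p) gtree. T' \<in> ss_trees G \<Longrightarrow>
      (\<And>b. b \<in> B \<Longrightarrow> \<bar>length_function G T' b - length_function G T b\<bar> < \<delta>) \<Longrightarrow>
      \<exists>x'. (\<forall>i\<in>{1..n}. x' i \<in> pts T') \<and>
       (\<forall>a\<in>A. \<forall>i\<in>{1..n}. \<forall>j\<in>{1..n}.
          \<bar>tdist T' (x' i) (act T' a (x' j)) - tdist T (x i) (act T a (x j))\<bar> \<le> \<epsilon>)"
    using length_nbhd_in_gromov_nbhd[OF assms(1) Tss e(2,3,4,1)] by metis
  define l where "l = class_length_function G C"
  have l: "l = length_function G T" unfolding l_def by (rule length_function_class[OF CT T])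
  \<comment> \<open>Only the finitely many coordinates in \<open>B\<close> are restricted, as
    openness of a box in the product topology demands.\<close>
  define S where "S b = (if b \<in> B then ball (l b) \<delta> else UNIV)" for b
  define V where "V = Pi\<^sub>E (carrier G) S"
  have "{b \<in> carrier G. S b \<noteq> topspace euclideanreal} \<subseteq> B" by (auto simp: S_def)
  then have "openin (product_topology (\<lambda>_. euclideanreal) (carrier G)) V"
    unfolding V_def openin_PiE_gen using finite_subset[OF _ B(1)] by (auto simp: S_def)
  then have "openin (axes_topology G) (class_length_function G -` V \<inter> Tss G)"
    unfolding axes_topology_def openin_pullback_topology by blast
  moreover have "C \<in> class_length_function G -` V \<inter> Tss G"
    using CT class_length_function_extensional[OF CT] B(3)
    by (auto simp: V_def S_def l_def PiE_def)
  moreover have "class_length_function G -` V \<inter> Tss G \<subseteq> U"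
  proof
    fix D :: "('g, 'p) gtree set" assume "D \<in> class_length_function G -` V \<inter> Tss G"
    then have D: "D \<in> Tss G" "class_length_function G D \<in> V" by simp_all
    obtain T' where T': "T' \<in> D" by (rule Tss_nonempty_class[OF D(1)])
    have "\<bar>length_function G T' b - length_function G T b\<bar> < \<delta>" if b: "b \<in> B" for b
    proof -
      have "class_length_function G D b \<in> S b"
        using D(2) B(2) b unfolding V_def by (auto dest: PiE_mem)
      then show ?thesis
        using b unfolding length_function_class[OF D(1) T'] l
        by (simp add: S_def l dist_real_def abs_minus_commute)
    qed
    from near[OF Tss_cases(1)[OF D(1) T'] this]
    have "D \<in> gromov_nbhd G T \<epsilon> A n x"
      using D(1) T' unfolding gromov_nbhd_def by blast
    then show "D \<in> U" using e(5) by blast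
  qed
  ultimately show "\<exists>W. openin (axes_topology G) W \<and> C \<in> W \<and> W \<subseteq> U" by blast
qed

lemma axes_open_imp_gromov_open:
  fixes U :: "('g, 'p) gtree set set" and G (structure)
  assumes "group G" and U: "openin (axes_topology G) U"
  shows "gromov_open G U"
  unfolding gromov_open_def
proof (intro conjI ballI)
  interpret group G by fact
  obtain V where V: "openin (product_topology (\<lambda>_. euclideanreal) (carrier G)) V"
    "U = class_length_function G -` V \<inter> Tss G"
    using U unfolding axes_topology_def openin_pullback_topology by blast
  show "U \<subseteq> Tss G" using V(2) by blast
  fix C T assume C: "C \<in> U" and T: "T \<in> C"
  have CT: "C \<in> Tss G" "class_length_function G C \<in> V" using C V(2) by simp_all
  then have lV: "length_function G T \<in> V" using length_function_class[OF CT(1) T] by simp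
  have Tss: "is_gtree G T" using Tss_cases(1)[OF CT(1) T] by (simp add: ss_trees_def)
  define l where "l = length_function G T"
  obtain S where S: "finite {b \<in> carrier G. S b \<noteq> UNIV}" "\<And>b. b \<in> carrier G \<Longrightarrow> open (S b)"
    "l \<in> Pi\<^sub>E (carrier G) S" "Pi\<^sub>E (carrier G) S \<subseteq> V"
    using V(1) lV unfolding openin_product_topology_alt l_def by auto
  define B where "B = {b \<in> carrier G. S b \<noteq> UNIV}"
  have "\<exists>r>0. ball (l b) r \<subseteq> S b" if "b \<in> carrier G" for b
    using S(2)[OF that] PiE_mem[OF S(3) that] by (simp add: open_contains_ball)
  then obtain r where r: "\<And>b. b \<in> carrier G \<Longrightarrow> 0 < r b" "\<And>b. b \<in> carrier G \<Longrightarrow> ball (l b) (r b) \<subseteq> S b"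
    by metis
  \<comment> \<open>The lengths will differ by at most \<open>2 * \<epsilon>\<close>, strictly less
    than \<open>4 * \<epsilon>\<close>, so they land in the open balls; the 1 keeps the minimum
    defined when \<open>B\<close> is empty.\<close>
  define \<epsilon> where "\<epsilon> = Min (insert 1 (r ` B)) / 4"
  have \<epsilon>: "\<epsilon> > 0" "\<And>b. b \<in> B \<Longrightarrow> 4 * \<epsilon> \<le> r b"
    using S(1) r(1) unfolding \<epsilon>_def B_def by auto
  \<comment> \<open>Squares are included because the length of \<open>b\<close> is read off from the
    displacements of one point under \<open>b\<close> and \<open>b \<otimes> b\<close>.\<close>
  define A where "A = B \<union> (\<lambda>b. b \<otimes> b) ` B"
  have A: "finite A" "A \<subseteq> carrier G" using S(1) by (auto simp: A_def B_def)
  interpret T: tree_action "pts T" "tdist T" G "act T" by (rule gtree_action[OF assms(1) Tss])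
  obtain z where z: "z \<in> pts T" using T.nonempty by blast
  have "gromov_nbhd G T \<epsilon> A 1 (\<lambda>_. z) \<subseteq> U"
  proof
    fix D assume "D \<in> gromov_nbhd G T \<epsilon> A 1 (\<lambda>_. z)"
    then obtain T' x' where D: "D \<in> Tss G" "T' \<in> D" "x' (1::nat) \<in> pts T'"
      "\<And>a. a \<in> A \<Longrightarrow> \<bar>tdist T' (x' 1) (act T' a (x' 1)) - tdist T z (act T a z)\<bar> \<le> \<epsilon>"
      unfolding gromov_nbhd_def by auto
    have Tss': "is_gtree G T'" using Tss_cases(1)[OF D(1,2)] by (simp add: ss_trees_def)
    interpret U: tree_action "pts T'" "tdist T'" G "act T'" by (rule gtree_action[OF assms(1) Tss'])
    have "length_function G T' b \<in> S b" if b: "b \<in> carrier G" for b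
    proof (cases "b \<in> B")
      case True
      have "T.len b = max 0 (tdist T z (act T (b \<otimes> b) z) - tdist T z (act T b z))"
        using T.len_attained(1)[OF b z] T.act_mult[OF b b z] by simp
      moreover have "U.len b = max 0 (tdist T' (x' 1) (act T' (b \<otimes> b) (x' 1)) - tdist T' (x' 1) (act T' b (x' 1)))"
        using U.len_attained(1)[OF b D(3)] U.act_mult[OF b b D(3)] by simp
      moreover have "b \<in> A" "b \<otimes> b \<in> A" using True by (auto simp: A_def)
      note D(4)[OF this(1)] D(4)[OF this(2)]
      ultimately have "\<bar>U.len b - T.len b\<bar> \<le> 2 * \<epsilon>"
        by (simp add: max_def abs_le_iff)
      then have "length_function G T' b \<in> ball (l b) (r b)"
        using length_function_len[OF assms(1) Tss b] length_function_len[OF assms(1) Tss' b]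
          \<epsilon>(1) \<epsilon>(2)[OF True] by (simp add: l_def dist_real_def abs_minus_commute)
      then show ?thesis using r(2)[OF b] by blast
    next
      case False
      then show ?thesis using b by (simp add: B_def)
    qed
    then have "length_function G T' \<in> Pi\<^sub>E (carrier G) S"
      by (simp add: length_function_def PiE_def Pi_def)
    then show "D \<in> U"
      using S(4) D(1) length_function_class[OF D(1,2)] V(2) by auto
  qed
  then show "\<exists>\<epsilon> A n x. \<epsilon> > 0 \<and> finite A \<and> A \<subseteq> carrier G \<and>
       (\<forall>i\<in>{1..n}. x i \<in> pts T) \<and> gromov_nbhd G T \<epsilon> A n x \<subseteq> U"
    using \<epsilon>(1) A z
    by (intro exI[of _ \<epsilon>] exI[of _ A] exI[of _ "1::nat"] exI[of _ "\<lambda>_. z"]) simp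
qed

theorem theorem3p5:
  fixes G :: "('g, 'm) monoid_scheme"
  assumes "group G" and "countable (carrier G)"
  shows "(\<forall>T \<in> (ss_trees G :: ('g, 'p) gtree set). \<forall>T' \<in> ss_trees G.
            length_function G T = length_function G T' \<longrightarrow> equivariantly_isometric G T T')
       \<and> (equivariant_gromov_topology G :: ('g, 'p) gtree set topology) = axes_topology G"
proof
  show "\<forall>T \<in> (ss_trees G :: ('g, 'p) gtree set). \<forall>T' \<in> ss_trees G.
      length_function G T = length_function G T' \<longrightarrow> equivariantly_isometric G T T'"
    using equal_length_equivariantly_isometric[OF assms(1)] by blast
  show "(equivariant_gromov_topology G :: ('g, 'p) gtree set topology) = axes_topology G"
    unfolding topology_eq openin_equivariant_gromov_topology
    using gromov_open_imp_axes_open[OF assms(1)] axes_open_imp_gromov_open[OF assms(1)] by blast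
qed

end
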